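(* Let $r:\mathbb R\to\mathbb R$ be such that $v=r'$ is twice continuously differentiable with $|v(t)|+|v'(t)|+|v''(t)|\le C$ for all $t$, and such that $\beta=v/c$ satisfies $\check\beta\le|\beta(t)|\le\hat\epsilon_1<1$ for all $t\in\mathbb R$, for some constants $\check\beta>0$, $\hat\epsilon_1<1$. Let $\hat{\mathbf r}(t)=(0,0,r(t))$. Then for any $T_-<T_+$ there exist sequences $a_n$, $R_n$, $\chi_n$ and potentials $\varphi_n$ such that the KG equations (with logarithmic nonlinearity) are localized in $\hat\Omega_n$, and there exists a sequence of solutions $\psi_n$ of these KG equations which concentrates at $\hat{\mathbf r}$.
   Context: Fix constants $c>0$, $m>0$ and a real charge $q\neq0$. For parameters $\chi>0$, $a>0$ and a real electric potential $\varphi(t,\mathbf x)$, $\mathbf x\in\mathbb R^3$, the KG equation with logarithmic nonlinearity is $-c^{-2}\tilde\partial_t^2\psi+\Delta\psi-G_a'(|\psi|^2)\psi-\kappa_0^2\psi=0$, where $\tilde\partial_t=\partial_t+\mathrm iq\varphi/\chi$, $\kappa_0=mc/\chi$, $G_a(s)=-a^{-2}s[\ln(a^3s)+\ln\pi^{3/2}+2]$ for $s\ge0$, so $G_a'(s)=-a^{-2}\ln(\pi^{3/2}a^3s)-3a^{-2}$. Put $a_C=\chi/(mc)$. Energy density $\mathcal E=\frac{\chi^2}{2m}[c^{-2}|\tilde\partial_t\psi|^2+|\nabla\psi|^2+G_a(|\psi|^2)+\kappa_0^2|\psi|^2]$. $\nabla_{0,\mathbf x}=(c^{-1}\partial_t,\partial_1,\partial_2,\partial_3)$.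 For $R_n\to0$: $\Omega_n(t)=\{|\mathbf x-\hat{\mathbf r}(t)|\le R_n\}$, $\hat\Omega_n=\{(t,\mathbf x):t\in[T_-,T_+],\mathbf x\in\Omega_n(t)\}$. Localized KG equations: $a_n\to0$, $\chi_n\to0$, $a_{C,n}/a_n\le C$, $R_n/a_n\to\infty$; $\varphi_n\in C^2(\hat\Omega_n)$ with $\sup_{\hat\Omega_n}(|\varphi_n|+|\nabla_{0,\mathbf x}\varphi_n|)\le C$ uniformly in $n$; and a limit $\varphi_\infty(t,\mathbf x)=\varphi_\infty(t,\hat{\mathbf r}(t))+(\mathbf x-\hat{\mathbf r}(t))\cdot\nabla\varphi_\infty(t)$ with $\sup_{\hat\Omega_n}(|\varphi_n-\varphi_\infty|+|\nabla_{0,\mathbf x}(\varphi_n-\varphi_\infty)|)\to0$ and $|\varphi_\infty(t,\hat{\mathbf r}(t))|,|\nabla\varphi_\infty(t)|,|\partial_t\nabla\varphi_\infty(t)|\le C$ on $[T_-,T_+]$. Concentrating solutions: $\psi_n\in C^2(\hat\Omega_n)$ solving KG with $(\chi_n,a_n,\varphi_n)$ in $\hat\Omega_n$ such that (i) $\max_t\int_{\Omega_n(t)}[a_C^2|\nabla_{0,\mathbf x}\psi_n|^2+a_C^2|G_a(|\psi_n|^2)|+|\psi_n|^2]d^3x\le C$; (ii) $\max_t\int_{\partial\Omega_n(t)}[\text{same integrand}]d^2\sigma\to0$; (iii) $\bar{\mathcal E}_n(t)=\int_{\Omega_n(t)}\mathcal E_nd^3x\ge c_0>0$ for $n\ge n_0$,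 $t\in[T_-,T_+]$; (iv) there is $t_0\in[T_-,T_+]$ with $\bar{\mathcal E}_n(t_0)$ convergent. *)

theory Defs
  imports "HOL-Analysis.Analysis"
begin

type_synonym pt = "real \<times> (real^3)"

definition pd :: "(pt \<Rightarrow> 'b::real_normed_vector) \<Rightarrow> pt \<Rightarrow> pt \<Rightarrow> 'b" where
  "pd f w p = frechet_derivative f (at p) w"

definition e_t :: pt where "e_t = (1, 0)"
definition e_x :: "3 \<Rightarrow> pt" where "e_x i = (0, axis i 1)"

definition C2_on :: "(pt \<Rightarrow> 'b::real_normed_vector) \<Rightarrow> pt set \<Rightarrow> bool" where
  "C2_on f S \<longleftrightarrow> (\<exists>U. open U \<and> S \<subseteq> U \<and>
      (\<forall>p\<in>U. f differentiable at p) \<and>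
      (\<forall>w\<in>Basis. \<forall>p\<in>U. pd f w differentiable at p) \<and>
      (\<forall>w\<in>Basis. \<forall>w'\<in>Basis. continuous_on U (pd (pd f w) w')))"

definition Gfun :: "real \<Rightarrow> real \<Rightarrow> real" where
  "Gfun a s = - (s / a\<^sup>2) * (ln (a ^ 3 * s) + ln (pi powr (3/2)) + 2)"

definition Gder :: "real \<Rightarrow> real \<Rightarrow> real" where
  "Gder a s = - ln (pi powr (3/2) * a ^ 3 * s) / a\<^sup>2 - 3 / a\<^sup>2"

definition dt_tilde :: "real \<Rightarrow> real \<Rightarrow> (pt \<Rightarrow> real) \<Rightarrow> (pt \<Rightarrow> complex) \<Rightarrow> pt \<Rightarrow> complex" where
  "dt_tilde q ch \<phi> f p = pd f e_t p + \<i> * complex_of_real (q * \<phi> p / ch) * f p"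

definition lap :: "(pt \<Rightarrow> complex) \<Rightarrow> pt \<Rightarrow> complex" where
  "lap f p = (\<Sum>i\<in>UNIV. pd (pd f (e_x i)) (e_x i) p)"

definition KG_eq :: "real \<Rightarrow> real \<Rightarrow> real \<Rightarrow> real \<Rightarrow> real \<Rightarrow> (pt \<Rightarrow> real) \<Rightarrow> (pt \<Rightarrow> complex) \<Rightarrow> pt \<Rightarrow> bool" where
  "KG_eq c m q ch a \<phi> \<psi> p \<longleftrightarrow>
     - dt_tilde q ch \<phi> (dt_tilde q ch \<phi> \<psi>) p / (complex_of_real c)\<^sup>2 + lap \<psi> p
     - complex_of_real (Gder a ((cmod (\<psi> p))\<^sup>2)) * \<psi> p
     - complex_of_real ((m * c / ch)\<^sup>2) * \<psi> p = 0"

definition energy_density :: "real \<Rightarrow> real \<Rightarrow> real \<Rightarrow> real \<Rightarrow> real \<Rightarrow> (pt \<Rightarrow> real) \<Rightarrow> (pt \<Rightarrow> complex) \<Rightarrow> pt \<Rightarrow> real" where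
  "energy_density c m q ch a \<phi> \<psi> p =
     ch\<^sup>2 / (2 * m) * ((cmod (dt_tilde q ch \<phi> \<psi> p))\<^sup>2 / c\<^sup>2
       + (\<Sum>i\<in>UNIV. (cmod (pd \<psi> (e_x i) p))\<^sup>2)
       + Gfun a ((cmod (\<psi> p))\<^sup>2) + (m * c / ch)\<^sup>2 * (cmod (\<psi> p))\<^sup>2)"

definition grad0_sq :: "real \<Rightarrow> (pt \<Rightarrow> complex) \<Rightarrow> pt \<Rightarrow> real" where
  "grad0_sq c \<psi> p = (cmod (pd \<psi> e_t p))\<^sup>2 / c\<^sup>2 + (\<Sum>i\<in>UNIV. (cmod (pd \<psi> (e_x i) p))\<^sup>2)"

definition grad0_norm :: "real \<Rightarrow> (pt \<Rightarrow> real) \<Rightarrow> pt \<Rightarrow> real" where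
  "grad0_norm c f p = sqrt ((pd f e_t p / c)\<^sup>2 + (\<Sum>i\<in>UNIV. (pd f (e_x i) p)\<^sup>2))"

definition conc_dens :: "real \<Rightarrow> real \<Rightarrow> real \<Rightarrow> real \<Rightarrow> (pt \<Rightarrow> complex) \<Rightarrow> pt \<Rightarrow> real" where
  "conc_dens c m ch a \<psi> p =
     (ch / (m * c))\<^sup>2 * grad0_sq c \<psi> p + (ch / (m * c))\<^sup>2 * \<bar>Gfun a ((cmod (\<psi> p))\<^sup>2)\<bar>
     + (cmod (\<psi> p))\<^sup>2"

definition rhat :: "(real \<Rightarrow> real) \<Rightarrow> real \<Rightarrow> real^3" where
  "rhat r t = vector [0, 0, r t]"

definition Omega :: "(real \<Rightarrow> real) \<Rightarrow> real \<Rightarrow> real \<Rightarrow> (real^3) set" where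
  "Omega r R t = cball (rhat r t) R"

definition Omega_hat :: "(real \<Rightarrow> real) \<Rightarrow> real \<Rightarrow> real \<Rightarrow> real \<Rightarrow> pt set" where
  "Omega_hat r R Tm Tp = {(t, x). t \<in> {Tm..Tp} \<and> x \<in> Omega r R t}"

definition sph :: "real \<Rightarrow> real \<Rightarrow> real^3" where
  "sph \<theta> \<phi> = vector [sin \<theta> * cos \<phi>, sin \<theta> * sin \<phi>, cos \<theta>]"

definition sphere_integral :: "(real^3 \<Rightarrow> real) \<Rightarrow> real^3 \<Rightarrow> real \<Rightarrow> real" where
  "sphere_integral f x0 R =
     integral ({0..pi} \<times> {0..2*pi}) (\<lambda>(\<theta>, \<phi>). R\<^sup>2 * sin \<theta> * f (x0 + R *\<^sub>R sph \<theta> \<phi>))"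

definition localized_KG ::
  "real \<Rightarrow> real \<Rightarrow> (real \<Rightarrow> real) \<Rightarrow> real \<Rightarrow> real \<Rightarrow>
   (nat \<Rightarrow> real) \<Rightarrow> (nat \<Rightarrow> real) \<Rightarrow> (nat \<Rightarrow> real) \<Rightarrow> (nat \<Rightarrow> pt \<Rightarrow> real) \<Rightarrow> bool" where
  "localized_KG c m r Tm Tp a R ch \<phi> \<longleftrightarrow>
     (\<forall>n. a n > 0 \<and> ch n > 0 \<and> R n > 0) \<and>
     a \<longlonglongrightarrow> 0 \<and> ch \<longlonglongrightarrow> 0 \<and> R \<longlonglongrightarrow> 0 \<and>
     (\<exists>C. \<forall>n. (ch n / (m * c)) / a n \<le> C) \<and>
     filterlim (\<lambda>n. R n / a n) at_top sequentially \<and>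
     (\<forall>n. C2_on (\<phi> n) (Omega_hat r (R n) Tm Tp)) \<and>
     (\<exists>C. \<forall>n. \<forall>p\<in>Omega_hat r (R n) Tm Tp. \<bar>\<phi> n p\<bar> + grad0_norm c (\<phi> n) p \<le> C) \<and>
     (\<exists>f0 g. (\<forall>t. f0 differentiable at t \<and> g differentiable at t) \<and>
        (let \<phi>inf = (\<lambda>(t, x). f0 t + (x - rhat r t) \<bullet> g t) in
          (\<forall>\<epsilon>>0. \<forall>\<^sub>F n in sequentially. \<forall>p\<in>Omega_hat r (R n) Tm Tp.
             \<bar>\<phi> n p - \<phi>inf p\<bar> + grad0_norm c (\<lambda>q. \<phi> n q - \<phi>inf q) p \<le> \<epsilon>)) \<and>
        (\<exists>C. \<forall>t\<in>{Tm..Tp}. \<bar>f0 t\<bar> \<le> C \<and> norm (g t) \<le> C \<and>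
             norm (vector_derivative g (at t)) \<le> C))"

definition Ebar :: "real \<Rightarrow> real \<Rightarrow> real \<Rightarrow> (real \<Rightarrow> real) \<Rightarrow> real \<Rightarrow> real \<Rightarrow> real \<Rightarrow>
    (pt \<Rightarrow> real) \<Rightarrow> (pt \<Rightarrow> complex) \<Rightarrow> real \<Rightarrow> real" where
  "Ebar c m q r R ch a \<phi> \<psi> t =
     integral (Omega r R t) (\<lambda>x. energy_density c m q ch a \<phi> \<psi> (t, x))"

definition concentrating ::
  "real \<Rightarrow> real \<Rightarrow> real \<Rightarrow> (real \<Rightarrow> real) \<Rightarrow> real \<Rightarrow> real \<Rightarrow>
   (nat \<Rightarrow> real) \<Rightarrow> (nat \<Rightarrow> real) \<Rightarrow> (nat \<Rightarrow> real) \<Rightarrow> (nat \<Rightarrow> pt \<Rightarrow> real) \<Rightarrow>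
   (nat \<Rightarrow> pt \<Rightarrow> complex) \<Rightarrow> bool" where
  "concentrating c m q r Tm Tp a R ch \<phi> \<psi> \<longleftrightarrow>
     (\<forall>n. C2_on (\<psi> n) (Omega_hat r (R n) Tm Tp) \<and>
          (\<forall>p\<in>Omega_hat r (R n) Tm Tp. KG_eq c m q (ch n) (a n) (\<phi> n) (\<psi> n) p)) \<and>
     (\<exists>C. \<forall>n. \<forall>t\<in>{Tm..Tp}.
        integral (Omega r (R n) t) (\<lambda>x. conc_dens c m (ch n) (a n) (\<psi> n) (t, x)) \<le> C) \<and>
     (\<forall>\<epsilon>>0. \<forall>\<^sub>F n in sequentially. \<forall>t\<in>{Tm..Tp}.
        sphere_integral (\<lambda>x. conc_dens c m (ch n) (a n) (\<psi> n) (t, x)) (rhat r t) (R n) \<le> \<epsilon>) \<and>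
     (\<exists>c0>0. \<exists>n0. \<forall>n\<ge>n0. \<forall>t\<in>{Tm..Tp}.
        Ebar c m q r (R n) (ch n) (a n) (\<phi> n) (\<psi> n) t \<ge> c0) \<and>
     (\<exists>t0\<in>{Tm..Tp}. convergent (\<lambda>n. Ebar c m q r (R n) (ch n) (a n) (\<phi> n) (\<psi> n) t0))"

end

theory Submission
  imports Defs "HOL-Complex_Analysis.Complex_Analysis" "HOL-Probability.Distributions" "HOL-Real_Asymp.Real_Asymp"
begin

no_notation fps_nth (infixl "$" 75)

text \<open>The equation for \<open>\<psi> = u exp(i s / \<chi>)\<close> splits into a Hamilton-Jacobi equation for \<open>s\<close>, in
  which \<open>u\<close> enters through a potential of order \<open>\<chi>\<^sup>2\<close>, and a continuity equation. The potential \<open>\<phi>\<close> is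
  at our disposal, so one prescribes a Gaussian \<open>u\<close> of width \<open>a\<close> around the worldline and solves for
  \<open>s\<close> and \<open>\<phi>\<close>. To make the motion explicit, a polynomial \<open>P\<close> replaces the logarithm of
  \<open>(c + v) / (c - v)\<close> as a function of \<open>c t - r(t)\<close>; in the coordinates \<open>y, \<tau> = X(z + c t) \<plusminus> (z - c t)\<close> with
  \<open>X' = exp(- P(X))\<close> the worldline is close to \<open>y = 0\<close> and the continuity equation says that a pair
  of densities derives from a single function \<open>k\<close>. What remains is one algebraic relation between
  \<open>k\<close> and the integral over \<open>y\<close> of \<open>k\<^sub>\<tau>\<close>. This loses a derivative, but all data are analytic
  because \<open>P\<close> is a polynomial, so a Cauchy-Kovalevskaya type contraction solves it for small \<open>\<chi>\<close>, and
  \<open>\<phi>\<close> tends to \<open>(m c\<^sup>2 / q) exp(P(X) / 2)\<close> as \<open>\<chi> \<rightarrow> 0\<close> with \<open>a\<close>, the radius and \<open>P\<close> fixed. The parameters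
  are chosen in the order radius, \<open>a\<close>, \<open>P\<close>, \<open>\<chi>\<close>, and a subsequence makes the energies converge.\<close>

text \<open>On the worldline \<open>A = P(X)\<close> is close to twice the rapidity, and the leading
  momentum \<open>- m c sinh(A/2)\<close> and energy \<open>m c\<^sup>2 cosh(A/2)\<close> lie
  exactly on the mass shell. The factor \<open>exp(- A/2)\<close> built into
  \<open>u\<^sup>2\<close> makes them satisfy the continuity equation exactly as well, so the
  quantum potential, with its factor \<open>\<chi>\<^sup>2\<close>, is the only source of the
  correction \<open>k\<close>. The leading phase depends on \<open>z + c t\<close> alone; this gauge
  gives \<open>q \<phi> = m c\<^sup>2 (cosh(A/2) + sinh(A/2))\<close>. The logarithmic nonlinearity
  keeps the problem two-dimensional: for a Gaussian of width \<open>a\<close> the transverse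
  Laplacian and the transverse part of the logarithm cancel, so the quantum potential depends on
  \<open>\<tau>\<close> and \<open>y\<close> only. The trajectory has few derivatives while the
  contraction needs analytic data, so no estimate uniform in \<open>a\<close> or \<open>P\<close> is
  sought: \<open>1 / u\<^sup>2\<close> may be exponentially large in \<open>1 / a\<^sup>2\<close>
  and higher derivatives of \<open>P\<close> are uncontrolled, but all this is fixed before
  \<open>\<chi>\<close>. Only \<open>P\<close> and \<open>P'\<close> must be close to the logarithm
  and its derivative, since the potentials converge with their first derivatives.\<close>

section \<open>Jets with factorial majorants\<close>

text \<open>The factor \<open>(n + 1)\<^sup>2\<close> makes these majorants stable under Leibniz convolution, and \<open>\<rho>\<close> plays the
  role of a radius of analyticity.\<close>
definition wt :: "nat \<Rightarrow> real \<Rightarrow> real" where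
  "wt n \<rho> = fact n / ((real n + 1)\<^sup>2 * \<rho> ^ (n + 1))"

lemma wt_pos: "\<rho> > 0 \<Longrightarrow> wt n \<rho> > 0"
  by (simp add: wt_def)

lemma wt_le_fact: "\<rho> \<ge> 1 \<Longrightarrow> wt n \<rho> \<le> fact n"
proof -
  assume r: "\<rho> \<ge> 1"
  have "1 * 1 \<le> (real n + 1)\<^sup>2 * \<rho> ^ (n + 1)"
    using r by (intro mult_mono one_le_power) (auto simp: one_le_power)
  thus ?thesis by (simp add: wt_def divide_le_eq)
qed

lemma sum_inverse_squares_le: "(\<Sum>s\<le>n. 1 / (real s + 1)\<^sup>2) \<le> 2 - 1 / (real n + 1)"
proof (induction n)
  case (Suc n)
  have "1 / (real n + 2)\<^sup>2 \<le> 1 / (real n + 1) - 1 / (real n + 2)"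
    by (simp add: divide_simps power2_eq_square)
  with Suc show ?case by (simp add: add.commute)
qed simp

text \<open>With \<open>x + y = n + 2\<close> the inequality
  \<open>(x + y)\<^sup>2 \<le> 2 (x\<^sup>2 + y\<^sup>2)\<close> splits each summand into two
  inverse squares and extracts the decay in the total order. The two remaining sums are at most 2
  each, whence the constant 8.\<close>

lemma sum_inverse_squares_conv:
  "(\<Sum>s\<le>n. 1 / ((real s + 1)\<^sup>2 * (real (n - s) + 1)\<^sup>2)) \<le> 8 / (real n + 1)\<^sup>2"
proof -
  have eq: "1 / ((real s + 1)\<^sup>2 * (real (n - s) + 1)\<^sup>2)
     \<le> 2 / (real n + 2)\<^sup>2 * (1 / (real s + 1)\<^sup>2 + 1 / (real (n - s) + 1)\<^sup>2)" if "s \<le> n" for s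
  proof -
    define x y where "x = real s + 1" and "y = real (n - s) + 1"
    have xy: "x > 0" "y > 0" "real n + 2 = x + y" using that by (auto simp: x_def y_def of_nat_diff)
    have "(x + y)\<^sup>2 \<le> 2 * (x\<^sup>2 + y\<^sup>2)" using sum_squares_bound[of x y] by (simp add: power2_sum)
    hence "(x + y)\<^sup>2 / ((x + y)\<^sup>2 * (x\<^sup>2 * y\<^sup>2)) \<le> 2 * (x\<^sup>2 + y\<^sup>2) / ((x + y)\<^sup>2 * (x\<^sup>2 * y\<^sup>2))"
      by (rule divide_right_mono) simp
    moreover have "2 * (x\<^sup>2 + y\<^sup>2) / ((x + y)\<^sup>2 * (x\<^sup>2 * y\<^sup>2)) = 2 / (x + y)\<^sup>2 * (1 / x\<^sup>2 + 1 / y\<^sup>2)"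
    proof -
      have "1 / x\<^sup>2 + 1 / y\<^sup>2 = (x\<^sup>2 + y\<^sup>2) / (x\<^sup>2 * y\<^sup>2)"
        using xy by (simp add: add_frac_eq add.commute)
      thus ?thesis by simp
    qed
    ultimately have "1 / (x\<^sup>2 * y\<^sup>2) \<le> 2 / (x + y)\<^sup>2 * (1 / x\<^sup>2 + 1 / y\<^sup>2)"
      using xy by simp
    thus ?thesis unfolding xy(3) by (simp only: x_def y_def)
  qed
  have "(\<Sum>s\<le>n. 1 / ((real s + 1)\<^sup>2 * (real (n - s) + 1)\<^sup>2))
    \<le> (\<Sum>s\<le>n. 2 / (real n + 2)\<^sup>2 * (1 / (real s + 1)\<^sup>2 + 1 / (real (n - s) + 1)\<^sup>2))"
    by (intro sum_mono eq) auto
  also have "\<dots> = 2 / (real n + 2)\<^sup>2 * ((\<Sum>s\<le>n. 1 / (real s + 1)\<^sup>2) + (\<Sum>s\<le>n. 1 / (real (n - s) + 1)\<^sup>2))"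
    by (simp only: sum_distrib_left[symmetric] sum.distrib)
  also have "(\<Sum>s\<le>n. 1 / (real (n - s) + 1)\<^sup>2) = (\<Sum>s\<le>n. 1 / (real s + 1)\<^sup>2)"
    by (rule sum.reindex_bij_witness[of _ "\<lambda>s. n - s" "\<lambda>s. n - s"]) auto
  also have "2 / (real n + 2)\<^sup>2 * ((\<Sum>s\<le>n. 1 / (real s + 1)\<^sup>2) + (\<Sum>s\<le>n. 1 / (real s + 1)\<^sup>2))
      \<le> 2 / (real n + 2)\<^sup>2 * (2 + 2)"
    using sum_inverse_squares_le[of n]
    by (intro mult_left_mono add_mono) (auto intro: order_trans)
  also have "\<dots> \<le> 8 / (real n + 1)\<^sup>2"
    by (simp add: frac_le power_mono)
  finally show ?thesis .
qed

lemma wt_conv: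
  assumes "\<rho> \<ge> 1"
  shows "(\<Sum>s\<le>n. real (n choose s) * (wt s \<rho> * wt (n - s) \<rho>)) \<le> 8 * wt n \<rho>"
proof -
  have eq: "real (n choose s) * (wt s \<rho> * wt (n - s) \<rho>)
     = fact n / \<rho> ^ (n + 2) * (1 / ((real s + 1)\<^sup>2 * (real (n - s) + 1)\<^sup>2))" if "s \<le> n" for s
  proof -
    have p: "\<rho> ^ (s + 1) * \<rho> ^ (n - s + 1) = \<rho> ^ (n + 2)"
      using that by (simp flip: power_add)
    have "real (n choose s) * (wt s \<rho> * wt (n - s) \<rho>)
      = real (n choose s) * fact s * fact (n - s) / ((real s + 1)\<^sup>2 * (real (n - s) + 1)\<^sup>2 * (\<rho> ^ (s + 1) * \<rho> ^ (n - s + 1)))"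
    proof -
      have "C * (F / (A * P) * (G / (B * Q))) = C * F * G / (A * B * (P * Q))" for A B C F G P Q :: real
        by (simp add: mult_ac)
      thus ?thesis unfolding wt_def .
    qed
    also have "real (n choose s) * fact s * fact (n - s) = fact n"
    proof -
      have "real (fact s * fact (n - s) * (n choose s)) = real (fact n)"
        by (simp only: binomial_fact_lemma[OF that])
      thus ?thesis by (simp add: mult_ac)
    qed
    finally show ?thesis unfolding p by simp
  qed
  have "(\<Sum>s\<le>n. real (n choose s) * (wt s \<rho> * wt (n - s) \<rho>))
     = fact n / \<rho> ^ (n + 2) * (\<Sum>s\<le>n. 1 / ((real s + 1)\<^sup>2 * (real (n - s) + 1)\<^sup>2))"
    unfolding sum_distrib_left by (intro sum.cong refl eq) auto
  also have "\<dots> \<le> fact n / \<rho> ^ (n + 2) * (8 / (real n + 1)\<^sup>2)"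
    using assms by (intro mult_left_mono sum_inverse_squares_conv) auto
  also have "\<dots> \<le> fact n / \<rho> ^ (n + 1) * (8 / (real n + 1)\<^sup>2)"
    using assms by (intro mult_right_mono frac_le power_increasing) auto
  also have "\<dots> = 8 * wt n \<rho>" by (simp add: wt_def mult_ac)
  finally show ?thesis .
qed

text \<open>\<open>g j l t y\<close> stands for the derivative of order \<open>j\<close> in \<open>t\<close> and \<open>l\<close> in \<open>y\<close>.\<close>
type_synonym jet = "nat \<Rightarrow> nat \<Rightarrow> real \<Rightarrow> real \<Rightarrow> real"

text \<open>Leibniz' rule, encoded by differentiating one factor at a time instead of by double
  binomial sums, so that the derivatives of a product jet are obtained by plain inductions. The
  indices \<open>a b a' b'\<close> hold the orders already reached on the two factors.\<close>

primrec jprod0 :: "nat \<Rightarrow> jet \<Rightarrow> jet \<Rightarrow> nat \<Rightarrow> nat \<Rightarrow> nat \<Rightarrow> nat \<Rightarrow> real \<Rightarrow> real \<Rightarrow> real" where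
  "jprod0 0 g h a b a' b' t y = g a b t y * h a' b' t y"
| "jprod0 (Suc l) g h a b a' b' t y
    = jprod0 l g h a (Suc b) a' b' t y + jprod0 l g h a b a' (Suc b') t y"

primrec jprod :: "nat \<Rightarrow> nat \<Rightarrow> jet \<Rightarrow> jet \<Rightarrow> nat \<Rightarrow> nat \<Rightarrow> nat \<Rightarrow> nat \<Rightarrow> real \<Rightarrow> real \<Rightarrow> real" where
  "jprod 0 l g h a b a' b' t y = jprod0 l g h a b a' b' t y"
| "jprod (Suc j) l g h a b a' b' t y
    = jprod j l g h (Suc a) b a' b' t y + jprod j l g h a b (Suc a') b' t y"

definition jmult :: "jet \<Rightarrow> jet \<Rightarrow> jet" where
  "jmult g h j l = jprod j l g h 0 0 0 0"

lemma jprod_diff_left: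
  "jprod j l (\<lambda>j l t y. g j l t y - g' j l t y) h a b a' b' t y
     = jprod j l g h a b a' b' t y - jprod j l g' h a b a' b' t y"
proof (induction j arbitrary: a a')
  case 0
  show ?case by (induction l arbitrary: b b') (simp_all add: left_diff_distrib right_diff_distrib)
qed simp

lemma jprod_diff_right:
  "jprod j l g (\<lambda>j l t y. h j l t y - h' j l t y) a b a' b' t y
     = jprod j l g h a b a' b' t y - jprod j l g h' a b a' b' t y"
proof (induction j arbitrary: a a')
  case 0
  show ?case by (induction l arbitrary: b b') (simp_all add: left_diff_distrib right_diff_distrib)
qed simp

lemma jmult_00 [simp]: "jmult g h 0 0 t y = g 0 0 t y * h 0 0 t y"
  by (simp add: jmult_def)

text \<open>The majorant \<open>w\<close> sees only the total order, so both recursions, in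
  \<open>t\<close> and in \<open>y\<close>, act on the bound in the same way and merge into Pascal's
  rule for order \<open>j + l\<close>.\<close>

lemma jprod_bound:
  assumes g: "\<And>j l. \<bar>g j l t y\<bar> \<le> M * w (j + l)" and h: "\<And>j l. \<bar>h j l t y\<bar> \<le> N * w (j + l)"
  shows "\<bar>jprod j l g h a b a' b' t y\<bar>
     \<le> M * N * (\<Sum>s\<le>j + l. real ((j + l) choose s) * (w (a + b + s) * w (a' + b' + (j + l - s))))"
proof -
  have pascal: "(\<Sum>s\<le>n. real (n choose s) * H (Suc s) (n - s)) + (\<Sum>s\<le>n. real (n choose s) * H s (Suc (n - s)))
      = (\<Sum>s\<le>Suc n. real (Suc n choose s) * H s (Suc n - s))" for n and H :: "nat \<Rightarrow> nat \<Rightarrow> real"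
  proof -
    have "(\<Sum>s\<le>Suc n. real (Suc n choose s) * H s (Suc n - s))
       = H 0 (Suc n) + (\<Sum>s\<le>n. real (Suc n choose Suc s) * H (Suc s) (n - s))"
      by (simp add: sum.atMost_Suc_shift del: sum.atMost_Suc)
    also have "\<dots> = H 0 (Suc n) + (\<Sum>s\<le>n. real (n choose s) * H (Suc s) (n - s))
         + (\<Sum>s\<le>n. real (n choose Suc s) * H (Suc s) (n - s))"
      by (simp add: algebra_simps sum.distrib)
    also have "H 0 (Suc n) + (\<Sum>s\<le>n. real (n choose s) * H (Suc s) (n - s))
         + (\<Sum>s\<le>n. real (n choose Suc s) * H (Suc s) (n - s))
       = (\<Sum>s\<le>n. real (n choose s) * H (Suc s) (n - s)) +
         (\<Sum>s\<le>Suc n. real (n choose s) * H s (Suc n - s))"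
      by (simp add: sum.atMost_Suc_shift del: sum.atMost_Suc)
    also have "(\<Sum>s\<le>Suc n. real (n choose s) * H s (Suc n - s)) = (\<Sum>s\<le>n. real (n choose s) * H s (Suc (n - s)))"
      by (simp add: Suc_diff_le)
    finally show ?thesis by simp
  qed
  define S where "S n p q = (\<Sum>s\<le>n. real (n choose s) * (w (p + s) * w (q + (n - s))))" for n p q
  have S_Suc: "S (Suc n) p q = S n (Suc p) q + S n p (Suc q)" for n p q
    unfolding S_def using pascal[of n "\<lambda>s t. w (p + s) * w (q + t)"] by simp
  have key: "\<bar>jprod j l g h a b a' b' t y\<bar> \<le> M * N * S (j + l) (a + b) (a' + b')"
  proof (induction j arbitrary: a a')
    case 0
    show ?case
    proof (induction l arbitrary: b b')
      case 0
      have "\<bar>g a b t y\<bar> * \<bar>h a' b' t y\<bar> \<le> (M * w (a + b)) * (N * w (a' + b'))"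
        by (intro mult_mono g h) (auto intro: order_trans[OF _ g])
      thus ?case by (simp add: S_def abs_mult algebra_simps)
    next
      case (Suc l)
      have "\<bar>jprod 0 (Suc l) g h a b a' b' t y\<bar> \<le> \<bar>jprod 0 l g h a (Suc b) a' b' t y\<bar> + \<bar>jprod 0 l g h a b a' (Suc b') t y\<bar>"
        by simp
      also have "\<dots> \<le> M * N * S (0 + l) (a + Suc b) (a' + b') + M * N * S (0 + l) (a + b) (a' + Suc b')"
        by (intro add_mono Suc)
      finally show ?case by (simp add: S_Suc algebra_simps)
    qed
  next
    case (Suc j)
    have "\<bar>jprod (Suc j) l g h a b a' b' t y\<bar> \<le> \<bar>jprod j l g h (Suc a) b a' b' t y\<bar> + \<bar>jprod j l g h a b (Suc a') b' t y\<bar>"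
      by simp
    also have "\<dots> \<le> M * N * S (j + l) (Suc a + b) (a' + b') + M * N * S (j + l) (a + b) (Suc a' + b')"
      by (intro add_mono Suc)
    finally show ?case by (simp add: S_Suc algebra_simps)
  qed
  thus ?thesis by (simp add: S_def add.assoc)
qed

lemma jprod_deriv_fst:
  assumes "\<And>j l. ((\<lambda>t. g j l t y) has_real_derivative g (Suc j) l t y) (at t within I)"
    and "\<And>j l. ((\<lambda>t. h j l t y) has_real_derivative h (Suc j) l t y) (at t within I)"
  shows "((\<lambda>t. jprod j l g h a b a' b' t y) has_real_derivative
     jprod (Suc j) l g h a b a' b' t y) (at t within I)"
proof (induction j arbitrary: a a')
  case 0
  show ?case
  proof (induction l arbitrary: b b')
    case 0
    show ?case using assms by (auto intro!: derivative_eq_intros)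
  next
    case (Suc l)
    show ?case using DERIV_add[OF Suc[of "Suc b" b'] Suc[of b "Suc b'"]]
      by (simp add: add.commute add.left_commute)
  qed
next
  case (Suc j)
  show ?case using DERIV_add[OF Suc[of "Suc a" a'] Suc[of a "Suc a'"]] by simp
qed

lemma jprod_deriv_snd:
  assumes "\<And>j l. ((\<lambda>y. g j l t y) has_real_derivative g j (Suc l) t y) (at y within I)"
    and "\<And>j l. ((\<lambda>y. h j l t y) has_real_derivative h j (Suc l) t y) (at y within I)"
  shows "((\<lambda>y. jprod j l g h a b a' b' t y) has_real_derivative
     jprod j (Suc l) g h a b a' b' t y) (at y within I)"
proof (induction j arbitrary: a a')
  case 0
  show ?case
  proof (induction l arbitrary: b b')
    case 0
    show ?case using assms by (auto intro!: derivative_eq_intros)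
  next
    case (Suc l)
    show ?case using DERIV_add[OF Suc[of "Suc b" b'] Suc[of b "Suc b'"]] by simp
  qed
next
  case (Suc j)
  show ?case using DERIV_add[OF Suc[of "Suc a" a'] Suc[of a "Suc a'"]] by simp
qed

section \<open>Majorant norms on a rectangle and the contraction\<close>

locale rect =
  fixes t0 t1 y0 y1 :: real
  assumes t01: "t0 < t1" and y01: "y0 < y1"
begin

definition rh :: "real \<Rightarrow> real" where "rh y = 2 - (y - y0) / (y1 - y0)"

definition is_jet :: "jet \<Rightarrow> bool" where
  "is_jet g \<longleftrightarrow> (\<forall>j l. \<forall>t\<in>{t0..t1}. \<forall>y\<in>{y0..y1}.
     ((\<lambda>t. g j l t y) has_real_derivative g (Suc j) l t y) (at t within {t0..t1}) \<and>
     ((\<lambda>y. g j l t y) has_real_derivative g j (Suc l) t y) (at y within {y0..y1}))"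

definition nm :: "jet \<Rightarrow> real \<Rightarrow> bool" where
  "nm g M \<longleftrightarrow> (\<forall>j l. \<forall>t\<in>{t0..t1}. \<forall>y\<in>{y0..y1}. \<bar>g j l t y\<bar> \<le> M * wt (j + l) (rh y))"

lemma rh_bounds: "y \<in> {y0..y1} \<Longrightarrow> 1 \<le> rh y \<and> rh y \<le> 2"
  using y01 by (auto simp: rh_def divide_simps)

lemma nmD: "nm g M \<Longrightarrow> t \<in> {t0..t1} \<Longrightarrow> y \<in> {y0..y1} \<Longrightarrow> \<bar>g j l t y\<bar> \<le> M * wt (j + l) (rh y)"
  by (auto simp: nm_def)

lemma nmI: "(\<And>j l t y. t \<in> {t0..t1} \<Longrightarrow> y \<in> {y0..y1} \<Longrightarrow> \<bar>g j l t y\<bar> \<le> M * wt (j + l) (rh y)) \<Longrightarrow> nm g M"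
  by (auto simp: nm_def)

lemma wt_rh_pos: "y \<in> {y0..y1} \<Longrightarrow> wt n (rh y) > 0"
  using rh_bounds[of y] by (intro wt_pos) auto

lemma nm_nonneg: "nm g M \<Longrightarrow> M \<ge> 0"
proof -
  assume "nm g M"
  hence "0 \<le> M * wt (0 + 0) (rh y0)"
    by (rule order_trans[OF abs_ge_zero nmD[of g M t0 y0]]) (use t01 y01 in auto)
  thus ?thesis using wt_rh_pos[of y0 "0 + 0"] y01 by (simp add: zero_le_mult_iff)
qed

lemma nm_mono: "nm g M \<Longrightarrow> M \<le> N \<Longrightarrow> nm g N"
  by (rule nmI, rule order_trans[OF nmD mult_right_mono]) (auto intro: less_imp_le[OF wt_rh_pos])

lemma nm_fact: "nm g M \<Longrightarrow> t \<in> {t0..t1} \<Longrightarrow> y \<in> {y0..y1} \<Longrightarrow> \<bar>g j l t y\<bar> \<le> M * fact (j + l)"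
  by (rule order_trans[OF nmD[of g M t y j l] mult_left_mono[OF wt_le_fact]])
    (use rh_bounds[of y] in \<open>auto dest: nm_nonneg\<close>)

lemma nm_add: "nm g M \<Longrightarrow> nm h N \<Longrightarrow> nm (\<lambda>j l t y. g j l t y + h j l t y) (M + N)"
  by (rule nmI, unfold distrib_right, rule order_trans[OF abs_triangle_ineq add_mono]) (rule nmD; assumption)+

lemma nm_diff: "nm g M \<Longrightarrow> nm h N \<Longrightarrow> nm (\<lambda>j l t y. g j l t y - h j l t y) (M + N)"
  by (rule nmI, unfold distrib_right, rule order_trans[OF abs_triangle_ineq4 add_mono]) (rule nmD; assumption)+

lemma nm_cmult: "nm g M \<Longrightarrow> nm (\<lambda>j l t y. a * g j l t y) (\<bar>a\<bar> * M)"
  by (rule nmI, unfold abs_mult mult.assoc, rule mult_left_mono[OF nmD]) (assumption | rule abs_ge_zero)+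

lemma nm_jmult: "nm g M \<Longrightarrow> nm h N \<Longrightarrow> nm (jmult g h) (8 * M * N)"
proof (intro nmI)
  fix j l t y assume g: "nm g M" and h: "nm h N" and ty: "t \<in> {t0..t1}" "y \<in> {y0..y1}"
  have "\<bar>jmult g h j l t y\<bar> \<le> M * N * (\<Sum>s\<le>j + l. real ((j + l) choose s) * (wt (0 + 0 + s) (rh y) * wt (0 + 0 + (j + l - s)) (rh y)))"
    unfolding jmult_def by (rule jprod_bound) (use g h ty in \<open>auto intro: nmD\<close>)
  also have "\<dots> \<le> M * N * (8 * wt (j + l) (rh y))"
    using wt_conv[of "rh y" "j + l"] rh_bounds[OF ty(2)] nm_nonneg[OF g] nm_nonneg[OF h]
    by (intro mult_left_mono) auto
  finally show "\<bar>jmult g h j l t y\<bar> \<le> 8 * M * N * wt (j + l) (rh y)" by (simp add: mult_ac)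
qed

lemma is_jet_t: "is_jet g \<Longrightarrow> t \<in> {t0..t1} \<Longrightarrow> y \<in> {y0..y1} \<Longrightarrow>
    ((\<lambda>t. g j l t y) has_real_derivative g (Suc j) l t y) (at t within {t0..t1})"
  and is_jet_y: "is_jet g \<Longrightarrow> t \<in> {t0..t1} \<Longrightarrow> y \<in> {y0..y1} \<Longrightarrow>
    ((\<lambda>y. g j l t y) has_real_derivative g j (Suc l) t y) (at y within {y0..y1})"
  unfolding is_jet_def by blast+

lemma is_jet_jmult: "is_jet g \<Longrightarrow> is_jet h \<Longrightarrow> is_jet (jmult g h)"
  unfolding is_jet_def jmult_def by (intro allI ballI conjI jprod_deriv_fst jprod_deriv_snd; blast)

lemma is_jet_add: "is_jet g \<Longrightarrow> is_jet h \<Longrightarrow> is_jet (\<lambda>j l t y. g j l t y + h j l t y)"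
  and is_jet_diff: "is_jet g \<Longrightarrow> is_jet h \<Longrightarrow> is_jet (\<lambda>j l t y. g j l t y - h j l t y)"
  unfolding is_jet_def by (intro allI ballI conjI DERIV_add DERIV_diff; blast)+

lemma is_jet_cmult: "is_jet g \<Longrightarrow> is_jet (\<lambda>j l t y. a * g j l t y)"
  unfolding is_jet_def by (intro allI ballI conjI DERIV_cmult; blast)

text \<open>A jet only provides partial derivatives. The weights bound them uniformly, so every
  entry is Lipschitz in each variable separately, with constants independent of the other variable,
  and hence jointly.\<close>

lemma jet_continuous:
  assumes j: "is_jet g" and n: "nm g M"
  shows "continuous_on ({t0..t1} \<times> {y0..y1}) (\<lambda>(t, y). g j l t y)"
proof -
  define C where "C = M * fact (Suc (j + l))"
  have C: "C \<ge> 0" using nm_nonneg[OF n] by (simp add: C_def)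
  have lip_t: "\<bar>g j l t y - g j l t' y\<bar> \<le> C * \<bar>t - t'\<bar>"
    if "t \<in> {t0..t1}" "t' \<in> {t0..t1}" "y \<in> {y0..y1}" for t t' y
    using field_differentiable_bound[of "{t0..t1}" "\<lambda>t. g j l t y" "\<lambda>t. g (Suc j) l t y" C t t'] that
      is_jet_t[OF j] nm_fact[OF n, of _ y "Suc j" l] by (auto simp: C_def)
  have lip_y: "\<bar>g j l t y - g j l t y'\<bar> \<le> C * \<bar>y - y'\<bar>"
    if "t \<in> {t0..t1}" "y' \<in> {y0..y1}" "y \<in> {y0..y1}" for t y y'
    using field_differentiable_bound[of "{y0..y1}" "\<lambda>y. g j l t y" "\<lambda>y. g j (Suc l) t y" C y y'] that
      is_jet_y[OF j] nm_fact[OF n, of t _ j "Suc l"] by (auto simp: C_def)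
  have "(2 * C)-lipschitz_on ({t0..t1} \<times> {y0..y1}) (\<lambda>(t, y). g j l t y)"
  proof (rule lipschitz_onI)
    fix p p' assume pp: "p \<in> {t0..t1} \<times> {y0..y1}" "p' \<in> {t0..t1} \<times> {y0..y1}"
    obtain t y t' y' where eq: "p = (t, y)" "p' = (t', y')" by (metis surj_pair)
    have "\<bar>g j l t y - g j l t' y'\<bar> \<le> C * \<bar>t - t'\<bar> + C * \<bar>y - y'\<bar>"
      using lip_t[of t t' y] lip_y[of t' y' y] pp eq by auto
    also have "\<dots> \<le> C * dist p p' + C * dist p p'"
      using C dist_fst_le[of p p'] dist_snd_le[of p p'] eq
      by (intro add_mono mult_left_mono) (auto simp: dist_real_def)
    finally show "dist (case p of (t, y) \<Rightarrow> g j l t y) (case p' of (t, y) \<Rightarrow> g j l t y) \<le> 2 * C * dist p p'"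
      by (simp add: eq dist_real_def)
  qed (use C in auto)
  thus ?thesis by (rule lipschitz_on_continuous_on)
qed

lemma jet_continuous_y:
  assumes "is_jet g" "t \<in> {t0..t1}" "y \<in> {y0..y1}"
  shows "continuous_on {y0..y} (\<lambda>y. g j l t y)"
proof (rule continuous_on_subset)
  show "continuous_on {y0..y1} (\<lambda>y. g j l t y)"
    unfolding continuous_on_eq_continuous_within
    by (auto intro: DERIV_continuous is_jet_y[OF assms(1,2)])
qed (use assms in auto)

text \<open>The jet of the function \<open>p\<close> that vanishes for \<open>y = y0\<close> and satisfies \<open>p\<^sub>y = k\<^sub>t\<close>.\<close>
definition pj :: "jet \<Rightarrow> jet" where
  "pj k j l t y = (case l of 0 \<Rightarrow> integral {y0..y} (\<lambda>x. k (Suc j) 0 t x) | Suc l' \<Rightarrow> k (Suc j) l' t y)"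

lemma pj_simps [simp]: "pj k j 0 t y = integral {y0..y} (\<lambda>x. k (Suc j) 0 t x)"
  "pj k j (Suc l) t y = k (Suc j) l t y"
  by (simp_all add: pj_def)

lemma is_jet_pj:
  assumes k: "is_jet k" and n: "nm k M"
  shows "is_jet (pj k)"
  unfolding is_jet_def
proof (intro allI ballI conjI)
  fix j l t y assume ty: "t \<in> {t0..t1}" "y \<in> {y0..y1}"
  show "((\<lambda>t. pj k j l t y) has_real_derivative pj k (Suc j) l t y) (at t within {t0..t1})"
  proof (cases l)
    case 0
    have "((\<lambda>t. integral (cbox y0 y) (k (Suc j) 0 t)) has_real_derivative
        integral (cbox y0 y) (k (Suc (Suc j)) 0 t)) (at t within {t0..t1})"
    proof (rule leibniz_rule_field_derivative)
      show "k (Suc j) 0 s integrable_on cbox y0 y" if "s \<in> {t0..t1}" for s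
        using integrable_continuous_real[OF jet_continuous_y[OF k that ty(2)]] by (simp add: cbox_interval)
      show "continuous_on ({t0..t1} \<times> cbox y0 y) (\<lambda>(x, t). k (Suc (Suc j)) 0 x t)"
        by (rule continuous_on_subset[OF jet_continuous[OF k n]]) (use ty in \<open>auto simp: cbox_interval\<close>)
    qed (use ty is_jet_t[OF k] in \<open>auto simp: cbox_interval\<close>)
    thus ?thesis by (simp add: 0 cbox_interval)
  qed (use is_jet_t[OF k ty] in simp)
  show "((\<lambda>y. pj k j l t y) has_real_derivative pj k j (Suc l) t y) (at y within {y0..y1})"
  proof (cases l)
    case 0
    show ?thesis unfolding 0 pj_simps
      by (rule integral_has_real_derivative[OF jet_continuous_y[OF k ty(1)] ty(2)]) (use y01 in auto)
  qed (use is_jet_y[OF k ty] in simp)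
qed

text \<open>The norm bound of \<open>pj\<close>: the factor is 1 where a \<open>y\<close>-derivative
  undoes the integral and \<open>y1 - y0\<close> where it does not.\<close>

definition cP :: real where "cP = max 1 (y1 - y0)"

text \<open>Differentiating in \<open>t\<close> costs one derivative, but since \<open>rh\<close> decreases in \<open>y\<close>, integrating in
  \<open>y\<close> lowers the power of \<open>rh\<close> by one and gains it back.\<close>
lemma nm_pj:
  assumes k: "is_jet k" and n: "nm k M"
  shows "nm (pj k) (cP * M)"
proof (intro nmI)
  fix j l t y assume ty: "t \<in> {t0..t1}" "y \<in> {y0..y1}"
  note M = nm_nonneg[OF n]
  show "\<bar>pj k j l t y\<bar> \<le> cP * M * wt (j + l) (rh y)"
  proof (cases l)
    case (Suc l')
    have "\<bar>pj k j l t y\<bar> \<le> 1 * (M * wt (j + l) (rh y))"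
      using nmD[OF n ty, of "Suc j" l'] by (simp add: Suc)
    also have "\<dots> \<le> cP * (M * wt (j + l) (rh y))"
      using M wt_rh_pos[OF ty(2)] by (intro mult_right_mono) (auto simp: cP_def less_imp_le)
    finally show ?thesis by simp
  next
    case 0
    \<comment> \<open>A primitive of the weight of order \<open>j + 1\<close>, because
      \<open>rh\<close> has slope \<open>- 1 / (y1 - y0)\<close>. The exponent \<open>n + 1\<close>
      in \<open>wt\<close> keeps it a power even for \<open>j = 0\<close>, where an exponent
      \<open>n\<close> would lead to a logarithm.\<close>
    define H where "H x = (y1 - y0) * fact j / ((real j + 2)\<^sup>2 * rh x ^ (j + 1))" for x
    have H': "(H has_real_derivative wt (Suc j) (rh x)) (at x within {y0..y})" if "x \<in> {y0..y}" for x
    proof -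
      have r: "rh x \<noteq> 0" using rh_bounds[of x] that ty by auto
      have d: "y1 - y0 \<noteq> 0" using y01 by linarith
      have alg: "a * F / S * - (i * (N * (- e * P)) * i) = F / S * (N * ((a * e) * (P * i * i)))"
        for a F S i N e P :: real
        by (simp add: divide_inverse mult_ac)
      have "(rh has_real_derivative - (1 / (y1 - y0))) (at x within {y0..y})"
        unfolding rh_def using d by (auto intro!: derivative_eq_intros simp: divide_simps)
      hence "((\<lambda>x. inverse (rh x ^ Suc j)) has_real_derivative
          - (inverse (rh x ^ Suc j) * ((1 + real j) * (- (1 / (y1 - y0)) * rh x ^ j)) * inverse (rh x ^ Suc j))) (at x within {y0..y})"
        using r by (intro DERIV_inverse' DERIV_power_Suc) auto
      from DERIV_cmult[OF this, of "(y1 - y0) * fact j / (real j + 2)\<^sup>2"]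
      have "((\<lambda>x. (y1 - y0) * fact j / (real j + 2)\<^sup>2 * inverse (rh x ^ Suc j)) has_real_derivative
         fact j / (real j + 2)\<^sup>2 * ((1 + real j) * (((y1 - y0) * (1 / (y1 - y0))) * (rh x ^ j * inverse (rh x ^ Suc j) * inverse (rh x ^ Suc j))))) (at x within {y0..y})"
        unfolding alg .
      also have "(y1 - y0) * (1 / (y1 - y0)) = 1" unfolding times_divide_eq_right mult_1_right using d by (rule divide_self)
      also have "rh x ^ j * inverse (rh x ^ Suc j) * inverse (rh x ^ Suc j) = inverse (rh x ^ (j + 2))"
        using r by (simp add: field_simps)
      finally show ?thesis
        unfolding H_def[abs_def] wt_def by (simp add: divide_inverse mult_ac add_ac)
    qed
    have int: "((\<lambda>x. wt (Suc j) (rh x)) has_integral (H y - H y0)) {y0..y}"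
      by (rule fundamental_theorem_of_calculus)
         (use ty H' in \<open>auto simp: has_real_derivative_iff_has_vector_derivative[symmetric]\<close>)
    have Hy: "H y \<le> (y1 - y0) * wt j (rh y)"
    proof -
      have "H y = (y1 - y0) * (fact j / ((real j + 2)\<^sup>2 * rh y ^ (j + 1)))" by (simp add: H_def)
      also have "\<dots> \<le> (y1 - y0) * (fact j / ((real j + 1)\<^sup>2 * rh y ^ (j + 1)))"
        using y01 rh_bounds[OF ty(2)]
        by (intro mult_left_mono divide_left_mono mult_right_mono power_mono mult_pos_pos) auto
      finally show ?thesis by (simp add: wt_def)
    qed
    have "norm (integral {y0..y} (\<lambda>x. k (Suc j) 0 t x)) \<le> integral {y0..y} (\<lambda>x. M * wt (Suc j) (rh x))"
    proof (rule integral_norm_bound_integral)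
      show "(\<lambda>x. M * wt (Suc j) (rh x)) integrable_on {y0..y}"
        using has_integral_mult_right[OF int, of M] by blast
      show "k (Suc j) 0 t integrable_on {y0..y}"
        by (rule integrable_continuous_real[OF jet_continuous_y[OF k ty]])
      fix x assume "x \<in> {y0..y}"
      thus "norm (k (Suc j) 0 t x) \<le> M * wt (Suc j) (rh x)"
        using nmD[OF n ty(1), of x "Suc j" 0] ty by auto
    qed
    also have "\<dots> = M * (H y - H y0)"
      by (rule integral_unique[OF has_integral_mult_right[OF int]])
    also have "\<dots> \<le> M * H y"
      using M y01 rh_bounds[of y0] by (intro mult_left_mono) (auto simp: H_def)
    also have "M * H y \<le> M * ((y1 - y0) * wt j (rh y))"
      by (rule mult_left_mono[OF Hy M])
    also have "M * ((y1 - y0) * wt j (rh y)) \<le> M * (cP * wt j (rh y))"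
      using M wt_rh_pos[OF ty(2)] by (intro mult_left_mono mult_right_mono) (auto simp: cP_def less_imp_le)
    finally show ?thesis by (simp add: 0 mult_ac)
  qed
qed

lemma pj_diff:
  assumes k: "is_jet k" "is_jet k'" and ty: "t \<in> {t0..t1}" "y \<in> {y0..y1}"
  shows "pj (\<lambda>j l t y. k j l t y - k' j l t y) j l t y = pj k j l t y - pj k' j l t y"
proof (cases l)
  case 0
  have "integral {y0..y} (\<lambda>x. k (Suc j) 0 t x - k' (Suc j) 0 t x)
     = integral {y0..y} (\<lambda>x. k (Suc j) 0 t x) - integral {y0..y} (\<lambda>x. k' (Suc j) 0 t x)"
    by (rule integral_diff) (rule integrable_continuous_real, rule jet_continuous_y, rule k, rule ty, rule ty)+
  thus ?thesis by (simp add: 0)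
qed simp

lemma nm_cong_diff:
  assumes "nm g M" "\<And>j l t y. t \<in> {t0..t1} \<Longrightarrow> y \<in> {y0..y1} \<Longrightarrow> h j l t y = g j l t y"
  shows "nm h M"
  using assms by (simp add: nm_def)

definition Q :: "jet \<Rightarrow> jet" where
  "Q k j l t y = jmult (pj k) (pj k) j l t y - jmult k k j l t y"

text \<open>Isolating the linear term in
  \<open>(f + k)\<^sup>2 - p\<^sup>2 = f\<^sup>2 (1 + w)\<close> gives a fixed point equation of
  this shape, with \<open>h = 1 / (2 f)\<close> and a source proportional to
  \<open>f w\<close>.\<close>

definition Theta :: "real \<Rightarrow> jet \<Rightarrow> jet \<Rightarrow> jet \<Rightarrow> jet" where
  "Theta e b h k j l t y = e * b j l t y + jmult h (Q k) j l t y"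

lemma is_jet_Theta:
  assumes "is_jet b" "is_jet h" "is_jet k" "nm k M"
  shows "is_jet (Theta e b h k)"
  unfolding Theta_def[abs_def] Q_def[abs_def]
  by (intro is_jet_add is_jet_cmult is_jet_jmult is_jet_diff is_jet_pj[OF assms(3,4)] assms)

lemma nm_Theta:
  assumes "nm b B" "nm h H" "is_jet k" "nm k r"
  shows "nm (Theta e b h k) (\<bar>e\<bar> * B + 64 * H * (cP\<^sup>2 + 1) * r\<^sup>2)"
proof -
  have "nm (Theta e b h k) (\<bar>e\<bar> * B + 8 * H * (8 * (cP * r) * (cP * r) + 8 * r * r))"
    unfolding Theta_def[abs_def] Q_def[abs_def]
    by (intro nm_add nm_cmult nm_jmult nm_diff nm_pj assms)
  thus ?thesis by (simp add: power2_eq_square algebra_simps)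
qed

lemma jmult_diff_left: "jmult (\<lambda>j l t y. g j l t y - g' j l t y) h j l t y = jmult g h j l t y - jmult g' h j l t y"
  and jmult_diff_right: "jmult g (\<lambda>j l t y. h j l t y - h' j l t y) j l t y = jmult g h j l t y - jmult g h' j l t y"
  by (simp_all add: jmult_def jprod_diff_left jprod_diff_right)

lemma nm_square_diff:
  assumes "nm g r" "nm g' r" "nm (\<lambda>j l t y. g j l t y - g' j l t y) d"
  shows "nm (\<lambda>j l t y. jmult g g j l t y - jmult g' g' j l t y) (16 * r * d)"
proof -
  have "nm (\<lambda>j l t y. jmult (\<lambda>j l t y. g j l t y - g' j l t y) g j l t y
      + jmult g' (\<lambda>j l t y. g j l t y - g' j l t y) j l t y) (8 * d * r + 8 * r * d)"
    by (intro nm_add nm_jmult assms)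
  hence "nm (\<lambda>j l t y. jmult (\<lambda>j l t y. g j l t y - g' j l t y) g j l t y
      + jmult g' (\<lambda>j l t y. g j l t y - g' j l t y) j l t y) (16 * r * d)"
    by (simp add: mult_ac)
  thus ?thesis by (rule nm_cong_diff) (simp add: jmult_diff_left jmult_diff_right)
qed

text \<open>The unknown enters quadratically, so the Lipschitz constant is proportional to the
  radius \<open>r\<close> of the ball, and a small ball is contracted. No derivative is lost because
  \<open>pj\<close> is bounded in the norm \<open>nm\<close>. The factor 128 is 16 from the
  differences of squares times 8 from the product with \<open>h\<close>.\<close>

lemma nm_Theta_diff:
  assumes h: "nm h H" and k: "is_jet k" "nm k r" and k': "is_jet k'" "nm k' r"
    and d: "nm (\<lambda>j l t y. k j l t y - k' j l t y) d"
  shows "nm (\<lambda>j l t y. Theta e b h k j l t y - Theta e b h k' j l t y) (128 * H * (cP\<^sup>2 + 1) * r * d)"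
proof -
  have p: "nm (\<lambda>j l t y. pj k j l t y - pj k' j l t y) (cP * d)"
    by (rule nm_cong_diff[OF nm_pj[OF is_jet_diff[OF k(1) k'(1)] d]]) (simp add: pj_diff k k')
  have "nm (\<lambda>j l t y. Q k j l t y - Q k' j l t y) (16 * (cP * r) * (cP * d) + 16 * r * d)"
  proof -
    have "nm (\<lambda>j l t y. (jmult (pj k) (pj k) j l t y - jmult (pj k') (pj k') j l t y)
        - (jmult k k j l t y - jmult k' k' j l t y)) (16 * (cP * r) * (cP * d) + 16 * r * d)"
      by (intro nm_diff nm_square_diff nm_pj p d k k')
    thus ?thesis by (rule nm_cong_diff) (simp add: Q_def)
  qed
  from nm_jmult[OF h this]
  have "nm (jmult h (\<lambda>j l t y. Q k j l t y - Q k' j l t y)) (128 * H * (cP\<^sup>2 + 1) * r * d)"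
    by (simp add: power2_eq_square algebra_simps)
  thus ?thesis by (rule nm_cong_diff) (simp add: Theta_def jmult_diff_right)
qed

text \<open>For each fixed order the weights are bounded on the rectangle, so Weierstrass' test
  applies to the differentiated series of every order and termwise differentiation is
  allowed.\<close>

lemma jet_series:
  assumes D: "\<And>i. is_jet (D i)" "\<And>i. nm (D i) (C * (1/2) ^ i)"
  shows "is_jet (\<lambda>j l t y. \<Sum>i. D i j l t y)"
    and "\<And>j l t y. t \<in> {t0..t1} \<Longrightarrow> y \<in> {y0..y1} \<Longrightarrow> summable (\<lambda>i. D i j l t y)"
proof -
  have b: "norm (D i j l t y) \<le> C * fact (j + l) * (1/2) ^ i" if "t \<in> {t0..t1}" "y \<in> {y0..y1}" for i j l t y
    using nm_fact[OF D(2) that, of i j l] by (simp add: mult_ac)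
  have sm: "summable (\<lambda>i. C * fact (j + l) * (1/2 :: real) ^ i)" for j l :: nat
    by (intro summable_mult summable_geometric) simp
  show sd: "summable (\<lambda>i. D i j l t y)" if "t \<in> {t0..t1}" "y \<in> {y0..y1}" for j l t y
    by (rule summable_comparison_test'[OF sm[of j l], of 0]) (use b[OF that] in blast)
  show "is_jet (\<lambda>j l t y. \<Sum>i. D i j l t y)"
    unfolding is_jet_def
  proof (intro allI ballI conjI)
    fix j l t y assume ty: "t \<in> {t0..t1}" "y \<in> {y0..y1}"
    have "uniform_limit {t0..t1} (\<lambda>n t. \<Sum>i<n. D i (Suc j) l t y) (\<lambda>t. \<Sum>i. D i (Suc j) l t y) sequentially"
      by (rule Weierstrass_m_test[OF _ sm[of "Suc j" l]]) (use b[OF _ ty(2)] in blast)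
    from has_field_derivative_series[OF convex_real_interval(5) is_jet_t[OF D(1) _ ty(2)] this ty(1) sd[OF ty]]
    obtain g where g: "\<And>x. x \<in> {t0..t1} \<Longrightarrow> (\<lambda>n. D n j l x y) sums g x \<and>
        (g has_real_derivative (\<Sum>i. D i (Suc j) l x y)) (at x within {t0..t1})"
      by blast
    show "((\<lambda>t. \<Sum>i. D i j l t y) has_real_derivative (\<Sum>i. D i (Suc j) l t y)) (at t within {t0..t1})"
      by (rule has_field_derivative_transform_within[OF conjunct2[OF g[OF ty(1)]], of 1])
         (use g ty in \<open>auto simp: sums_iff\<close>)
    have "uniform_limit {y0..y1} (\<lambda>n y. \<Sum>i<n. D i j (Suc l) t y) (\<lambda>y. \<Sum>i. D i j (Suc l) t y) sequentially"
      by (rule Weierstrass_m_test[OF _ sm[of j "Suc l"]]) (use b[OF ty(1)] in blast)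
    from has_field_derivative_series[OF convex_real_interval(5) is_jet_y[OF D(1) ty(1)] this ty(2) sd[OF ty]]
    obtain g where g: "\<And>x. x \<in> {y0..y1} \<Longrightarrow> (\<lambda>n. D n j l t x) sums g x \<and>
        (g has_real_derivative (\<Sum>i. D i j (Suc l) t x)) (at x within {y0..y1})"
      by blast
    show "((\<lambda>y. \<Sum>i. D i j l t y) has_real_derivative (\<Sum>i. D i j (Suc l) t y)) (at y within {y0..y1})"
      by (rule has_field_derivative_transform_within[OF conjunct2[OF g[OF ty(2)]], of 1])
         (use g ty in \<open>auto simp: sums_iff\<close>)
  qed
qed

text \<open>Picard iteration from 0. Completeness is replaced by summing the geometrically
  decreasing differences as a series of jets. The source uses at most half of \<open>r\<close> and
  the quadratic term at most a quarter, so the iterates stay in the ball of radius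
  \<open>r\<close>.\<close>

lemma fixed_point:
  assumes b: "is_jet b" "nm b B" and h: "is_jet h" "nm h H"
    and r: "0 < r" "128 * H * (cP\<^sup>2 + 1) * r \<le> 1/2" and e: "\<bar>e\<bar> * B \<le> r / 2"
  shows "\<exists>k. is_jet k \<and> nm k r \<and> (\<forall>t\<in>{t0..t1}. \<forall>y\<in>{y0..y1}.
     k 0 0 t y = e * b 0 0 t y + h 0 0 t y * ((pj k 0 0 t y)\<^sup>2 - (k 0 0 t y)\<^sup>2))"
proof -
  define K where "K n = ((Theta e b h) ^^ n) (\<lambda>_ _ _ _. 0)" for n
  have K_Suc: "K (Suc n) = Theta e b h (K n)" for n by (simp add: K_def)
  have K: "is_jet (K n) \<and> nm (K n) r" for n
  proof (induction n)
    case 0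
    show ?case using r by (auto simp: K_def is_jet_def nm_def intro!: mult_nonneg_nonneg less_imp_le[OF wt_rh_pos])
  next
    case (Suc n)
    have "\<bar>e\<bar> * B + 64 * H * (cP\<^sup>2 + 1) * r\<^sup>2 \<le> r"
      using e mult_right_mono[OF r(2), of r] r(1) by (simp add: power2_eq_square algebra_simps)
    thus ?case unfolding K_Suc
      using is_jet_Theta[OF b(1) h(1)] nm_Theta[OF b(2) h(2), of "K n" r e] Suc nm_mono by blast
  qed
  note Kj = conjunct1[OF K] and Kn = conjunct2[OF K]
  define D where "D n j l t y = K (Suc n) j l t y - K n j l t y" for n j l t y
  have step: "nm (\<lambda>j l t y. Theta e b h k j l t y - Theta e b h k' j l t y) (1/2 * d)"
    if "is_jet k" "nm k r" "is_jet k'" "nm k' r" "nm (\<lambda>j l t y. k j l t y - k' j l t y) d" for k k' d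
    using nm_Theta_diff[OF h(2) that, of e b] mult_right_mono[OF r(2) nm_nonneg[OF that(5)]]
    by (auto intro: nm_mono)
  have Dn: "nm (D n) (2 * r * (1/2) ^ n)" for n
  proof (induction n)
    case 0
    show ?case using nm_diff[OF Kn[of "Suc 0"] Kn[of 0]] by (simp add: D_def[abs_def])
  next
    case (Suc n)
    thus ?case using step[OF Kj Kn Kj Kn, of "Suc n" n "2 * r * (1/2) ^ n"]
      by (simp add: D_def[abs_def] K_Suc)
  qed
  have Dj: "is_jet (D n)" for n unfolding D_def[abs_def] by (intro is_jet_diff Kj)
  define L where "L j l t y = (\<Sum>i. D i j l t y)" for j l t y
  have Lj: "is_jet L" unfolding L_def[abs_def] by (rule jet_series[OF Dj Dn])
  have lim: "(\<lambda>n. K n j l t y) \<longlonglongrightarrow> L j l t y" if "t \<in> {t0..t1}" "y \<in> {y0..y1}" for j l t y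
  proof -
    have "(\<lambda>n. \<Sum>i<n. D i j l t y) \<longlonglongrightarrow> L j l t y"
      unfolding L_def by (intro summable_LIMSEQ jet_series[OF Dj Dn] that)
    moreover have "(\<Sum>i<n. D i j l t y) = K n j l t y" for n
      unfolding D_def by (subst sum_lessThan_telescope) (simp add: K_def)
    ultimately show ?thesis by simp
  qed
  have Ln: "nm L r"
  proof (rule nmI)
    fix j l t y assume ty: "t \<in> {t0..t1}" "y \<in> {y0..y1}"
    show "\<bar>L j l t y\<bar> \<le> r * wt (j + l) (rh y)"
      by (rule LIMSEQ_le_const2[OF tendsto_rabs[OF lim[OF ty]]]) (use nmD[OF Kn ty] in blast)
  qed
  \<comment> \<open>The partial geometric sum is kept in closed form so that the induction on
    \<open>i\<close> closes; the subtracted power is discarded only after the limit in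
    \<open>i\<close>.\<close>
  have diff: "\<bar>K (n + i) j l t y - K n j l t y\<bar> \<le> 4 * r * ((1/2) ^ n - (1/2) ^ (n + i)) * wt (j + l) (rh y)"
    if ty: "t \<in> {t0..t1}" "y \<in> {y0..y1}" for n i j l t y
  proof (induction i)
    case (Suc i)
    have "\<bar>K (n + Suc i) j l t y - K n j l t y\<bar> \<le> \<bar>D (n + i) j l t y\<bar> + \<bar>K (n + i) j l t y - K n j l t y\<bar>"
      by (simp add: D_def)
    also have "\<dots> \<le> 2 * r * (1/2) ^ (n + i) * wt (j + l) (rh y) + 4 * r * ((1/2) ^ n - (1/2) ^ (n + i)) * wt (j + l) (rh y)"
      by (intro add_mono Suc nmD[OF Dn ty])
    also have "\<dots> = 4 * r * ((1/2) ^ n - (1/2) ^ (n + Suc i)) * wt (j + l) (rh y)"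
      by (simp add: algebra_simps)
    finally show ?case .
  qed simp
  have LK: "nm (\<lambda>j l t y. L j l t y - K n j l t y) (4 * r * (1/2) ^ n)" for n
  proof (rule nmI)
    fix j l t y assume ty: "t \<in> {t0..t1}" "y \<in> {y0..y1}"
    have "(\<lambda>i. K (i + n) j l t y - K n j l t y) \<longlonglongrightarrow> L j l t y - K n j l t y"
      by (rule tendsto_diff[OF LIMSEQ_ignore_initial_segment[OF lim[OF ty]] tendsto_const])
    from tendsto_rabs[OF this]
    show "\<bar>L j l t y - K n j l t y\<bar> \<le> 4 * r * (1/2) ^ n * wt (j + l) (rh y)"
    proof (rule LIMSEQ_le_const2, intro exI allI impI)
      fix i
      have "4 * r * ((1/2) ^ n - (1/2) ^ (n + i)) * wt (j + l) (rh y) \<le> 4 * r * (1/2) ^ n * wt (j + l) (rh y)"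
        using r(1) wt_rh_pos[OF ty(2)] by (intro mult_right_mono mult_left_mono) (auto simp: less_imp_le)
      with diff[OF ty, of n i j l] show "\<bar>K (i + n) j l t y - K n j l t y\<bar> \<le> 4 * r * (1/2) ^ n * wt (j + l) (rh y)"
        by (simp only: add.commute[of i n])
    qed
  qed
  have "L 0 0 t y = Theta e b h L 0 0 t y" if ty: "t \<in> {t0..t1}" "y \<in> {y0..y1}" for t y
  proof -
    have "\<bar>L 0 0 t y - Theta e b h L 0 0 t y\<bar> \<le> 4 * r * wt (0 + 0) (rh y) * (1/2) ^ n" for n
    proof -
      have "\<bar>L 0 0 t y - K (Suc n) 0 0 t y\<bar> \<le> 4 * r * (1/2) ^ Suc n * wt (0 + 0) (rh y)"
        by (rule nmD[OF LK ty])
      moreover have "\<bar>Theta e b h L 0 0 t y - Theta e b h (K n) 0 0 t y\<bar> \<le> 1/2 * (4 * r * (1/2) ^ n) * wt (0 + 0) (rh y)"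
        by (rule nmD[OF step[OF Lj Ln Kj Kn LK] ty])
      ultimately show ?thesis by (simp add: K_Suc mult_ac)
    qed
    moreover have "(\<lambda>n. 4 * r * wt (0 + 0) (rh y) * (1/2) ^ n) \<longlonglongrightarrow> 0"
      by (intro tendsto_mult_right_zero LIMSEQ_realpow_zero) auto
    ultimately have "\<bar>L 0 0 t y - Theta e b h L 0 0 t y\<bar> \<le> 0"
      by (intro LIMSEQ_le_const[of _ 0]) auto
    thus ?thesis by simp
  qed
  thus ?thesis using Lj Ln
    by (intro exI[of _ L]) (simp add: Theta_def Q_def power2_eq_square)
qed

end

section \<open>Entire functions as a source of jets\<close>

lemma Suc_squared_le_power4: "(real n + 1)\<^sup>2 \<le> 4 ^ n"
proof -
  have "real (n + 1) \<le> 2 ^ n"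
    by (induction n) auto
  hence "(real n + 1)\<^sup>2 \<le> (2 ^ n)\<^sup>2" by (intro power_mono) auto
  also have "\<dots> = (4::real) ^ n" by (simp add: power2_eq_square flip: power_mult_distrib)
  finally show ?thesis .
qed

text \<open>Cauchy's inequality on discs of radius 8 produces the left side. The radius is
  \<open>4 * 2\<close>: a factor 4 pays for \<open>(n + 1)\<^sup>2\<close> and a factor 2 for
  \<open>\<rho>\<close>.\<close>

lemma fact_over_power8_le: "1 \<le> \<rho> \<Longrightarrow> \<rho> \<le> 2 \<Longrightarrow> fact n / 8 ^ n \<le> 2 * wt n \<rho>"
proof -
  assume r: "1 \<le> \<rho>" "\<rho> \<le> 2"
  have "(real n + 1)\<^sup>2 * \<rho> ^ (n + 1) \<le> 4 ^ n * 2 ^ (n + 1)"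
    using r by (intro mult_mono Suc_squared_le_power4 power_mono) auto
  also have "\<dots> = 2 * (8::real) ^ n" by (simp flip: power_mult_distrib)
  finally have le: "(real n + 1)\<^sup>2 * \<rho> ^ (n + 1) \<le> 2 * 8 ^ n" .
  have "fact n / (8::real) ^ n = 2 * (fact n / (2 * 8 ^ n))" by simp
  also have "\<dots> \<le> 2 * (fact n / ((real n + 1)\<^sup>2 * \<rho> ^ (n + 1)))"
    using r le by (intro mult_left_mono divide_left_mono mult_pos_pos) auto
  finally show ?thesis by (simp only: wt_def)
qed

text \<open>Analyticity is recorded through a complex extension, since Cauchy's inequality then
  bounds all real derivatives at once.\<close>

definition real_entire :: "(real \<Rightarrow> real) \<Rightarrow> bool" where
  "real_entire f \<longleftrightarrow> (\<exists>F. F holomorphic_on UNIV \<and> (\<forall>x. F (complex_of_real x) = complex_of_real (f x)))"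

lemma real_entire_const [simp]: "real_entire (\<lambda>_. c)"
  unfolding real_entire_def by (rule exI[of _ "\<lambda>_. complex_of_real c"]) auto

lemma real_entire_id [simp]: "real_entire (\<lambda>x. x)"
  unfolding real_entire_def by (rule exI[of _ "\<lambda>z. z"]) (auto intro: holomorphic_intros)

lemma real_entire_add: "real_entire f \<Longrightarrow> real_entire g \<Longrightarrow> real_entire (\<lambda>x. f x + g x)"
  unfolding real_entire_def
  by (elim exE, rule_tac x = "\<lambda>z. F z + Fa z" in exI) (auto intro: holomorphic_intros)

lemma real_entire_mult: "real_entire f \<Longrightarrow> real_entire g \<Longrightarrow> real_entire (\<lambda>x. f x * g x)"
  unfolding real_entire_def
  by (elim exE, rule_tac x = "\<lambda>z. F z * Fa z" in exI) (auto intro: holomorphic_intros)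

lemma real_entire_exp: "real_entire f \<Longrightarrow> real_entire (\<lambda>x. exp (f x))"
  unfolding real_entire_def
  by (elim exE, rule_tac x = "\<lambda>z. exp (F z)" in exI) (auto intro: holomorphic_intros simp: exp_of_real)

context rect begin

definition has_jet :: "(real \<Rightarrow> real \<Rightarrow> real) \<Rightarrow> bool" where
  "has_jet g \<longleftrightarrow> (\<exists>G M. is_jet G \<and> nm G M \<and> (\<forall>t\<in>{t0..t1}. \<forall>y\<in>{y0..y1}. G 0 0 t y = g t y))"

lemma has_jet_add: "has_jet g \<Longrightarrow> has_jet h \<Longrightarrow> has_jet (\<lambda>t y. g t y + h t y)"
proof -
  assume "has_jet g" "has_jet h"
  then obtain G M H N where "is_jet G" "nm G M" "is_jet H" "nm H N"
    "\<forall>t\<in>{t0..t1}. \<forall>y\<in>{y0..y1}. G 0 0 t y = g t y" "\<forall>t\<in>{t0..t1}. \<forall>y\<in>{y0..y1}. H 0 0 t y = h t y"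
    unfolding has_jet_def by blast
  thus ?thesis unfolding has_jet_def
    by (intro exI[of _ "\<lambda>j l t y. G j l t y + H j l t y"] exI[of _ "M + N"]) (simp add: is_jet_add nm_add)
qed

lemma has_jet_mult: "has_jet g \<Longrightarrow> has_jet h \<Longrightarrow> has_jet (\<lambda>t y. g t y * h t y)"
proof -
  assume "has_jet g" "has_jet h"
  then obtain G M H N where "is_jet G" "nm G M" "is_jet H" "nm H N"
    "\<forall>t\<in>{t0..t1}. \<forall>y\<in>{y0..y1}. G 0 0 t y = g t y" "\<forall>t\<in>{t0..t1}. \<forall>y\<in>{y0..y1}. H 0 0 t y = h t y"
    unfolding has_jet_def by blast
  thus ?thesis unfolding has_jet_def
    by (intro exI[of _ "jmult G H"] exI[of _ "8 * M * N"]) (simp add: is_jet_jmult nm_jmult)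
qed

text \<open>Mixed derivatives are \<open>a ^ j * b ^ l\<close> times a derivative of order
  \<open>j + l\<close> of the extension. The assumptions on \<open>a\<close> and \<open>b\<close>
  keep this factor at most 1, and the derivative is estimated by Cauchy's inequality on a disc of
  radius 8.\<close>

lemma has_jet_entire:
  assumes f: "real_entire f" and ab: "\<bar>a\<bar> \<le> 1" "\<bar>b\<bar> \<le> 1"
  shows "has_jet (\<lambda>t y. f (a * t + b * y))"
proof -
  from f obtain F where F: "F holomorphic_on UNIV" and Ff: "\<And>x. F (complex_of_real x) = complex_of_real (f x)"
    unfolding real_entire_def by blast
  define G where "G j l t y = a ^ j * b ^ l * Re ((deriv ^^ (j + l)) F (complex_of_real (a * t + b * y)))" for j l t y
  have Fn: "(deriv ^^ n) F holomorphic_on UNIV" for n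
    by (rule holomorphic_higher_deriv[OF F open_UNIV])
  have D: "((\<lambda>x. Re ((deriv ^^ n) F (complex_of_real x))) has_real_derivative
      Re ((deriv ^^ Suc n) F (complex_of_real x))) (at x)" for n x
  proof -
    have "((deriv ^^ n) F has_field_derivative (deriv ^^ Suc n) F (of_real x)) (at (of_real x))"
      using holomorphic_derivI[OF Fn open_UNIV UNIV_I, of n "of_real x"] by simp
    from has_vector_derivative_real_field[OF this]
    have "((\<lambda>x. (deriv ^^ n) F (of_real x)) has_vector_derivative (deriv ^^ Suc n) F (of_real x)) (at x)" .
    from bounded_linear.has_vector_derivative[OF bounded_linear_Re this]
    show ?thesis by (simp add: has_real_derivative_iff_has_vector_derivative)
  qed
  have "is_jet G"
    unfolding is_jet_def
  proof (intro allI ballI conjI)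
    fix j l t y
    have "((\<lambda>t. a * t + b * y) has_real_derivative a) (at t within {t0..t1})"
      by (auto intro!: derivative_eq_intros)
    from DERIV_chain2[OF D this]
    have "((\<lambda>t. Re ((deriv ^^ (j + l)) F (complex_of_real (a * t + b * y)))) has_real_derivative
      Re ((deriv ^^ Suc (j + l)) F (complex_of_real (a * t + b * y))) * a) (at t within {t0..t1})" .
    from DERIV_cmult[OF this, of "a ^ j * b ^ l"]
    show "((\<lambda>t. G j l t y) has_real_derivative G (Suc j) l t y) (at t within {t0..t1})"
      by (simp add: G_def mult_ac)
    have "((\<lambda>y. a * t + b * y) has_real_derivative b) (at y within {y0..y1})"
      by (auto intro!: derivative_eq_intros)
    from DERIV_chain2[OF D this]
    have "((\<lambda>y. Re ((deriv ^^ (j + l)) F (complex_of_real (a * t + b * y)))) has_real_derivative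
      Re ((deriv ^^ Suc (j + l)) F (complex_of_real (a * t + b * y))) * b) (at y within {y0..y1})" .
    from DERIV_cmult[OF this, of "a ^ j * b ^ l"]
    show "((\<lambda>y. G j l t y) has_real_derivative G j (Suc l) t y) (at y within {y0..y1})"
      by (simp add: G_def mult_ac)
  qed
  moreover
  define K where "K = \<bar>t0\<bar> + \<bar>t1\<bar> + \<bar>y0\<bar> + \<bar>y1\<bar>"
  have contF: "continuous_on S F" for S
    by (rule holomorphic_on_imp_continuous_on[OF holomorphic_on_subset[OF F]]) simp
  have "compact (F ` cball 0 (K + 8))" by (intro compact_continuous_image contF) simp
  then obtain B where "\<forall>w \<in> F ` cball 0 (K + 8). cmod w \<le> B"
    using compact_imp_bounded bounded_iff by metis
  hence B: "cmod (F z) \<le> B" if "z \<in> cball 0 (K + 8)" for z using that by blast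
  have B0: "B \<ge> 0" using order_trans[OF norm_ge_zero B[of 0]] by (simp add: K_def)
  have "nm G (2 * B)"
  proof (rule nmI)
    fix j l t y assume ty: "t \<in> {t0..t1}" "y \<in> {y0..y1}"
    define x where "x = a * t + b * y"
    have "\<bar>a * t\<bar> \<le> 1 * \<bar>t\<bar>" "\<bar>b * y\<bar> \<le> 1 * \<bar>y\<bar>"
      unfolding abs_mult by (intro mult_right_mono ab; simp)+
    hence x: "\<bar>x\<bar> \<le> K" using ty by (auto simp: x_def K_def)
    have "cmod ((deriv ^^ (j + l)) F (of_real x)) \<le> fact (j + l) * B / 8 ^ (j + l)"
    proof (rule Cauchy_inequality)
      show "F holomorphic_on ball (of_real x) 8" by (rule holomorphic_on_subset[OF F]) simp
      fix z assume "cmod (of_real x - z) = 8"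
      hence "cmod z \<le> \<bar>x\<bar> + 8" using norm_triangle_ineq2[of z "of_real x"] by (simp add: norm_minus_commute)
      thus "cmod (F z) \<le> B" using x by (intro B) auto
    qed (auto intro: contF)
    also have "\<dots> = B * (fact (j + l) / 8 ^ (j + l))" by simp
    also have "\<dots> \<le> B * (2 * wt (j + l) (rh y))"
      using B0 rh_bounds[OF ty(2)] by (intro mult_left_mono fact_over_power8_le) auto
    finally have d: "\<bar>Re ((deriv ^^ (j + l)) F (of_real x))\<bar> \<le> 2 * B * wt (j + l) (rh y)"
      using abs_Re_le_cmod[of "(deriv ^^ (j + l)) F (of_real x)"] by simp
    have "\<bar>a ^ j * b ^ l\<bar> \<le> 1"
      unfolding abs_mult power_abs using ab by (intro mult_le_one power_le_one) auto
    hence "\<bar>a ^ j * b ^ l\<bar> * \<bar>Re ((deriv ^^ (j + l)) F (of_real x))\<bar> \<le> 1 * (2 * B * wt (j + l) (rh y))"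
      by (intro mult_mono d) auto
    thus "\<bar>G j l t y\<bar> \<le> 2 * B * wt (j + l) (rh y)"
      by (simp add: G_def abs_mult x_def)
  qed
  moreover have "G 0 0 t y = f (a * t + b * y)" for t y
    using Ff[of "a * t + b * y"] by (simp add: G_def)
  ultimately show ?thesis unfolding has_jet_def by blast
qed

lemma small_solution:
  assumes b: "has_jet b" and h: "has_jet h" and r: "r > 0"
  obtains e0 where "e0 > 0" "\<And>e. 0 < e \<Longrightarrow> e < e0 \<Longrightarrow>
     \<exists>k p. is_jet k \<and> is_jet p \<and> nm k r \<and> nm p r \<and>
       (\<forall>t\<in>{t0..t1}. \<forall>y\<in>{y0..y1}. p 0 1 t y = k 1 0 t y \<and>
          k 0 0 t y = e * b t y + h t y * ((p 0 0 t y)\<^sup>2 - (k 0 0 t y)\<^sup>2))"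
proof -
  obtain Bj B where B: "is_jet Bj" "nm Bj B" "\<And>t y. t\<in>{t0..t1} \<Longrightarrow> y\<in>{y0..y1} \<Longrightarrow> Bj 0 0 t y = b t y"
    using b unfolding has_jet_def by blast
  obtain Hj H where H: "is_jet Hj" "nm Hj H" "\<And>t y. t\<in>{t0..t1} \<Longrightarrow> y\<in>{y0..y1} \<Longrightarrow> Hj 0 0 t y = h t y"
    using h unfolding has_jet_def by blast
  note B0 = nm_nonneg[OF B(2)] note H0 = nm_nonneg[OF H(2)]
  define q where "q = 256 * (H + 1) * (cP\<^sup>2 + 1)"
  have q: "q > 0" using H0 by (auto simp: q_def intro!: mult_pos_pos add_nonneg_pos)
  \<comment> \<open>The bound \<open>r / cP\<close> keeps \<open>pj k\<close> below
    \<open>r\<close>, and \<open>1 / q\<close> yields the contraction hypothesis of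
    \<open>fixed_point\<close>.\<close>
  define r' where "r' = min (r / cP) (1 / q)"
  have cP: "cP \<ge> 1" by (simp add: cP_def)
  have r': "r' > 0" "cP * r' \<le> r" "r' \<le> r" "q * r' \<le> 1"
  proof -
    show "r' > 0" using r q cP by (simp add: r'_def)
    have "r' \<le> r / cP" by (simp add: r'_def)
    thus 1: "cP * r' \<le> r" using cP by (simp add: pos_le_divide_eq mult.commute)
    have "1 * r' \<le> cP * r'" using cP \<open>r' > 0\<close> by (intro mult_right_mono) auto
    with 1 show "r' \<le> r" by linarith
    have "r' \<le> 1 / q" by (simp add: r'_def)
    thus "q * r' \<le> 1" using q by (simp add: pos_le_divide_eq mult.commute)
  qed
  have hyp: "128 * H * (cP\<^sup>2 + 1) * r' \<le> 1/2"
  proof -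
    have "128 * H * (cP\<^sup>2 + 1) \<le> q / 2" using H0 by (simp add: q_def algebra_simps)
    hence "128 * H * (cP\<^sup>2 + 1) * r' \<le> q / 2 * r'" using r' by (intro mult_right_mono) auto
    thus ?thesis using r'(4) by simp
  qed
  show ?thesis
  proof (rule that[of "r' / (2 * (B + 1))"])
    show "r' / (2 * (B + 1)) > 0" using r' B0 by simp
    fix e :: real assume e: "0 < e" "e < r' / (2 * (B + 1))"
    have "e * (2 * (B + 1)) < r'" using e(2) B0 by (subst (asm) pos_less_divide_eq) auto
    hence "\<bar>e\<bar> * B \<le> r' / 2" using e(1) by (simp add: algebra_simps)
    from fixed_point[OF B(1,2) H(1,2) r'(1) hyp this] obtain k where k: "is_jet k" "nm k r'"
      "\<forall>t\<in>{t0..t1}. \<forall>y\<in>{y0..y1}. k 0 0 t y = e * Bj 0 0 t y + Hj 0 0 t y * ((pj k 0 0 t y)\<^sup>2 - (k 0 0 t y)\<^sup>2)"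
      by blast
    show "\<exists>k p. is_jet k \<and> is_jet p \<and> nm k r \<and> nm p r \<and>
       (\<forall>t\<in>{t0..t1}. \<forall>y\<in>{y0..y1}. p 0 1 t y = k 1 0 t y \<and>
          k 0 0 t y = e * b t y + h t y * ((p 0 0 t y)\<^sup>2 - (k 0 0 t y)\<^sup>2))"
    proof (rule exI[of _ k], rule exI[of _ "pj k"], intro conjI ballI)
      fix t y assume ty: "t \<in> {t0..t1}" "y \<in> {y0..y1}"
      show "pj k 0 1 t y = k 1 0 t y" by (simp add: pj_def)
      show "k 0 0 t y = e * b t y + h t y * ((pj k 0 0 t y)\<^sup>2 - (k 0 0 t y)\<^sup>2)"
        using k(3) ty B(3)[OF ty] H(3)[OF ty] by metis
    qed (use k r' is_jet_pj[OF k(1,2)] nm_mono[OF nm_pj[OF k(1,2)]] nm_mono[OF k(2)] in auto)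
  qed
qed

end

lemma abs_mult_le: "\<bar>x\<bar> \<le> a \<Longrightarrow> \<bar>y\<bar> \<le> b \<Longrightarrow> \<bar>x * y\<bar> \<le> a * (b :: real)"
  unfolding abs_mult by (rule mult_mono) auto

section \<open>Differential calculus on space-time\<close>

lemma pd_eq: "(f has_derivative f') (at p) \<Longrightarrow> pd f w p = f' w"
  unfolding pd_def by (simp flip: frechet_derivative_at)

lemma pd_cong:
  assumes "open U" "p \<in> U" "\<And>x. x \<in> U \<Longrightarrow> f x = g x" "f differentiable at p"
  shows "g differentiable at p" "pd g w p = pd f w p"
proof -
  obtain f' where f': "(f has_derivative f') (at p)" using assms(4) by (auto simp: differentiable_def)
  have g': "(g has_derivative f') (at p)"
    by (rule has_derivative_transform_within_open[OF f' assms(1,2)]) (use assms in auto)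
  show "g differentiable at p" using g' by (auto simp: differentiable_def)
  show "pd g w p = pd f w p" by (simp add: pd_eq[OF f'] pd_eq[OF g'])
qed

text \<open>Class C^n, by recursion over partial derivatives along the basis: closure properties
  become inductions on \<open>n\<close>, and the case \<open>n = 2\<close> unfolds to the conditions
  in \<open>C2_on\<close>.\<close>

primrec ck :: "nat \<Rightarrow> (pt \<Rightarrow> 'b::real_normed_vector) \<Rightarrow> pt set \<Rightarrow> bool" where
  "ck 0 f U = continuous_on U f"
| "ck (Suc n) f U = ((\<forall>p\<in>U. f differentiable at p) \<and> (\<forall>w\<in>Basis. ck n (pd f w) U))"

lemma ck_cong:
  assumes "open U"
  shows "ck n f U \<Longrightarrow> (\<And>p. p \<in> U \<Longrightarrow> f p = g p) \<Longrightarrow> ck n g U"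
proof (induction n arbitrary: f g)
  case 0
  thus ?case by (simp cong: continuous_on_cong)
next
  case (Suc n)
  show ?case unfolding ck.simps
  proof (intro conjI ballI)
    show "g differentiable at p" if "p \<in> U" for p
      by (rule pd_cong(1)[OF assms that, of f]) (use Suc.prems that in auto)
    fix w :: pt assume "w \<in> Basis"
    hence "ck n (pd f w) U" using Suc.prems(1) by auto
    thus "ck n (pd g w) U"
    proof (rule Suc.IH)
      fix p assume p: "p \<in> U"
      show "pd f w p = pd g w p"
        by (rule pd_cong(2)[OF assms p, of f, symmetric]) (use Suc.prems p in auto)
    qed
  qed
qed

lemma ck_SucI:
  assumes "open U" "\<And>p. p \<in> U \<Longrightarrow> (f has_derivative f' p) (at p)" "\<And>w. w \<in> Basis \<Longrightarrow> ck n (\<lambda>p. f' p w) U"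
  shows "ck (Suc n) f U"
  unfolding ck.simps
proof (intro conjI ballI)
  show "f differentiable at p" if "p \<in> U" for p using assms(2)[OF that] by (auto simp: differentiable_def)
  show "ck n (pd f w) U" if "w \<in> Basis" for w
    by (rule ck_cong[OF assms(1) assms(3)[OF that]]) (simp add: pd_eq[OF assms(2)])
qed

lemma ck_continuous: "ck n f U \<Longrightarrow> continuous_on U f"
  by (cases n) (auto intro!: continuous_at_imp_continuous_on differentiable_imp_continuous_within)

lemma ck_Suc_imp: "ck (Suc n) f U \<Longrightarrow> ck n f U"
proof (induction n arbitrary: f)
  case 0
  thus ?case using ck_continuous[of "Suc 0" f U] by simp
next
  case (Suc n)
  show ?case unfolding ck.simps
  proof (intro conjI ballI)
    show "f differentiable at p" if "p \<in> U" for p using Suc.prems that by auto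
    show "ck n (pd f w) U" if "w \<in> Basis" for w
    proof (rule Suc.IH)
      show "ck (Suc n) (pd f w) U" using Suc.prems that unfolding ck.simps(2)[of "Suc n"] by blast
    qed
  qed
qed

lemma ck_subset: "ck n f U \<Longrightarrow> V \<subseteq> U \<Longrightarrow> ck n f V"
  by (induction n arbitrary: f) (auto intro: continuous_on_subset)

lemma ck_const: "open U \<Longrightarrow> ck n (\<lambda>_. k) U"
proof (induction n arbitrary: k)
  case (Suc n)
  thus ?case by (intro ck_SucI[of U _ "\<lambda>_ _. 0"]) auto
qed simp

lemma ck_bounded_linear: "open U \<Longrightarrow> bounded_linear f \<Longrightarrow> ck n f U"
proof (cases n)
  case 0
  assume "bounded_linear f"
  thus ?thesis using 0 by (simp add: linear_continuous_on)
next
  case (Suc m)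
  assume "open U" "bounded_linear f"
  thus ?thesis unfolding Suc
    by (intro ck_SucI[of U _ "\<lambda>_. f"] bounded_linear_imp_has_derivative ck_const)
qed

lemma ck_comp_linear: "open U \<Longrightarrow> bounded_linear L \<Longrightarrow> ck n f U \<Longrightarrow> ck n (\<lambda>p. L (f p)) U"
proof (induction n arbitrary: f)
  case 0
  thus ?case using continuous_on_compose2[OF linear_continuous_on[of L UNIV], of U f] by auto
next
  case (Suc n)
  show ?case
  proof (rule ck_SucI[OF Suc.prems(1), of _ "\<lambda>p w. L (pd f w p)"])
    fix p assume "p \<in> U"
    hence "(f has_derivative (\<lambda>w. pd f w p)) (at p)"
      using Suc.prems(3) by (auto simp: pd_def frechet_derivative_works)
    from bounded_linear.has_derivative[OF Suc.prems(2) this]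
    show "((\<lambda>p. L (f p)) has_derivative (\<lambda>w. L (pd f w p))) (at p)" .
  qed (use Suc in auto)
qed

lemma ck_has_derivative: "ck (Suc n) f U \<Longrightarrow> p \<in> U \<Longrightarrow> (f has_derivative (\<lambda>w. pd f w p)) (at p)"
  by (auto simp: pd_def frechet_derivative_works)

lemma ck_add: "open U \<Longrightarrow> ck n f U \<Longrightarrow> ck n g U \<Longrightarrow> ck n (\<lambda>p. f p + g p) U"
proof (induction n arbitrary: f g)
  case (Suc n)
  show ?case
    by (rule ck_SucI[OF Suc.prems(1) has_derivative_add[OF ck_has_derivative[OF Suc.prems(2)] ck_has_derivative[OF Suc.prems(3)]]])
      (use Suc in auto)
qed (auto intro: continuous_intros)

lemma ck_mult:
  fixes f g :: "pt \<Rightarrow> 'a::real_normed_algebra"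
  shows "open U \<Longrightarrow> ck n f U \<Longrightarrow> ck n g U \<Longrightarrow> ck n (\<lambda>p. f p * g p) U"
proof (induction n arbitrary: f g)
  case (Suc n)
  show ?case
    by (rule ck_SucI[OF Suc.prems(1) has_derivative_mult[OF ck_has_derivative[OF Suc.prems(2)] ck_has_derivative[OF Suc.prems(3)]]])
      (use Suc ck_Suc_imp[OF Suc.prems(2)] ck_Suc_imp[OF Suc.prems(3)] in \<open>auto intro!: ck_add\<close>)
qed (auto intro: continuous_intros)

lemma ck_cmult:
  fixes f :: "pt \<Rightarrow> 'a::real_normed_algebra"
  shows "open U \<Longrightarrow> ck n f U \<Longrightarrow> ck n (\<lambda>p. k * f p) U"
  by (intro ck_mult ck_const)

lemma ck_minus: "open U \<Longrightarrow> ck n f U \<Longrightarrow> ck n (\<lambda>p. - f p) U"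
  by (rule ck_comp_linear[OF _ bounded_linear_minus[OF bounded_linear_ident]])

lemma ck_diff: "open U \<Longrightarrow> ck n f U \<Longrightarrow> ck n g U \<Longrightarrow> ck n (\<lambda>p. f p - g p) U"
  using ck_add[of U n f "\<lambda>p. - g p"] ck_minus[of U n g] by simp

lemma ck_power:
  fixes f :: "pt \<Rightarrow> real"
  shows "open U \<Longrightarrow> ck n f U \<Longrightarrow> ck n (\<lambda>p. f p ^ k) U"
  by (induction k) (auto intro: ck_const ck_mult)

lemma ck_exp:
  fixes f :: "pt \<Rightarrow> real"
  shows "open U \<Longrightarrow> ck n f U \<Longrightarrow> ck n (\<lambda>p. exp (f p)) U"
proof (induction n)
  case (Suc n)
  have d: "((\<lambda>p. exp (f p)) has_derivative (\<lambda>w. pd f w p * exp (f p))) (at p)" if "p \<in> U" for p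
    using has_derivative_exp[OF ck_has_derivative[OF Suc.prems(2) that]] .
  show ?case
    by (rule ck_SucI[OF Suc.prems(1) d]) (use Suc ck_Suc_imp[OF Suc.prems(2)] in \<open>auto intro!: ck_mult\<close>)
qed (auto intro: continuous_intros)

lemma ck_sin_cos:
  fixes f :: "pt \<Rightarrow> real"
  shows "open U \<Longrightarrow> ck n f U \<Longrightarrow> ck n (\<lambda>p. sin (f p)) U \<and> ck n (\<lambda>p. cos (f p)) U"
proof (induction n)
  case (Suc n)
  have IH: "ck n (\<lambda>p. sin (f p)) U" "ck n (\<lambda>p. cos (f p)) U"
    using Suc ck_Suc_imp[OF Suc.prems(2)] by auto
  have d: "((\<lambda>p. sin (f p)) has_derivative (\<lambda>w. pd f w p * cos (f p))) (at p)"
    "((\<lambda>p. cos (f p)) has_derivative (\<lambda>w. pd f w p * (-1 * sin (f p)))) (at p)" if "p \<in> U" for p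
    using has_derivative_sin[OF ck_has_derivative[OF Suc.prems(2) that]]
      has_derivative_cos[OF ck_has_derivative[OF Suc.prems(2) that]] by (simp_all add: mult.commute)
  show ?case
    by (intro conjI ck_SucI[OF Suc.prems(1) d(1)] ck_SucI[OF Suc.prems(1) d(2)])
      (use Suc IH in \<open>auto intro!: ck_mult ck_minus\<close>)
qed (auto intro: continuous_intros)

lemma ck_2_imp_C2_on: "open U \<Longrightarrow> S \<subseteq> U \<Longrightarrow> ck 2 f U \<Longrightarrow> C2_on f S"
  unfolding C2_on_def by (intro exI[of _ U]) (auto simp: numeral_2_eq_2)

lemma ck_polar:
  assumes "open U" "ck n u U" "ck n S U"
  shows "ck n (\<lambda>p. complex_of_real (u p) * cis (S p)) U"
proof -
  have r: "ck n (\<lambda>p. complex_of_real (f p)) U" if "ck n f U" for f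
    by (rule ck_comp_linear[OF assms(1) bounded_linear_of_real that])
  have "ck n (\<lambda>p. complex_of_real (u p) * (complex_of_real (cos (S p)) + \<i> * complex_of_real (sin (S p)))) U"
    using ck_sin_cos[OF assms(1,3)] assms
    by (intro ck_mult ck_add ck_const r) auto
  moreover have "complex_of_real (cos x) + \<i> * complex_of_real (sin x) = cis x" for x
    by (simp add: complex_eq_iff)
  ultimately show ?thesis by simp
qed

text \<open>Total differentiability and the four partial derivatives in a single statement: the
  former is what the chain rule needs, the latter is what \<open>pd\<close> evaluates to, and rules
  such as \<open>d4_mult\<close> compute both together.\<close>

definition d4 :: "(pt \<Rightarrow> real) \<Rightarrow> real \<Rightarrow> real \<Rightarrow> real \<Rightarrow> real \<Rightarrow> pt \<Rightarrow> bool" where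
  "d4 f f0 f1 f2 f3 p \<longleftrightarrow>
     (f has_derivative (\<lambda>w. f0 * fst w + f1 * (snd w $ 1) + f2 * (snd w $ 2) + f3 * (snd w $ 3))) (at p)"

lemma d4_const: "d4 (\<lambda>_. k) 0 0 0 0 p"
  by (simp add: d4_def)

lemma d4_t: "d4 fst 1 0 0 0 p"
  by (simp add: d4_def has_derivative_fst[OF has_derivative_ident])

lemma has_derivative_component: "((\<lambda>p. snd p $ i) has_derivative (\<lambda>w. snd w $ i)) (at p)"
  by (intro bounded_linear_imp_has_derivative
      bounded_linear_compose[OF bounded_linear_vec_nth bounded_linear_snd])

lemma d4_x1: "d4 (\<lambda>p. snd p $ 1) 0 1 0 0 p" and d4_x2: "d4 (\<lambda>p. snd p $ 2) 0 0 1 0 p"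
  and d4_x3: "d4 (\<lambda>p. snd p $ 3) 0 0 0 1 p"
  by (simp_all add: d4_def has_derivative_component)

lemma d4_add: "d4 f f0 f1 f2 f3 p \<Longrightarrow> d4 g g0 g1 g2 g3 p \<Longrightarrow>
    d4 (\<lambda>p. f p + g p) (f0 + g0) (f1 + g1) (f2 + g2) (f3 + g3) p"
  unfolding d4_def by (drule (1) has_derivative_add) (simp add: algebra_simps)

lemma d4_mult: "d4 f f0 f1 f2 f3 p \<Longrightarrow> d4 g g0 g1 g2 g3 p \<Longrightarrow>
    d4 (\<lambda>p. f p * g p) (f p * g0 + f0 * g p) (f p * g1 + f1 * g p) (f p * g2 + f2 * g p) (f p * g3 + f3 * g p) p"
  unfolding d4_def by (drule (1) has_derivative_mult) (simp add: algebra_simps)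

lemma d4_cmult: "d4 f f0 f1 f2 f3 p \<Longrightarrow> d4 (\<lambda>p. k * f p) (k * f0) (k * f1) (k * f2) (k * f3) p"
  using d4_mult[OF d4_const] by simp

lemma d4_diff: "d4 f f0 f1 f2 f3 p \<Longrightarrow> d4 g g0 g1 g2 g3 p \<Longrightarrow>
    d4 (\<lambda>p. f p - g p) (f0 - g0) (f1 - g1) (f2 - g2) (f3 - g3) p"
  unfolding d4_def by (drule (1) has_derivative_diff) (simp add: algebra_simps)

lemma d4_chain: "(h has_real_derivative h') (at (f p)) \<Longrightarrow> d4 f f0 f1 f2 f3 p \<Longrightarrow>
    d4 (\<lambda>p. h (f p)) (h' * f0) (h' * f1) (h' * f2) (h' * f3) p"
  unfolding d4_def has_field_derivative_def
  by (drule (1) has_derivative_compose[rotated]) (simp add: algebra_simps)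

lemma d4_cong: "d4 f f0 f1 f2 f3 p \<Longrightarrow> open U \<Longrightarrow> p \<in> U \<Longrightarrow> (\<And>x. x \<in> U \<Longrightarrow> f x = g x) \<Longrightarrow>
    f0 = g0 \<Longrightarrow> f1 = g1 \<Longrightarrow> f2 = g2 \<Longrightarrow> f3 = g3 \<Longrightarrow> d4 g g0 g1 g2 g3 p"
  unfolding d4_def by (auto intro: has_derivative_transform_within_open)

lemma e_t_simps [simp]: "fst e_t = 1" "snd e_t = 0" and e_x_simps [simp]: "fst (e_x i) = 0" "snd (e_x i) = axis i 1"
  by (simp_all add: e_t_def e_x_def)

lemma d4_pd:
  assumes "d4 f f0 f1 f2 f3 p"
  shows "pd f e_t p = f0" "pd f (e_x 1) p = f1" "pd f (e_x 2) p = f2" "pd f (e_x 3) p = f3"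
  by (simp_all add: pd_eq[OF assms[unfolded d4_def]] axis_def)

lemma polar_derivative:
  assumes a: "(a has_derivative a') (at p)" and S: "(S has_derivative S') (at p)"
  shows "((\<lambda>p. a p * cis (S p)) has_derivative
     (\<lambda>w. (a' w + \<i> * a p * complex_of_real (S' w)) * cis (S p))) (at p)"
proof -
  have "((\<lambda>p. cis (S p)) has_derivative (\<lambda>w. S' w *\<^sub>R (\<i> * cis (S p)))) (at p)"
    using has_derivative_cis[OF S] .
  from has_derivative_mult[OF a this] show ?thesis
    by (rule has_derivative_eq_rhs) (auto simp: fun_eq_iff algebra_simps scaleR_conv_of_real)
qed

section \<open>The equation in polar form\<close>

text \<open>\<open>a\<close> and \<open>b\<close> are the components in the frame rotating with the
  phase. The derivatives of such a function have the same form, so two applications of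
  \<open>dt_tilde\<close> or \<open>pd\<close> reduce to real calculus.\<close>

definition pol :: "(pt \<Rightarrow> real) \<Rightarrow> (pt \<Rightarrow> real) \<Rightarrow> (pt \<Rightarrow> real) \<Rightarrow> pt \<Rightarrow> complex" where
  "pol a b S p = (complex_of_real (a p) + \<i> * complex_of_real (b p)) * cis (S p)"

lemma pol_has_derivative:
  assumes "(a has_derivative a') (at p)" "(b has_derivative b') (at p)" "(S has_derivative S') (at p)"
  shows "(pol a b S has_derivative
    (\<lambda>w. (complex_of_real (a' w - b p * S' w) + \<i> * complex_of_real (b' w + a p * S' w)) * cis (S p))) (at p)"
proof -
  have "((\<lambda>p. complex_of_real (a p) + \<i> * complex_of_real (b p)) has_derivative
      (\<lambda>w. complex_of_real (a' w) + \<i> * complex_of_real (b' w))) (at p)"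
    by (intro has_derivative_add has_derivative_mult_right has_derivative_of_real assms)
  from polar_derivative[OF this assms(3)] show ?thesis
    unfolding pol_def[abs_def]
    by (rule has_derivative_eq_rhs) (simp add: fun_eq_iff complex_eq_iff algebra_simps)
qed

lemma pd_pol:
  assumes "d4 a a0 a1 a2 a3 p" "d4 b b0 b1 b2 b3 p" "d4 S s0 s1 s2 s3 p"
  shows "pd (pol a b S) e_t p = (complex_of_real (a0 - b p * s0) + \<i> * complex_of_real (b0 + a p * s0)) * cis (S p)"
    "pd (pol a b S) (e_x 1) p = (complex_of_real (a1 - b p * s1) + \<i> * complex_of_real (b1 + a p * s1)) * cis (S p)"
    "pd (pol a b S) (e_x 2) p = (complex_of_real (a2 - b p * s2) + \<i> * complex_of_real (b2 + a p * s2)) * cis (S p)"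
    "pd (pol a b S) (e_x 3) p = (complex_of_real (a3 - b p * s3) + \<i> * complex_of_real (b3 + a p * s3)) * cis (S p)"
  by (simp_all add: pd_eq[OF pol_has_derivative[OF assms[unfolded d4_def]]] axis_def)

lemma pol_differentiable:
  assumes "d4 a a0 a1 a2 a3 p" "d4 b b0 b1 b2 b3 p" "d4 S s0 s1 s2 s3 p"
  shows "pol a b S differentiable at p"
  using pol_has_derivative[OF assms[unfolded d4_def]] by (auto simp: differentiable_def)

lemma cmod_pol: "cmod ((complex_of_real x + \<i> * complex_of_real y) * cis \<theta>) ^ 2 = x\<^sup>2 + y\<^sup>2"
  by (simp add: norm_mult cmod_power2)

lemma d4_0: "d4 (\<lambda>_. 0) 0 0 0 0 p" by (rule d4_const)

text \<open>\<open>\<Phi>\<close> is the gauge-covariant time derivative of the phase. In the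
  equation and in the energy, \<open>St\<close> and \<open>\<phi>\<close> occur only through it;
  \<open>conc_dens\<close> uses plain derivatives and hence \<open>St\<close>.\<close>

locale polar_field =
  fixes c m q ch a :: real and \<phi> u S ut u1 u2 u3 St Sz \<Phi> :: "pt \<Rightarrow> real" and U :: "pt set"
  assumes U: "open U"
    and du: "\<And>p. p \<in> U \<Longrightarrow> d4 u (ut p) (u1 p) (u2 p) (u3 p) p"
    and dS: "\<And>p. p \<in> U \<Longrightarrow> d4 S (St p) 0 0 (Sz p) p"
    and Phi: "\<And>p. p \<in> U \<Longrightarrow> \<Phi> p = St p + q * \<phi> p / ch"
begin

definition \<psi> :: "pt \<Rightarrow> complex" where "\<psi> p = complex_of_real (u p) * cis (S p)"

lemma psi_pol: "\<psi> = pol u (\<lambda>_. 0) S"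
  by (simp add: fun_eq_iff \<psi>_def pol_def)

lemma psi_cmod: "(cmod (\<psi> p))\<^sup>2 = (u p)\<^sup>2"
  by (simp add: \<psi>_def norm_mult)

lemma pd_psi:
  assumes "p \<in> U"
  shows "pd \<psi> e_t p = pol ut (\<lambda>p. u p * St p) S p" "pd \<psi> (e_x 1) p = pol u1 (\<lambda>_. 0) S p"
    "pd \<psi> (e_x 2) p = pol u2 (\<lambda>_. 0) S p" "pd \<psi> (e_x 3) p = pol u3 (\<lambda>p. u p * Sz p) S p"
  unfolding psi_pol pd_pol[OF du[OF assms] d4_0 dS[OF assms]] by (simp_all add: pol_def)

lemma dt_psi:
  assumes "p \<in> U"
  shows "dt_tilde q ch \<phi> \<psi> p = pol ut (\<lambda>p. u p * \<Phi> p) S p"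
  unfolding dt_tilde_def pd_psi[OF assms]
  by (simp add: pol_def \<psi>_def Phi[OF assms] complex_eq_iff algebra_simps)

lemma energy_density_polar:
  assumes "p \<in> U"
  shows "energy_density c m q ch a \<phi> \<psi> p = ch\<^sup>2 / (2 * m) * (((ut p)\<^sup>2 + (u p * \<Phi> p)\<^sup>2) / c\<^sup>2
     + ((u1 p)\<^sup>2 + (u2 p)\<^sup>2 + (u3 p)\<^sup>2 + (u p * Sz p)\<^sup>2) + Gfun a ((u p)\<^sup>2) + (m * c / ch)\<^sup>2 * (u p)\<^sup>2)"
  unfolding energy_density_def dt_psi[OF assms] sum_3 pd_psi[OF assms] psi_cmod
  by (simp only: pol_def cmod_pol) simp

lemma conc_dens_polar:
  assumes "p \<in> U"
  shows "conc_dens c m ch a \<psi> p = (ch / (m * c))\<^sup>2 * (((ut p)\<^sup>2 + (u p * St p)\<^sup>2) / c\<^sup>2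
     + ((u1 p)\<^sup>2 + (u2 p)\<^sup>2 + (u3 p)\<^sup>2 + (u p * Sz p)\<^sup>2)) + (ch / (m * c))\<^sup>2 * \<bar>Gfun a ((u p)\<^sup>2)\<bar> + (u p)\<^sup>2"
  unfolding conc_dens_def grad0_sq_def sum_3 pd_psi[OF assms] psi_cmod
  by (simp only: pol_def cmod_pol) simp

text \<open>The real part of the equation is a Hamilton-Jacobi equation with quantum potential, the
  imaginary part is the continuity equation divided by \<open>u\<close>.\<close>
lemma KG_eq_polar:
  assumes p: "p \<in> U"
    and d2: "d4 ut utt a1 a2 a3 p" "d4 u1 b0 u11 b2 b3 p" "d4 u2 c0 c1 u22 c3 p" "d4 u3 e0 e1 e2 u33 p"
      "d4 \<Phi> \<Phi>t g1 g2 g3 p" "d4 Sz k0 k1 k2 Szz p"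
    and re: "- (utt - u p * (\<Phi> p)\<^sup>2) / c\<^sup>2 + u11 + u22 + u33 - u p * (Sz p)\<^sup>2
        - Gder a ((u p)\<^sup>2) * u p - (m * c / ch)\<^sup>2 * u p = 0"
    and im: "- (2 * ut p * \<Phi> p + u p * \<Phi>t) / c\<^sup>2 + 2 * u3 p * Sz p + u p * Szz = 0"
  shows "KG_eq c m q ch a \<phi> \<psi> p"
proof -
  note du' = du[OF p] and dS' = dS[OF p]
  have 1: "pd (dt_tilde q ch \<phi> \<psi>) e_t p = (complex_of_real (utt - u p * \<Phi> p * St p)
      + \<i> * complex_of_real (u p * \<Phi>t + ut p * \<Phi> p + ut p * St p)) * cis (S p)"
    using pd_cong(2)[OF U p, of "pol ut (\<lambda>p. u p * \<Phi> p) S" "dt_tilde q ch \<phi> \<psi>" e_t]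
      pol_differentiable[OF d2(1) d4_mult[OF du' d2(5)] dS'] pd_pol(1)[OF d2(1) d4_mult[OF du' d2(5)] dS']
    by (simp add: dt_psi)
  have 2: "dt_tilde q ch \<phi> (dt_tilde q ch \<phi> \<psi>) p = (complex_of_real (utt - u p * (\<Phi> p)\<^sup>2)
      + \<i> * complex_of_real (u p * \<Phi>t + 2 * ut p * \<Phi> p)) * cis (S p)"
    unfolding dt_tilde_def[of q ch \<phi> "dt_tilde q ch \<phi> \<psi>"] 1 dt_psi[OF p]
    by (simp add: pol_def Phi[OF p] complex_eq_iff algebra_simps power2_eq_square)
  have x1: "pd (pd \<psi> (e_x 1)) (e_x 1) p = complex_of_real u11 * cis (S p)"
    using pd_cong(2)[OF U p, of "pol u1 (\<lambda>_. 0) S" "pd \<psi> (e_x 1)" "e_x 1"]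
      pol_differentiable[OF d2(2) d4_0 dS'] pd_pol(2)[OF d2(2) d4_0 dS'] by (simp add: pd_psi)
  have x2: "pd (pd \<psi> (e_x 2)) (e_x 2) p = complex_of_real u22 * cis (S p)"
    using pd_cong(2)[OF U p, of "pol u2 (\<lambda>_. 0) S" "pd \<psi> (e_x 2)" "e_x 2"]
      pol_differentiable[OF d2(3) d4_0 dS'] pd_pol(3)[OF d2(3) d4_0 dS'] by (simp add: pd_psi)
  have x3: "pd (pd \<psi> (e_x 3)) (e_x 3) p = (complex_of_real (u33 - u p * Sz p * Sz p)
     + \<i> * complex_of_real (u p * Szz + u3 p * Sz p + u3 p * Sz p)) * cis (S p)"
    using pd_cong(2)[OF U p, of "pol u3 (\<lambda>p. u p * Sz p) S" "pd \<psi> (e_x 3)" "e_x 3"]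
      pol_differentiable[OF d2(4) d4_mult[OF du' d2(6)] dS'] pd_pol(4)[OF d2(4) d4_mult[OF du' d2(6)] dS']
    by (simp add: pd_psi)
  define A B where "A = - (utt - u p * (\<Phi> p)\<^sup>2) / c\<^sup>2 + u11 + u22 + u33 - u p * (Sz p)\<^sup>2
        - Gder a ((u p)\<^sup>2) * u p - (m * c / ch)\<^sup>2 * u p"
    and "B = - (2 * ut p * \<Phi> p + u p * \<Phi>t) / c\<^sup>2 + 2 * u3 p * Sz p + u p * Szz"
  have "- dt_tilde q ch \<phi> (dt_tilde q ch \<phi> \<psi>) p / (complex_of_real c)\<^sup>2 + lap \<psi> p
     - complex_of_real (Gder a ((cmod (\<psi> p))\<^sup>2)) * \<psi> p - complex_of_real ((m * c / ch)\<^sup>2) * \<psi> p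
     = (complex_of_real A + \<i> * complex_of_real B) * cis (S p)"
    unfolding lap_def sum_3 x1 x2 x3 2 psi_cmod A_def B_def unfolding \<psi>_def
    by (simp add: algebra_simps power2_eq_square add_divide_distrib diff_divide_distrib)
  moreover have "A = 0" "B = 0" using re im by (simp_all only: A_def B_def)
  ultimately show ?thesis unfolding KG_eq_def by (simp only: of_real_0 mult_zero_right add_0 mult_zero_left)
qed

end

section \<open>Functions of time and the third coordinate, and their primitives in z\<close>

lemma has_derivative_partials2:
  fixes f :: "real \<Rightarrow> real \<Rightarrow> real"
  assumes o: "open X" "open Y" "convex Y" and xy: "x \<in> X" "y \<in> Y"
    and fx: "((\<lambda>x. f x y) has_real_derivative f1 x y) (at x)"
    and fy: "\<And>x y. x \<in> X \<Longrightarrow> y \<in> Y \<Longrightarrow> ((\<lambda>y. f x y) has_real_derivative f2 x y) (at y)"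
    and cont: "continuous_on (X \<times> Y) (\<lambda>(x, y). f2 x y)"
  shows "((\<lambda>(x, y). f x y) has_derivative (\<lambda>(s, t). f1 x y * s + f2 x y * t)) (at (x, y))"
proof -
  have "((\<lambda>(x, y). f x y) has_derivative (\<lambda>(s, t). f1 x y * s + blinfun_apply (blinfun_mult_right (f2 x y)) t)) (at (x, y) within X \<times> Y)"
  proof (rule has_derivative_partialsI)
    show "((\<lambda>x. f x y) has_derivative (*) (f1 x y)) (at x within X)"
      using fx by (simp add: has_field_derivative_def has_derivative_at_withinI)
    show "((\<lambda>y. f x y) has_derivative blinfun_apply (blinfun_mult_right (f2 x y))) (at y within Y)"
      if "x \<in> X" "y \<in> Y" for x y
      using fy[OF that] by (simp add: has_field_derivative_def has_derivative_at_withinI)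
    have "continuous_on (X \<times> Y) (\<lambda>p. blinfun_mult_right ((\<lambda>(x, y). f2 x y) p))"
      by (rule bounded_linear.continuous_on[OF bounded_linear_blinfun_mult_right cont])
    hence "continuous_on (X \<times> Y) (\<lambda>(x, y). blinfun_mult_right (f2 x y))"
      by (simp add: case_prod_unfold)
    thus "continuous (at (x, y) within X \<times> Y) (\<lambda>(x, y). blinfun_mult_right (f2 x y))"
      using xy by (auto simp: continuous_on_eq_continuous_within)
  qed (use xy o in auto)
  moreover have "at (x, y) within X \<times> Y = at (x, y)"
    using xy o by (intro at_within_open) (auto intro: open_Times)
  ultimately show ?thesis by simp
qed

context rect begin

lemma jet_has_derivative:
  assumes j: "is_jet G" and n: "nm G M" and ty: "t \<in> {t0<..<t1}" "y \<in> {y0<..<y1}"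
  shows "((\<lambda>(t, y). G j l t y) has_derivative (\<lambda>(s, r). G (Suc j) l t y * s + G j (Suc l) t y * r)) (at (t, y))"
proof (rule has_derivative_partials2[of "{t0<..<t1}" "{y0<..<y1}" t y "G j l" "G (Suc j) l" "G j (Suc l)"])
  have w: "at t within {t0..t1} = at t" if "t \<in> {t0<..<t1}" for t
    using that by (intro at_within_Icc_at) auto
  have w': "at y within {y0..y1} = at y" if "y \<in> {y0<..<y1}" for y
    using that by (intro at_within_Icc_at) auto
  show "((\<lambda>t. G j l t y) has_real_derivative G (Suc j) l t y) (at t)"
    using is_jet_t[OF j, of t y j l] w[OF ty(1)] ty by auto
  show "((\<lambda>y. G j l t y) has_real_derivative G j (Suc l) t y) (at y)"
    if "t \<in> {t0<..<t1}" "y \<in> {y0<..<y1}" for t y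
    using is_jet_y[OF j, of t y j l] w'[OF that(2)] that by auto
  show "continuous_on ({t0<..<t1} \<times> {y0<..<y1}) (\<lambda>(t, y). G j (Suc l) t y)"
    by (rule continuous_on_subset[OF jet_continuous[OF j n]]) auto
qed (use ty in auto)

end

definition proj :: "pt \<Rightarrow> pt" where "proj p = (fst p, (snd p $ 3) *\<^sub>R axis 3 1)"

definition pz :: "real \<Rightarrow> real \<Rightarrow> pt" where "pz t z = (t, z *\<^sub>R axis 3 1)"

lemma proj_pz: "proj p = pz (fst p) (snd p $ 3)"
  by (simp add: proj_def pz_def)

lemma bounded_linear_proj: "bounded_linear proj"
  unfolding proj_def[abs_def]
  by (intro bounded_linear_Pair bounded_linear_fst
      bounded_linear_compose[OF bounded_linear_scaleR_left]
      bounded_linear_compose[OF bounded_linear_vec_nth bounded_linear_snd])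

lemma Basis_pt: "w \<in> (Basis :: pt set) \<Longrightarrow> w = e_t \<or> (\<exists>i. w = e_x i)"
  by (auto simp: Basis_prod_def Basis_vec_def e_t_def e_x_def)

text \<open>A basis derivative of \<open>f\<close> after \<open>proj\<close> is therefore either
  zero or the same derivative of \<open>f\<close> at the projected point, which makes
  \<open>ck_proj\<close> an induction.\<close>

lemma proj_Basis: "w \<in> (Basis :: pt set) \<Longrightarrow> proj w = 0 \<or> proj w = w"
proof -
  assume "w \<in> (Basis :: pt set)"
  then consider "w = e_t" | i where "w = e_x i" using Basis_pt by blast
  thus ?thesis
  proof cases
    case 2
    show ?thesis using exhaust_3[of i] by (auto simp: 2 proj_def e_x_def axis_def zero_prod_def)
  qed (simp add: proj_def e_t_def)
qed

lemma ck_proj: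
  assumes "open U" "\<And>p. p \<in> U \<Longrightarrow> proj p \<in> U"
  shows "ck n f U \<Longrightarrow> ck n (\<lambda>p. f (proj p)) U"
proof (induction n arbitrary: f)
  case 0
  show ?case unfolding ck.simps
    by (rule continuous_on_compose2[of U f U proj])
      (use 0 assms in \<open>auto intro: linear_continuous_on[OF bounded_linear_proj]\<close>)
next
  case (Suc n)
  have D: "((\<lambda>p. f (proj p)) has_derivative (\<lambda>w. pd f (proj w) (proj p))) (at p)" if "p \<in> U" for p
    using has_derivative_compose[OF bounded_linear_imp_has_derivative[OF bounded_linear_proj]
        ck_has_derivative[OF Suc.prems assms(2)[OF that]]] .
  have L: "pd f 0 (proj p) = 0" if "p \<in> U" for p
    by (rule linear_0[OF has_derivative_linear[OF ck_has_derivative[OF Suc.prems assms(2)[OF that]]]])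
  show ?case
  proof (rule ck_SucI[OF assms(1) D])
    fix w :: pt assume w: "w \<in> Basis"
    from proj_Basis[OF w] show "ck n (\<lambda>p. pd f (proj w) (proj p)) U"
    proof
      assume "proj w = 0"
      thus ?thesis by (intro ck_cong[OF assms(1) ck_const[OF assms(1), of _ 0]]) (simp add: L)
    next
      assume "proj w = w"
      thus ?thesis using Suc.IH[of "pd f w"] Suc.prems w by simp
    qed
  qed
qed

definition slab :: "real \<Rightarrow> real \<Rightarrow> real \<Rightarrow> real \<Rightarrow> pt set" where
  "slab T1 T2 Z1 Z2 = {p. fst p \<in> {T1<..<T2} \<and> snd p $ 3 \<in> {Z1<..<Z2}}"

lemma open_slab: "open (slab T1 T2 Z1 Z2)"
proof -
  have "slab T1 T2 Z1 Z2 = {p. T1 < fst p} \<inter> {p. fst p < T2} \<inter> {p. Z1 < snd p $ 3} \<inter> {p. snd p $ 3 < Z2}"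
    by (auto simp: slab_def)
  moreover have "continuous_on UNIV (\<lambda>p :: pt. snd p $ 3)" by (intro continuous_intros)
  moreover have "continuous_on UNIV (\<lambda>p :: pt. fst p)" by (intro continuous_intros)
  ultimately show ?thesis by (auto intro!: open_Int open_Collect_less)
qed

lemma pz_simps [simp]: "fst (pz t z) = t" "snd (pz t z) $ 3 = z"
  by (simp_all add: pz_def axis_def)

lemma pz_slab: "pz t z \<in> slab T1 T2 Z1 Z2 \<longleftrightarrow> t \<in> {T1<..<T2} \<and> z \<in> {Z1<..<Z2}"
  by (simp add: slab_def)

lemma proj_slab: "p \<in> slab T1 T2 Z1 Z2 \<Longrightarrow> proj p \<in> slab T1 T2 Z1 Z2"
  by (simp add: proj_pz pz_slab) (simp add: slab_def)

definition zint :: "real \<Rightarrow> (pt \<Rightarrow> real) \<Rightarrow> pt \<Rightarrow> real" where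
  "zint z0 f p = integral {z0..snd p $ 3} (\<lambda>\<zeta>. f (pz (fst p) \<zeta>))"

lemma has_derivative_pz_t: "((\<lambda>t. pz t z) has_derivative (\<lambda>s. s *\<^sub>R e_t)) (at t)"
  unfolding pz_def e_t_def scaleR_Pair by (auto intro!: derivative_eq_intros)

lemma ck_Suc_partial_t:
  fixes f :: "pt \<Rightarrow> real"
  assumes "ck (Suc n) f (slab T1 T2 Z1 Z2)" "t \<in> {T1<..<T2}" "z \<in> {Z1<..<Z2}"
  shows "((\<lambda>t. f (pz t z)) has_real_derivative pd f e_t (pz t z)) (at t)"
proof -
  have D: "(f has_derivative (\<lambda>w. pd f w (pz t z))) (at (pz t z))"
    by (rule ck_has_derivative[OF assms(1)]) (use assms in \<open>simp add: pz_slab\<close>)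
  have "((\<lambda>t. f (pz t z)) has_derivative (\<lambda>s. pd f (s *\<^sub>R e_t) (pz t z))) (at t)"
    by (rule has_derivative_compose[OF has_derivative_pz_t D])
  moreover have "(\<lambda>s. pd f (s *\<^sub>R e_t) (pz t z)) = (*) (pd f e_t (pz t z))"
    using linear_scale[OF has_derivative_linear[OF D]] by (auto simp: mult.commute)
  ultimately show ?thesis by (simp add: has_field_derivative_def)
qed

lemma continuous_on_pz: "continuous_on S (\<lambda>(t, z). pz t z)"
  unfolding pz_def case_prod_unfold by (intro continuous_intros)

lemma slab_cont2:
  assumes "continuous_on (slab T1 T2 Z1 Z2) f" "S \<subseteq> {T1<..<T2} \<times> {Z1<..<Z2}"
  shows "continuous_on S (\<lambda>(t, z). f (pz t z))"
proof -
  have "continuous_on S (\<lambda>p. f ((\<lambda>(t, z). pz t z) p))"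
    by (rule continuous_on_compose2[OF assms(1) continuous_on_pz]) (use assms(2) in \<open>auto simp: pz_slab\<close>)
  thus ?thesis by (simp add: case_prod_unfold)
qed

lemma slab_cont1:
  fixes f :: "pt \<Rightarrow> real"
  assumes "continuous_on (slab T1 T2 Z1 Z2) f" "t \<in> {T1<..<T2}" "Z1 < z0" "z < Z2"
  shows "continuous_on {z0..z} (\<lambda>\<zeta>. f (pz t \<zeta>))"
proof (rule continuous_on_compose2[OF assms(1)])
  show "continuous_on {z0..z} (pz t)" unfolding pz_def by (intro continuous_intros)
qed (use assms in \<open>auto simp: pz_slab\<close>)

text \<open>Leibniz' rule gives the \<open>t\<close>-derivative and the fundamental theorem the
  \<open>z\<close>-derivative. The point must lie above \<open>z0\<close>, because below that level
  the interval of integration is empty and the integral is 0.\<close>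

lemma zint_d4:
  assumes f: "ck (Suc n) f (slab T1 T2 Z1 Z2)" and z0: "Z1 < z0" and p: "p \<in> slab T1 T2 z0 Z2"
  shows "d4 (zint z0 f) (zint z0 (pd f e_t) p) 0 0 (f (proj p)) p"
proof -
  obtain t x where tx: "p = (t, x)" by (metis surj_pair)
  define z where "z = x $ 3"
  have t: "t \<in> {T1<..<T2}" and z: "z \<in> {z0<..<Z2}" using p by (auto simp: slab_def tx z_def)
  have fc: "continuous_on (slab T1 T2 Z1 Z2) f" by (rule ck_continuous[OF f])
  have ftc: "continuous_on (slab T1 T2 Z1 Z2) (pd f e_t)"
    by (rule ck_continuous[of n]) (use f in \<open>simp add: Basis_prod_def e_t_def\<close>)
  have "((\<lambda>(t, z). integral {z0..z} (\<lambda>\<zeta>. f (pz t \<zeta>))) has_derivative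
      (\<lambda>(s, r). integral {z0..z} (\<lambda>\<zeta>. pd f e_t (pz t \<zeta>)) * s + f (pz t z) * r)) (at (t, z))"
  proof (rule has_derivative_partials2[of "{T1<..<T2}" "{z0<..<Z2}" t z "\<lambda>t z. integral {z0..z} (\<lambda>\<zeta>. f (pz t \<zeta>))"
        "\<lambda>t z. integral {z0..z} (\<lambda>\<zeta>. pd f e_t (pz t \<zeta>))" "\<lambda>t z. f (pz t z)"])
    have "((\<lambda>t. integral (cbox z0 z) (\<lambda>\<zeta>. f (pz t \<zeta>))) has_real_derivative
       integral (cbox z0 z) (\<lambda>\<zeta>. pd f e_t (pz t \<zeta>))) (at t within {T1<..<T2})"
    proof (rule leibniz_rule_field_derivative)
      show "((\<lambda>t. f (pz t \<zeta>)) has_real_derivative pd f e_t (pz s \<zeta>)) (at s within {T1<..<T2})"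
        if "s \<in> {T1<..<T2}" "\<zeta> \<in> cbox z0 z" for s \<zeta>
        by (rule has_field_derivative_at_within[OF ck_Suc_partial_t[OF f that(1)]])
          (use that z z0 in \<open>auto simp: cbox_interval\<close>)
      show "(\<lambda>\<zeta>. f (pz s \<zeta>)) integrable_on cbox z0 z" if "s \<in> {T1<..<T2}" for s
        unfolding cbox_interval
        by (rule integrable_continuous_real[OF slab_cont1[OF fc that z0]]) (use z in auto)
      show "continuous_on ({T1<..<T2} \<times> cbox z0 z) (\<lambda>(t, z). pd f e_t (pz t z))"
        by (rule slab_cont2[OF ftc]) (use z z0 in \<open>auto simp: cbox_interval\<close>)
    qed (use t in auto)
    thus "((\<lambda>t. integral {z0..z} (\<lambda>\<zeta>. f (pz t \<zeta>))) has_real_derivative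
       integral {z0..z} (\<lambda>\<zeta>. pd f e_t (pz t \<zeta>))) (at t)"
      using at_within_open[OF t open_greaterThanLessThan] by (simp add: cbox_interval)
    show "((\<lambda>z. integral {z0..z} (\<lambda>\<zeta>. f (pz s \<zeta>))) has_real_derivative f (pz s y)) (at y)"
      if "s \<in> {T1<..<T2}" "y \<in> {z0<..<Z2}" for s y
    proof -
      \<comment> \<open>An endpoint beyond \<open>y\<close> turns the derivative within the interval
        into a two-sided one.\<close>
      define y' where "y' = (y + Z2) / 2"
      have y': "y < y'" "y' < Z2" using that by (auto simp: y'_def)
      have "((\<lambda>z. integral {z0..z} (\<lambda>\<zeta>. f (pz s \<zeta>))) has_real_derivative f (pz s y)) (at y within {z0..y'})"
        by (rule integral_has_real_derivative[OF slab_cont1[OF fc that(1) z0 y'(2)]]) (use that y' in auto)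
      moreover have "at y within {z0..y'} = at y"
        using that y' by (intro at_within_Icc_at) auto
      ultimately show ?thesis by simp
    qed
    show "continuous_on ({T1<..<T2} \<times> {z0<..<Z2}) (\<lambda>(t, z). f (pz t z))"
      by (rule slab_cont2[OF fc]) (use z0 in auto)
  qed (use t z in auto)
  hence "((\<lambda>(t, z). integral {z0..z} (\<lambda>\<zeta>. f (pz t \<zeta>))) has_derivative
      (\<lambda>(s, r). integral {z0..z} (\<lambda>\<zeta>. pd f e_t (pz t \<zeta>)) * s + f (pz t z) * r)) (at (fst p, snd p $ 3))"
    by (simp add: tx z_def)
  from has_derivative_compose[OF has_derivative_Pair[OF has_derivative_fst[OF has_derivative_ident] has_derivative_component] this]
  show ?thesis
    unfolding d4_def zint_def[abs_def] by (simp add: tx z_def proj_pz)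
qed

text \<open>The \<open>t\<close>-derivative of the primitive is the primitive of the
  \<open>t\<close>-derivative. The induction thus replaces \<open>f\<close> by
  \<open>pd f e_t\<close>, which is why \<open>f\<close> is assumed smooth of all orders.\<close>

lemma zint_ck:
  assumes z0: "Z1 < z0"
  shows "(\<And>k. ck k f (slab T1 T2 Z1 Z2)) \<Longrightarrow> ck n (zint z0 f) (slab T1 T2 z0 Z2)"
proof (induction n arbitrary: f)
  case 0
  have "isCont (zint z0 f) p" if "p \<in> slab T1 T2 z0 Z2" for p
    using zint_d4[OF 0[of "Suc 0"] z0 that] unfolding d4_def by (rule has_derivative_continuous)
  thus ?case by (auto intro: continuous_at_imp_continuous_on)
next
  case (Suc n)
  have sub: "slab T1 T2 z0 Z2 \<subseteq> slab T1 T2 Z1 Z2" using z0 by (auto simp: slab_def)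
  have et: "e_t \<in> Basis" by (simp add: Basis_prod_def e_t_def)
  have ft: "ck k (pd f e_t) (slab T1 T2 Z1 Z2)" for k using Suc.prems[of "Suc k"] et by simp
  have I: "ck n (zint z0 (pd f e_t)) (slab T1 T2 z0 Z2)" by (rule Suc.IH[OF ft])
  have J: "ck n (\<lambda>p. f (proj p)) (slab T1 T2 z0 Z2)"
    by (rule ck_subset[OF ck_proj[OF open_slab proj_slab Suc.prems] sub])
  show ?case
    by (rule ck_SucI[OF open_slab zint_d4[OF Suc.prems[of "Suc 0"] z0, unfolded d4_def]], assumption)
      (intro ck_add ck_mult ck_const open_slab I J)
qed

lemma real_entire_primitive:
  assumes "real_entire f"
  obtains G where "\<And>x. (G has_real_derivative f x) (at x)"
proof -
  obtain F where F: "F holomorphic_on UNIV" "\<And>x. F (complex_of_real x) = complex_of_real (f x)"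
    using assms unfolding real_entire_def by blast
  have "\<exists>g. \<forall>x\<in>UNIV. (g has_field_derivative F x) (at x within UNIV)"
    by (rule holomorphic_convex_primitive') (use F in auto)
  then obtain g where g: "\<And>x. (g has_field_derivative F x) (at x)" by auto
  have "((\<lambda>x. Re (g (of_real x))) has_real_derivative f x) (at x)" for x
  proof -
    from has_vector_derivative_real_field[OF g]
    have "((\<lambda>x. g (of_real x)) has_vector_derivative F (of_real x)) (at x)" .
    from bounded_linear.has_vector_derivative[OF bounded_linear_Re this]
    show ?thesis by (simp add: has_real_derivative_iff_has_vector_derivative F(2))
  qed
  thus ?thesis by (rule that)
qed

lemma real_entire_poly: "real_entire (poly P)"
proof (induction P)
  case 0
  show ?case by (simp add: real_entire_const[of 0])
next
  case (pCons a P)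
  have "real_entire (\<lambda>x. a + x * poly P x)"
    by (intro real_entire_add real_entire_mult real_entire_const real_entire_id pCons)
  thus ?case by simp
qed

lemma ck_poly:
  fixes f :: "pt \<Rightarrow> real"
  shows "open U \<Longrightarrow> ck n f U \<Longrightarrow> ck n (\<lambda>p. poly P (f p)) U"
proof (induction P)
  case (pCons a P)
  have "ck n (\<lambda>p. a + f p * poly P (f p)) U"
    by (intro ck_add ck_mult ck_const pCons.IH pCons.prems)
  thus ?case by simp
qed (simp add: ck_const)

section \<open>Light-cone coordinates and the amplitude\<close>

text \<open>The slab \<open>U\<close> is mapped by \<open>tt\<close>, \<open>yy\<close> into the rectangle of the jets; \<open>V\<close> is its part above \<open>z0\<close>,
  the level at which integrals over \<open>z\<close> start.\<close>
locale field = rect t0 t1 y0 y1 for t0 t1 y0 y1 :: real +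
  fixes c m q aa :: real and P :: "real poly" and X H :: "real \<Rightarrow> real" and T1 T2 Z1 Z2 z0 :: real
  assumes c: "c > 0" and m: "m > 0" and q: "q \<noteq> 0" and aa: "aa > 0" and z0: "Z1 < z0"
    and X': "\<And>t z. t \<in> {T1<..<T2} \<Longrightarrow> z \<in> {Z1<..<Z2} \<Longrightarrow>
       (X has_real_derivative exp (- poly P (X (z + c * t)))) (at (z + c * t))"
    and range: "\<And>t z. t \<in> {T1<..<T2} \<Longrightarrow> z \<in> {Z1<..<Z2} \<Longrightarrow>
       X (z + c * t) - (z - c * t) \<in> {t0<..<t1} \<and> X (z + c * t) + (z - c * t) \<in> {y0<..<y1}"
    and H': "\<And>x. (H has_real_derivative sinh (poly P x / 2) * exp (poly P x)) (at x)"
begin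

definition "U = slab T1 T2 Z1 Z2"
definition "V = slab T1 T2 z0 Z2"
definition "\<mu> = 1 / aa\<^sup>2"
definition "\<kappa> = m / (2 * aa ^ 3)"
definition "Xp p = X (snd p $ 3 + c * fst p)" for p :: pt
definition "et p = snd p $ 3 - c * fst p" for p :: pt
definition "yy p = Xp p + et p" for p
definition "tt p = Xp p - et p" for p
definition "A p = poly P (Xp p)" for p
definition "A1 p = poly (pderiv P) (Xp p)" for p
definition "A2 p = poly (pderiv (pderiv P)) (Xp p)" for p
definition "nu p = exp (- A p)" for p

lemma mu: "\<mu> > 0" and kappa: "\<kappa> > 0" using aa m by (simp_all add: \<mu>_def \<kappa>_def)

lemma V_subset: "V \<subseteq> U" using z0 by (auto simp: U_def V_def slab_def)

lemma open_U [simp]: "open U" and open_V [simp]: "open V" by (simp_all add: U_def V_def open_slab)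

lemma d4_Xp: "p \<in> U \<Longrightarrow> d4 Xp (c * nu p) 0 0 (nu p) p"
proof -
  assume p: "p \<in> U"
  have "d4 (\<lambda>p. snd p $ 3 + c * fst p) (0 + c * 1) (0 + c * 0) (0 + c * 0) (1 + c * 0) p"
    by (intro d4_add d4_cmult d4_x3 d4_t)
  from d4_chain[OF X' this] p show ?thesis
    by (simp add: Xp_def[abs_def] nu_def A_def U_def slab_def mult.commute)
qed

lemma d4_et: "d4 et (- c) 0 0 1 p"
proof -
  have "d4 (\<lambda>p. snd p $ 3 - c * fst p) (0 - c * 1) (0 - c * 0) (0 - c * 0) (1 - c * 0) p"
    by (intro d4_diff d4_cmult d4_x3 d4_t)
  thus ?thesis by (simp add: et_def[abs_def])
qed

lemma d4_yy: "p \<in> U \<Longrightarrow> d4 yy (c * (nu p - 1)) 0 0 (nu p + 1) p"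
  using d4_add[OF d4_Xp d4_et] by (simp add: yy_def[abs_def] algebra_simps)

lemma d4_tt: "p \<in> U \<Longrightarrow> d4 tt (c * (nu p + 1)) 0 0 (nu p - 1) p"
  using d4_diff[OF d4_Xp d4_et] by (simp add: tt_def[abs_def] algebra_simps)

lemma d4_A: "p \<in> U \<Longrightarrow> d4 A (A1 p * (c * nu p)) 0 0 (A1 p * nu p) p"
  using d4_chain[OF poly_DERIV d4_Xp] by (simp add: A_def[abs_def] A1_def)

lemma d4_A1: "p \<in> U \<Longrightarrow> d4 A1 (A2 p * (c * nu p)) 0 0 (A2 p * nu p) p"
  using d4_chain[OF poly_DERIV d4_Xp] by (simp add: A1_def[abs_def] A2_def)

lemma d4_exp: "d4 f f0 f1 f2 f3 p \<Longrightarrow> d4 (\<lambda>p. exp (f p)) (exp (f p) * f0) (exp (f p) * f1) (exp (f p) * f2) (exp (f p) * f3) p"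
  by (rule d4_chain[OF DERIV_exp])

lemma d4_nu: "p \<in> U \<Longrightarrow> d4 nu (- (A1 p * c * nu p * nu p)) 0 0 (- (A1 p * nu p * nu p)) p"
  using d4_exp[OF d4_cmult[OF d4_A, of p "-1"]] by (simp add: nu_def[abs_def] mult_ac)

text \<open>\<open>X\<close> is known only through its differential equation. The derivative of
  \<open>Xp\<close> is the exponential of a polynomial in \<open>Xp\<close>, so every order of
  smoothness yields the next.\<close>

lemma ck_Xp: "ck n Xp U"
proof (induction n)
  case 0
  have "isCont Xp p" if "p \<in> U" for p
    using d4_Xp[OF that] unfolding d4_def by (rule has_derivative_continuous)
  thus ?case by (auto intro: continuous_at_imp_continuous_on)
next
  case (Suc n)
  have "ck n (\<lambda>p. exp (- poly P (Xp p))) U" by (intro ck_exp ck_minus ck_poly Suc open_U)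
  hence nu: "ck n nu U" by (simp add: nu_def[abs_def] A_def[abs_def])
  show ?case
    by (rule ck_SucI[OF open_U d4_Xp[unfolded d4_def]], assumption)
      (intro ck_add ck_mult ck_const open_U nu)
qed

lemma ck_A: "ck n A U" and ck_A1: "ck n A1 U"
  unfolding A_def[abs_def] A1_def[abs_def] by (intro ck_poly ck_Xp open_U)+

lemma ck_nu: "ck n nu U"
  unfolding nu_def[abs_def] by (intro ck_exp ck_minus ck_A open_U)

lemma ck_x3: "open W \<Longrightarrow> ck n (\<lambda>p. snd p $ i) W"
  by (intro ck_bounded_linear bounded_linear_compose[OF bounded_linear_vec_nth bounded_linear_snd])

lemma ck_t: "open W \<Longrightarrow> ck n (\<lambda>p. fst p) W"
  by (intro ck_bounded_linear bounded_linear_fst)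

lemma ck_et: "ck n et U"
  unfolding et_def[abs_def] by (intro ck_diff ck_mult ck_const ck_x3 ck_t open_U)

lemma ck_yy: "ck n yy U" and ck_tt: "ck n tt U"
  unfolding yy_def[abs_def] tt_def[abs_def] by (intro ck_add ck_diff ck_Xp ck_et open_U)+

lemma in_rect: "p \<in> U \<Longrightarrow> tt p \<in> {t0<..<t1} \<and> yy p \<in> {y0<..<y1}"
  using range[of "fst p" "snd p $ 3"] by (auto simp: U_def slab_def tt_def yy_def Xp_def et_def)

definition jp :: "jet \<Rightarrow> nat \<Rightarrow> nat \<Rightarrow> pt \<Rightarrow> real" where
  "jp G j l p = G j l (tt p) (yy p)"

lemma d4_jp:
  assumes G: "is_jet G" "nm G M" and p: "p \<in> U"
  shows "d4 (jp G j l) (c * (nu p + 1) * jp G (Suc j) l p + c * (nu p - 1) * jp G j (Suc l) p) 0 0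
     ((nu p - 1) * jp G (Suc j) l p + (nu p + 1) * jp G j (Suc l) p) p"
proof -
  have "((\<lambda>p. (tt p, yy p)) has_derivative (\<lambda>w. (c * (nu p + 1) * fst w + 0 * (snd w $ 1) + 0 * (snd w $ 2) + (nu p - 1) * (snd w $ 3),
      c * (nu p - 1) * fst w + 0 * (snd w $ 1) + 0 * (snd w $ 2) + (nu p + 1) * (snd w $ 3)))) (at p)"
    by (rule has_derivative_Pair[OF d4_tt[OF p, unfolded d4_def] d4_yy[OF p, unfolded d4_def]])
  from has_derivative_compose[OF this jet_has_derivative[OF G in_rect[OF p, THEN conjunct1] in_rect[OF p, THEN conjunct2], of j l]]
  have "((\<lambda>p. G j l (tt p) (yy p)) has_derivative (\<lambda>w. G (Suc j) l (tt p) (yy p) * (c * (nu p + 1) * fst w + (nu p - 1) * (snd w $ 3))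
     + G j (Suc l) (tt p) (yy p) * (c * (nu p - 1) * fst w + (nu p + 1) * (snd w $ 3)))) (at p)"
    by simp
  thus ?thesis unfolding d4_def jp_def[abs_def]
    by (rule has_derivative_eq_rhs) (simp add: fun_eq_iff algebra_simps)
qed

lemma ck_jp: "is_jet G \<Longrightarrow> nm G M \<Longrightarrow> ck n (jp G j l) U"
proof (induction n arbitrary: j l)
  case 0
  have "isCont (jp G j l) p" if "p \<in> U" for p
    using d4_jp[OF 0 that] unfolding d4_def by (rule has_derivative_continuous)
  thus ?case by (auto intro: continuous_at_imp_continuous_on)
next
  case (Suc n)
  show ?case
    by (rule ck_SucI[OF open_U d4_jp[OF Suc.prems, unfolded d4_def]], assumption)
      (intro ck_add ck_mult ck_diff ck_const open_U ck_nu Suc.IH Suc.prems)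
qed

lemma jp_proj: "jp G j l (proj p) = jp G j l p"
  by (simp add: jp_def tt_def yy_def Xp_def et_def proj_pz)

lemma jp_le:
  assumes "nm G r" "p \<in> U"
  shows "\<bar>jp G j l p\<bar> \<le> r * fact (j + l)"
  unfolding jp_def by (rule nm_fact[OF assms(1)]) (use in_rect[OF assms(2)] in auto)

text \<open>Up to a constant and the transverse Gaussian this is
  \<open>u\<^sup>2 exp(A / 2)\<close>, the leading density along one light-cone direction; along the
  other it is \<open>nu\<close> times the same function.\<close>

definition "fr y = \<kappa> * exp (- \<mu> * y\<^sup>2)" for y
text \<open>The nonlinear coefficient minus the wave operator applied to \<open>u\<close> and
  divided by \<open>u\<close>, as computed in \<open>quantum_potential\<close>; the argument
  \<open>(\<tau> + y) / 2\<close> is \<open>X\<close>.\<close>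

definition "Fr \<tau> y = - \<mu> * (ln (pi powr (3/2)) + 1 - \<mu> * y\<^sup>2 - poly P ((\<tau> + y) / 2) / 2)
   - 4 * exp (- poly P ((\<tau> + y) / 2)) * (- \<mu> + \<mu> * y * (\<mu> * y + poly (pderiv P) ((\<tau> + y) / 2) / 4))" for \<tau> y

text \<open>The term \<open>- A p / 4\<close> is chosen so that \<open>u\<^sup>2\<close> times the
  leading light-cone momenta \<open>exp(\<plusminus> A / 2)\<close> becomes a multiple of
  \<open>fr y\<close> and of \<open>nu * fr y\<close>. For this pair the continuity equation holds
  identically.\<close>

definition "lam p = - \<mu> * (yy p)\<^sup>2 / 2 - A p / 4 - \<mu> / 2 * ((snd p $ 1)\<^sup>2 + (snd p $ 2)\<^sup>2)" for p :: pt
definition "lt p = c * (- \<mu> * yy p * (nu p - 1) - A1 p * nu p / 4)" for p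
definition "l3 p = - \<mu> * yy p * (nu p + 1) - A1 p * nu p / 4" for p
definition "u p = sqrt (1 / aa ^ 3) * exp (lam p)" for p

lemma fr_pos: "fr y > 0" using kappa by (simp add: fr_def)

lemma u_pos: "u p > 0" using aa by (simp add: u_def)

lemma u_square: "(u p)\<^sup>2 = exp (2 * lam p) / aa ^ 3"
  using aa by (simp add: u_def power_mult_distrib exp_double)

lemma ln_u: "ln (aa ^ 3 * (u p)\<^sup>2) = 2 * lam p"
  using aa by (simp add: u_square)

lemma Gder_u: "Gder aa ((u p)\<^sup>2) = - \<mu> * (ln (pi powr (3/2)) + 2 * lam p + 3)"
proof -
  have "ln (pi powr (3/2) * aa ^ 3 * (u p)\<^sup>2) = ln (pi powr (3/2)) + 2 * lam p"
    using ln_u[of p] aa u_pos[of p] by (simp add: ln_mult_pos mult.assoc)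
  thus ?thesis by (simp add: Gder_def \<mu>_def add_divide_distrib diff_divide_distrib)
qed

lemma Gfun_u: "Gfun aa ((u p)\<^sup>2) = - \<mu> * (u p)\<^sup>2 * (2 * lam p + ln (pi powr (3/2)) + 2)"
  by (simp add: Gfun_def ln_u \<mu>_def)

lemma d4_lam: "p \<in> U \<Longrightarrow> d4 lam (lt p) (- \<mu> * snd p $ 1) (- \<mu> * snd p $ 2) (l3 p) p"
proof -
  assume p: "p \<in> U"
  have "d4 (\<lambda>p. (- \<mu> / 2) * (yy p * yy p) + (- 1 / 4) * A p + (- \<mu> / 2) * (snd p $ 1 * snd p $ 1 + snd p $ 2 * snd p $ 2))
     (lt p) (- \<mu> * snd p $ 1) (- \<mu> * snd p $ 2) (l3 p) p"
    by (rule d4_cong[OF d4_add[OF d4_add[OF d4_cmult[OF d4_mult[OF d4_yy[OF p] d4_yy[OF p]], of "- \<mu> / 2"] d4_cmult[OF d4_A[OF p], of "- 1 / 4"]]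
        d4_cmult[OF d4_add[OF d4_mult[OF d4_x1 d4_x1] d4_mult[OF d4_x2 d4_x2]], of "- \<mu> / 2"]] open_UNIV UNIV_I])
      (simp_all add: lt_def l3_def algebra_simps)
  thus ?thesis by (rule d4_cong[OF _ open_UNIV UNIV_I]) (simp_all add: lam_def power2_eq_square algebra_simps)
qed

lemma d4_u: "p \<in> U \<Longrightarrow> d4 u (u p * lt p) (u p * (- \<mu> * snd p $ 1)) (u p * (- \<mu> * snd p $ 2)) (u p * l3 p) p"
  using d4_cmult[OF d4_exp[OF d4_lam], of p "sqrt (1 / aa ^ 3)"] by (simp add: u_def[abs_def] mult_ac)

definition "ltt p = c\<^sup>2 * (- \<mu> * (nu p - 1)\<^sup>2 + \<mu> * yy p * A1 p * (nu p)\<^sup>2 - (A2 p * (nu p)\<^sup>2 - (A1 p)\<^sup>2 * (nu p)\<^sup>2) / 4)" for p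
definition "l33 p = - \<mu> * (nu p + 1)\<^sup>2 + \<mu> * yy p * A1 p * (nu p)\<^sup>2 - (A2 p * (nu p)\<^sup>2 - (A1 p)\<^sup>2 * (nu p)\<^sup>2) / 4" for p

lemma d4_lt: "p \<in> U \<Longrightarrow> \<exists>a1 a2 a3. d4 lt (ltt p) a1 a2 a3 p"
proof -
  assume p: "p \<in> U"
  show ?thesis
    by (intro exI, rule d4_cong[OF d4_cmult[OF d4_diff[OF
        d4_cmult[OF d4_mult[OF d4_yy[OF p] d4_diff[OF d4_nu[OF p] d4_const[of 1]]], of "- \<mu>"]
        d4_cmult[OF d4_mult[OF d4_A1[OF p] d4_nu[OF p]], of "1/4"]], of c] open_UNIV UNIV_I _ _ refl refl refl])
      (simp_all add: lt_def ltt_def field_simps power2_eq_square)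
qed

lemma d4_l3: "p \<in> U \<Longrightarrow> \<exists>a0 a1 a2. d4 l3 a0 a1 a2 (l33 p) p"
proof -
  assume p: "p \<in> U"
  show ?thesis
    by (intro exI, rule d4_cong[OF d4_diff[OF
        d4_cmult[OF d4_mult[OF d4_yy[OF p] d4_add[OF d4_nu[OF p] d4_const[of 1]]], of "- \<mu>"]
        d4_cmult[OF d4_mult[OF d4_A1[OF p] d4_nu[OF p]], of "1/4"]] open_UNIV UNIV_I _ refl refl refl])
      (simp_all add: l3_def l33_def field_simps power2_eq_square)
qed

text \<open>The transverse second derivatives produce \<open>\<mu>\<^sup>2\<close> times the squared
  distance from the axis, and the logarithm of the Gaussian produces the same term, so they cancel.
  The second derivatives of \<open>A\<close> cancel between \<open>t\<close> and \<open>z\<close>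
  because \<open>A\<close> depends on \<open>z + c t\<close> only.\<close>

lemma quantum_potential:
  "- ((lt p)\<^sup>2 + ltt p) / c\<^sup>2 + (\<mu>\<^sup>2 * (snd p $ 1)\<^sup>2 - \<mu>) + (\<mu>\<^sup>2 * (snd p $ 2)\<^sup>2 - \<mu>)
     + ((l3 p)\<^sup>2 + l33 p) + Fr (tt p) (yy p) - Gder aa ((u p)\<^sup>2) = 0"
proof -
  have X: "(tt p + yy p) / 2 = Xp p" by (simp add: tt_def yy_def)
  have t: "((lt p)\<^sup>2 + ltt p) / c\<^sup>2 = (- \<mu> * yy p * (nu p - 1) - A1 p * nu p / 4)\<^sup>2
     + (- \<mu> * (nu p - 1)\<^sup>2 + \<mu> * yy p * A1 p * (nu p)\<^sup>2 - (A2 p * (nu p)\<^sup>2 - (A1 p)\<^sup>2 * (nu p)\<^sup>2) / 4)"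
    using c unfolding lt_def ltt_def power_mult_distrib by (simp flip: distrib_left)
  have F: "Fr (tt p) (yy p) = - \<mu> * (ln (pi powr (3/2)) + 1 - \<mu> * (yy p)\<^sup>2 - A p / 2)
     - 4 * nu p * (- \<mu> + \<mu> * yy p * (\<mu> * yy p + A1 p / 4))"
    unfolding Fr_def X by (simp add: A_def A1_def nu_def)
  show ?thesis unfolding minus_divide_left[symmetric] t F Gder_u l3_def l33_def lam_def
    by (simp add: power2_eq_square algebra_simps)
qed

end

section \<open>The phase and the potential\<close>

text \<open>Up to constants and the transverse Gaussian, \<open>n1\<close> and \<open>n2\<close> below are the products of \<open>u\<^sup>2\<close> with the
  light-cone components of the momentum; \<open>rel1\<close> is the continuity equation, \<open>rel2\<close> the mass shell
  relation, and \<open>Om\<close>, \<open>Ph\<close> are the resulting small corrections of momentum and energy.\<close>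
locale sol = field t0 t1 y0 y1 c m q aa P X H T1 T2 Z1 Z2 z0
  for t0 t1 y0 y1 c m q aa P X H T1 T2 Z1 Z2 z0 +
  fixes ch r R1 :: real and kj pp Om Ph :: jet
  assumes ch: "ch > 0"
    and jets: "is_jet kj" "nm kj R1" "is_jet pp" "nm pp R1" "is_jet Om" "nm Om r" "is_jet Ph" "nm Ph r"
    and rel1: "\<And>\<tau> y. \<tau> \<in> {t0..t1} \<Longrightarrow> y \<in> {y0..y1} \<Longrightarrow> pp 0 1 \<tau> y = kj 1 0 \<tau> y"
    and rel2: "\<And>\<tau> y. \<tau> \<in> {t0..t1} \<Longrightarrow> y \<in> {y0..y1} \<Longrightarrow>
       (fr y + kj 0 0 \<tau> y)\<^sup>2 - (pp 0 0 \<tau> y)\<^sup>2 = (fr y)\<^sup>2 * (1 + ch\<^sup>2 * Fr \<tau> y / (m * c)\<^sup>2)"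
    and relOm: "\<And>\<tau> y. \<tau> \<in> {t0..t1} \<Longrightarrow> y \<in> {y0..y1} \<Longrightarrow>
       Om 0 0 \<tau> y = - (m * c / 2) * (exp (poly P ((\<tau> + y) / 2) / 2) * (kj 0 0 \<tau> y - pp 0 0 \<tau> y)
          - exp (- poly P ((\<tau> + y) / 2) / 2) * (kj 0 0 \<tau> y + pp 0 0 \<tau> y)) / fr y"
    and relPh: "\<And>\<tau> y. \<tau> \<in> {t0..t1} \<Longrightarrow> y \<in> {y0..y1} \<Longrightarrow>
       Ph 0 0 \<tau> y = (m * c\<^sup>2 / 2) * (exp (poly P ((\<tau> + y) / 2) / 2) * (kj 0 0 \<tau> y - pp 0 0 \<tau> y)
          + exp (- poly P ((\<tau> + y) / 2) / 2) * (kj 0 0 \<tau> y + pp 0 0 \<tau> y)) / fr y"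
begin

definition "fp p = fr (yy p)" for p
text \<open>Up to a constant and the transverse Gaussian this is \<open>1 / u\<^sup>2\<close>; it
  turns the densities \<open>n1\<close>, \<open>n2\<close> back into momenta.\<close>

definition "g p = exp (A p / 2 + \<mu> * (yy p)\<^sup>2) / \<kappa>" for p
definition "n1 p = fp p + (jp kj 0 0 p - jp pp 0 0 p)" for p
definition "n2 p = nu p * (fp p + (jp kj 0 0 p + jp pp 0 0 p))" for p
definition "sz p = - (m * c / 2) * (g p * (n1 p - n2 p))" for p
definition "Phi p = (m * c\<^sup>2 / 2) * (g p * (n1 p + n2 p))" for p
definition "om = jp Om 0 0"
definition "omt p = c * (nu p + 1) * jp Om 1 0 p + c * (nu p - 1) * jp Om 0 1 p" for p
text \<open>The first term has \<open>z\<close>-derivative \<open>- m c sinh(A / 2)\<close> by the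
  choice of \<open>H\<close>; the second adds the correction \<open>om\<close>, so that the
  \<open>z\<close>-derivative of the phase is exactly \<open>sz\<close>.\<close>

definition "s p = - m * c * H (Xp p) + zint z0 om p" for p
definition "st p = - m * c\<^sup>2 * sinh (A p / 2) + zint z0 omt p" for p
text \<open>Obtained by solving \<open>Phi = st + q * \<phi>\<close>: once phase and energy are
  fixed, the potential absorbs the time derivative of the phase. \<open>cosh\<close> and
  \<open>sinh\<close> of \<open>A / 2\<close> add up to the exponential.\<close>

definition "\<phi> p = (m * c\<^sup>2 * exp (A p / 2) + jp Ph 0 0 p - zint z0 omt p) / q" for p

lemma g_fp: "g p * fp p = exp (A p / 2)" "g p * (nu p * fp p) = exp (- A p / 2)" "g p = exp (A p / 2) / fp p"
    "g p * nu p = exp (- A p / 2) / fp p"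
proof -
  have e: "exp (\<mu> * (yy p)\<^sup>2) * exp (- \<mu> * (yy p)\<^sup>2) = 1" by (simp flip: exp_add)
  have n: "exp (A p / 2) * nu p = exp (- A p / 2)" by (simp add: nu_def flip: exp_add)
  show 1: "g p * fp p = exp (A p / 2)" using kappa e by (simp add: g_def fp_def fr_def exp_add)
  show 2: "g p * (nu p * fp p) = exp (- A p / 2)" using 1 n by (metis mult.assoc mult.commute)
  show "g p = exp (A p / 2) / fp p" using 1 fr_pos[of "yy p"] by (simp add: eq_divide_eq fp_def)
  show "g p * nu p = exp (- A p / 2) / fp p" using 2 fr_pos[of "yy p"] by (simp add: eq_divide_eq fp_def mult.assoc)
qed

lemma rect_mem: "p \<in> U \<Longrightarrow> tt p \<in> {t0..t1}" "p \<in> U \<Longrightarrow> yy p \<in> {y0..y1}"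
  using in_rect[of p] by auto

lemma tt_yy: "(tt p + yy p) / 2 = Xp p" by (simp add: tt_def yy_def)

lemma sz_eq: "p \<in> U \<Longrightarrow> sz p = - m * c * sinh (A p / 2) + om p"
proof -
  assume p: "p \<in> U"
  have "g p * (n1 p - n2 p) = (g p * fp p - g p * (nu p * fp p)) + (g p * (jp kj 0 0 p - jp pp 0 0 p)
     - g p * nu p * (jp kj 0 0 p + jp pp 0 0 p))"
    by (simp add: n1_def n2_def algebra_simps)
  also have "\<dots> = 2 * sinh (A p / 2) + (exp (A p / 2) * (jp kj 0 0 p - jp pp 0 0 p)
     - exp (- A p / 2) * (jp kj 0 0 p + jp pp 0 0 p)) / fp p"
    unfolding g_fp(1,2,4) unfolding g_fp(3) by (simp add: sinh_def diff_divide_distrib)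
  finally show ?thesis
    unfolding sz_def om_def jp_def relOm[OF rect_mem[OF p]] tt_yy
    by (simp add: A_def fp_def algebra_simps)
qed

lemma Phi_eq: "p \<in> U \<Longrightarrow> Phi p = m * c\<^sup>2 * cosh (A p / 2) + jp Ph 0 0 p"
proof -
  assume p: "p \<in> U"
  have "g p * (n1 p + n2 p) = (g p * fp p + g p * (nu p * fp p)) + (g p * (jp kj 0 0 p - jp pp 0 0 p)
     + g p * nu p * (jp kj 0 0 p + jp pp 0 0 p))"
    by (simp add: n1_def n2_def algebra_simps)
  also have "\<dots> = 2 * cosh (A p / 2) + (exp (A p / 2) * (jp kj 0 0 p - jp pp 0 0 p)
     + exp (- A p / 2) * (jp kj 0 0 p + jp pp 0 0 p)) / fp p"
    unfolding g_fp(1,2,4) unfolding g_fp(3) by (simp add: cosh_def add_divide_distrib)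
  finally show ?thesis
    unfolding Phi_def jp_def relPh[OF rect_mem[OF p]] tt_yy
    by (simp add: A_def fp_def algebra_simps)
qed

lemma Phi_s_phi: "p \<in> U \<Longrightarrow> Phi p = st p + q * \<phi> p"
  using q by (simp add: Phi_eq st_def \<phi>_def sinh_def cosh_def field_simps)

text \<open>\<open>Phi / c + sz\<close> and \<open>Phi / c - sz\<close> are \<open>m c g\<close>
  times \<open>n2\<close> and \<open>n1\<close>. The left side is therefore a multiple of
  \<open>n1 * n2\<close>, which \<open>rel2\<close> evaluates.\<close>

lemma mass_shell: "p \<in> U \<Longrightarrow> (Phi p)\<^sup>2 / c\<^sup>2 - (sz p)\<^sup>2 = (m * c)\<^sup>2 + ch\<^sup>2 * Fr (tt p) (yy p)"
proof -
  assume p: "p \<in> U"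
  define G K L where "G = g p" and "K = n1 p" and "L = n2 p"
  have "(m * c\<^sup>2 / 2 * (G * (K + L)))\<^sup>2 / c\<^sup>2 - (- (m * c / 2) * (G * (K - L)))\<^sup>2 = (m * c)\<^sup>2 * (G\<^sup>2 * (K * L))"
    using c by (simp add: field_simps power2_eq_square)
  hence "(Phi p)\<^sup>2 / c\<^sup>2 - (sz p)\<^sup>2 = (m * c)\<^sup>2 * (G\<^sup>2 * (K * L))"
    by (simp add: Phi_def sz_def G_def K_def L_def)
  also have "K * L = nu p * ((fr (yy p) + jp kj 0 0 p)\<^sup>2 - (jp pp 0 0 p)\<^sup>2)"
    by (simp add: K_def L_def n1_def n2_def fp_def algebra_simps power2_eq_square)
  also have "\<dots> = nu p * ((fp p)\<^sup>2 * (1 + ch\<^sup>2 * Fr (tt p) (yy p) / (m * c)\<^sup>2))"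
    unfolding jp_def rel2[OF rect_mem[OF p]] by (simp add: fp_def)
  also have "G\<^sup>2 * \<dots> = (g p * fp p) * (g p * (nu p * fp p)) * (1 + ch\<^sup>2 * Fr (tt p) (yy p) / (m * c)\<^sup>2)"
    by (simp add: G_def power2_eq_square mult_ac)
  also have "(g p * fp p) * (g p * (nu p * fp p)) = 1"
    unfolding g_fp(1,2) by (simp flip: exp_add)
  finally have "(Phi p)\<^sup>2 / c\<^sup>2 - (sz p)\<^sup>2 = (m * c)\<^sup>2 * (1 * (1 + ch\<^sup>2 * Fr (tt p) (yy p) / (m * c)\<^sup>2))" .
  moreover have "W * (1 * (1 + B / W)) = W + B" if "W \<noteq> 0" for W B :: real
    using that by (simp add: distrib_left)
  ultimately show ?thesis using m c by (metis mult_eq_0_iff order_less_irrefl power_not_zero)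
qed

lemma d4_g: "p \<in> U \<Longrightarrow> d4 g (g p * (c * (A1 p * nu p / 2 + 2 * \<mu> * yy p * (nu p - 1)))) 0 0
    (g p * (A1 p * nu p / 2 + 2 * \<mu> * yy p * (nu p + 1))) p"
proof -
  assume p: "p \<in> U"
  have "d4 (\<lambda>p. 1/2 * A p + \<mu> * (yy p * yy p)) (c * (A1 p * nu p / 2 + 2 * \<mu> * yy p * (nu p - 1))) 0 0
     (A1 p * nu p / 2 + 2 * \<mu> * yy p * (nu p + 1)) p"
    by (rule d4_cong[OF d4_add[OF d4_cmult[OF d4_A[OF p], of "1/2"] d4_cmult[OF d4_mult[OF d4_yy[OF p] d4_yy[OF p]], of \<mu>]] open_UNIV UNIV_I])
      (simp_all add: field_simps)
  from d4_cmult[OF d4_exp[OF this], of "1 / \<kappa>"] show ?thesis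
    by (rule d4_cong[OF _ open_UNIV UNIV_I]) (simp_all add: g_def power2_eq_square)
qed

lemma d4_fp: "p \<in> U \<Longrightarrow> d4 fp (- 2 * \<mu> * yy p * fp p * (c * (nu p - 1))) 0 0 (- 2 * \<mu> * yy p * fp p * (nu p + 1)) p"
proof -
  assume p: "p \<in> U"
  show ?thesis
    by (rule d4_cong[OF d4_cmult[OF d4_exp[OF d4_cmult[OF d4_mult[OF d4_yy[OF p] d4_yy[OF p]], of "- \<mu>"]], of \<kappa>] open_UNIV UNIV_I])
      (simp_all add: fp_def fr_def power2_eq_square algebra_simps)
qed

definition "yf p = - 2 * \<mu> * yy p * fp p" for p
definition "n1y p = yf p + (jp kj 0 1 p - jp pp 0 1 p)" for p
definition "n1t p = jp kj 1 0 p - jp pp 1 0 p" for p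
definition "n2y p = yf p + (jp kj 0 1 p + jp pp 0 1 p)" for p
definition "n2t p = jp kj 1 0 p + jp pp 1 0 p" for p

lemma d4_n1: "p \<in> U \<Longrightarrow> d4 n1 (c * (nu p + 1) * n1t p + c * (nu p - 1) * n1y p) 0 0
    ((nu p - 1) * n1t p + (nu p + 1) * n1y p) p"
proof -
  assume p: "p \<in> U"
  show ?thesis
    by (rule d4_cong[OF d4_add[OF d4_fp[OF p] d4_diff[OF d4_jp[OF jets(1,2) p, of 0 0] d4_jp[OF jets(3,4) p, of 0 0]]] open_UNIV UNIV_I])
      (simp_all add: n1_def n1t_def n1y_def yf_def algebra_simps)
qed

lemma d4_n2: "p \<in> U \<Longrightarrow> d4 n2 (c * (- A1 p * nu p * n2 p + nu p * ((nu p + 1) * n2t p + (nu p - 1) * n2y p))) 0 0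
    (- A1 p * nu p * n2 p + nu p * ((nu p - 1) * n2t p + (nu p + 1) * n2y p)) p"
proof -
  assume p: "p \<in> U"
  show ?thesis
    by (rule d4_cong[OF d4_mult[OF d4_nu[OF p] d4_add[OF d4_fp[OF p] d4_add[OF d4_jp[OF jets(1,2) p, of 0 0] d4_jp[OF jets(3,4) p, of 0 0]]]] open_UNIV UNIV_I])
      (simp_all add: n2_def n2t_def n2y_def yf_def algebra_simps)
qed

definition "szz p = - (m * c / 2) * (g p * ((nu p - 1) * n1t p + (nu p + 1) * n1y p
      - (- A1 p * nu p * n2 p + nu p * ((nu p - 1) * n2t p + (nu p + 1) * n2y p)))
    + g p * (A1 p * nu p / 2 + 2 * \<mu> * yy p * (nu p + 1)) * (n1 p - n2 p))" for p
definition "Phit p = (m * c\<^sup>2 / 2) * (g p * (c * (nu p + 1) * n1t p + c * (nu p - 1) * n1y p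
      + c * (- A1 p * nu p * n2 p + nu p * ((nu p + 1) * n2t p + (nu p - 1) * n2y p)))
    + g p * (c * (A1 p * nu p / 2 + 2 * \<mu> * yy p * (nu p - 1))) * (n1 p + n2 p))" for p

lemma d4_sz: "p \<in> U \<Longrightarrow> \<exists>a. d4 sz a 0 0 (szz p) p"
proof -
  assume p: "p \<in> U"
  show ?thesis
    by (rule exI, rule d4_cong[OF d4_cmult[OF d4_mult[OF d4_g[OF p] d4_diff[OF d4_n1[OF p] d4_n2[OF p]]], of "- (m * c / 2)"] open_UNIV UNIV_I _ refl])
      (simp_all add: sz_def szz_def)
qed

lemma d4_Phi: "p \<in> U \<Longrightarrow> \<exists>a. d4 Phi (Phit p) 0 0 a p"
proof -
  assume p: "p \<in> U"
  show ?thesis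
    by (rule exI, rule d4_cong[OF d4_cmult[OF d4_mult[OF d4_g[OF p] d4_add[OF d4_n1[OF p] d4_n2[OF p]]], of "m * c\<^sup>2 / 2"] open_UNIV UNIV_I _ _ _ _ refl])
      (simp_all add: Phi_def Phit_def)
qed

text \<open>The logarithmic derivatives of \<open>u\<^sup>2\<close> and \<open>g\<close> cancel, as
  their product depends on the transverse variables only. What remains is the divergence of the
  current with components \<open>n1\<close>, \<open>n2\<close>, a multiple of the derivative of
  \<open>kj\<close> in \<open>\<tau>\<close> minus that of \<open>pp\<close> in
  \<open>y\<close>.\<close>

lemma continuity_equation:
  assumes p: "p \<in> U"
  shows "- (2 * lt p * Phi p + Phit p) / c\<^sup>2 + 2 * l3 p * sz p + szz p = 0"
proof -
  have R: "jp pp 0 1 p = jp kj 1 0 p" unfolding jp_def by (rule rel1[OF rect_mem[OF p]])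
  have 1: "2 * lt p * Phi p + Phit p = c\<^sup>2 * (m * c / 2) * g p * ((nu p + 1) * n1t p + (nu p - 1) * n1y p
      + (- A1 p * nu p * n2 p + nu p * ((nu p + 1) * n2t p + (nu p - 1) * n2y p)))"
    unfolding lt_def Phi_def Phit_def by (simp add: algebra_simps power2_eq_square)
  have 2: "2 * l3 p * sz p + szz p = - (m * c / 2) * g p * ((nu p - 1) * n1t p + (nu p + 1) * n1y p
      - (- A1 p * nu p * n2 p + nu p * ((nu p - 1) * n2t p + (nu p + 1) * n2y p)))"
    unfolding l3_def sz_def szz_def by (simp add: field_simps power2_eq_square)
  have 3: "(2 * lt p * Phi p + Phit p) / c\<^sup>2 = (m * c / 2) * g p * ((nu p + 1) * n1t p + (nu p - 1) * n1y p
      + (- A1 p * nu p * n2 p + nu p * ((nu p + 1) * n2t p + (nu p - 1) * n2y p)))"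
    unfolding 1 using c by simp
  have "- (2 * lt p * Phi p + Phit p) / c\<^sup>2 + 2 * l3 p * sz p + szz p
     = - ((2 * lt p * Phi p + Phit p) / c\<^sup>2) + (2 * l3 p * sz p + szz p)"
    by (simp only: minus_divide_left add.assoc)
  also have "\<dots> = - (m * c / 2) * g p * (2 * nu p * (n1t p + n1y p + n2t p - n2y p))"
    unfolding 2 3 by (simp add: algebra_simps)
  also have "n1t p + n1y p + n2t p - n2y p = 0"
    using R by (simp add: n1t_def n1y_def n2t_def n2y_def)
  finally show ?thesis by simp
qed

lemma ck_om: "ck n om U" unfolding om_def by (rule ck_jp[OF jets(5,6)])

lemma ck_omt: "ck n omt U"
  unfolding omt_def[abs_def] by (intro ck_add ck_mult ck_diff ck_const ck_nu ck_jp[OF jets(5,6)] open_U)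

lemma pd_om: "p \<in> U \<Longrightarrow> pd om e_t p = omt p"
  using d4_pd(1)[OF d4_jp[OF jets(5,6), of p 0 0]] by (simp add: om_def omt_def)

definition "nut p = - (A1 p * c * nu p * nu p)" for p
text \<open>The potential contains \<open>zint z0 omt\<close>; controlling its time derivative takes
  this second time derivative of the momentum correction.\<close>

definition "omtt p = c * nut p * (jp Om 1 0 p + jp Om 0 1 p)
   + c * (nu p + 1) * (c * (nu p + 1) * jp Om 2 0 p + c * (nu p - 1) * jp Om 1 1 p)
   + c * (nu p - 1) * (c * (nu p + 1) * jp Om 1 1 p + c * (nu p - 1) * jp Om 0 2 p)" for p

lemma d4_omt: "p \<in> U \<Longrightarrow> \<exists>a. d4 omt (omtt p) 0 0 a p"
proof -
  assume p: "p \<in> U"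
  note J = d4_jp[OF jets(5,6) p]
  have "d4 omt (c * (nu p + 1) * (c * (nu p + 1) * jp Om (Suc 1) 0 p + c * (nu p - 1) * jp Om 1 (Suc 0) p)
     + c * nut p * jp Om 1 0 p + (c * (nu p - 1) * (c * (nu p + 1) * jp Om (Suc 0) 1 p + c * (nu p - 1) * jp Om 0 (Suc 1) p)
     + c * nut p * jp Om 0 1 p)) 0 0 
     (c * (nu p + 1) * ((nu p - 1) * jp Om (Suc 1) 0 p + (nu p + 1) * jp Om 1 (Suc 0) p)
     + c * (- (A1 p * nu p * nu p)) * jp Om 1 0 p + (c * (nu p - 1) * ((nu p - 1) * jp Om (Suc 0) 1 p + (nu p + 1) * jp Om 0 (Suc 1) p)
     + c * (- (A1 p * nu p * nu p)) * jp Om 0 1 p)) p"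
    by (rule d4_cong[OF d4_add[OF d4_mult[OF d4_cmult[OF d4_add[OF d4_nu[OF p] d4_const[of 1]], of c] J[of 1 0]]
       d4_mult[OF d4_cmult[OF d4_diff[OF d4_nu[OF p] d4_const[of 1]], of c] J[of 0 1]]] open_UNIV UNIV_I])
      (simp_all add: omt_def nut_def)
  moreover have "c * (nu p + 1) * (c * (nu p + 1) * jp Om (Suc 1) 0 p + c * (nu p - 1) * jp Om 1 (Suc 0) p)
     + c * nut p * jp Om 1 0 p + (c * (nu p - 1) * (c * (nu p + 1) * jp Om (Suc 0) 1 p + c * (nu p - 1) * jp Om 0 (Suc 1) p)
     + c * nut p * jp Om 0 1 p) = omtt p"
    unfolding omtt_def by (simp add: numeral_2_eq_2 algebra_simps)
  ultimately show ?thesis by metis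
qed

lemma om_proj: "om (proj p) = om p" by (simp add: om_def jp_proj)

lemma Xp_proj: "Xp (proj p) = Xp p" by (simp add: Xp_def proj_pz)

lemma omt_proj: "omt (proj p) = omt p" by (simp add: omt_def jp_proj nu_def A_def Xp_proj)

lemma zint_cong: "p \<in> V \<Longrightarrow> (\<And>p. p \<in> U \<Longrightarrow> f p = h p) \<Longrightarrow> zint z0 f p = zint z0 h p"
  unfolding zint_def by (intro integral_cong) (use z0 in \<open>auto simp: U_def V_def slab_def\<close>)

lemma zint_d4': 
  assumes f: "\<And>k. ck k f U" and p: "p \<in> V" and D: "\<And>p. p \<in> U \<Longrightarrow> pd f e_t p = h p" and pr: "f (proj p) = f p"
  shows "d4 (zint z0 f) (zint z0 h p) 0 0 (f p) p"
  using zint_d4[OF f[unfolded U_def, of "Suc 0"] z0 p[unfolded V_def]] zint_cong[OF p D] pr by simp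

lemma zint_bound:
  assumes p: "p \<in> V" and f: "\<And>p. p \<in> U \<Longrightarrow> \<bar>f p\<bar> \<le> B" and k: "ck n f U"
  shows "\<bar>zint z0 f p\<bar> \<le> B * (Z2 - z0)"
proof -
  have z: "z0 \<le> snd p $ 3" "snd p $ 3 < Z2" "fst p \<in> {T1<..<T2}" using p by (auto simp: V_def slab_def)
  have pz: "pz (fst p) \<zeta> \<in> U" if "\<zeta> \<in> {z0..snd p $ 3}" for \<zeta>
    using that z z0 by (auto simp: U_def pz_slab)
  have B: "B \<ge> 0" using f[OF pz[of z0]] z by auto
  have "norm (integral (cbox z0 (snd p $ 3)) (\<lambda>\<zeta>. f (pz (fst p) \<zeta>))) \<le> B * measure lborel (cbox z0 (snd p $ 3))"
  proof (rule integrable_bound[OF B])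
    show "(\<lambda>\<zeta>. f (pz (fst p) \<zeta>)) integrable_on cbox z0 (snd p $ 3)"
      unfolding cbox_interval
      by (rule integrable_continuous_real[OF slab_cont1[OF ck_continuous[OF k[unfolded U_def]] z(3) z0 z(2)]])
  qed (use f pz in \<open>auto simp: cbox_interval\<close>)
  also have "\<dots> \<le> B * (Z2 - z0)" using z B by (simp add: cbox_interval mult_left_mono)
  finally show ?thesis by (simp add: zint_def cbox_interval)
qed

lemma d4_zint_om: "p \<in> V \<Longrightarrow> d4 (zint z0 om) (zint z0 omt p) 0 0 (om p) p"
  by (rule zint_d4'[OF ck_om]) (simp_all add: pd_om om_proj)

lemma d4_zint_omt: "p \<in> V \<Longrightarrow> d4 (zint z0 omt) (zint z0 omtt p) 0 0 (omt p) p"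
proof (rule zint_d4'[OF ck_omt])
  fix p assume "p \<in> U"
  from d4_omt[OF this] show "pd omt e_t p = omtt p" using d4_pd(1) by blast
qed (simp_all add: omt_proj)

lemma ck_zint: "(\<And>k. ck k f U) \<Longrightarrow> ck n (zint z0 f) V"
  unfolding U_def V_def by (rule zint_ck[OF z0])

lemma d4_s: "p \<in> V \<Longrightarrow> d4 s (st p) 0 0 (sz p) p"
proof -
  assume p: "p \<in> V"
  hence pU: "p \<in> U" using V_subset by auto
  have e: "exp (A p) * nu p = 1" by (simp add: nu_def flip: exp_add)
  have "d4 (\<lambda>p. H (Xp p)) (sinh (A p / 2) * exp (A p) * (c * nu p)) (sinh (A p / 2) * exp (A p) * 0) (sinh (A p / 2) * exp (A p) * 0)
     (sinh (A p / 2) * exp (A p) * nu p) p"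
    using d4_chain[OF H' d4_Xp[OF pU]] by (simp add: A_def)
  also have "sinh (A p / 2) * exp (A p) * (c * nu p) = c * sinh (A p / 2) * (exp (A p) * nu p)" by simp
  also have "sinh (A p / 2) * exp (A p) * nu p = sinh (A p / 2) * (exp (A p) * nu p)" by simp
  finally have "d4 (\<lambda>p. H (Xp p)) (c * sinh (A p / 2)) 0 0 (sinh (A p / 2)) p" unfolding e by simp
  from d4_add[OF d4_cmult[OF this, of "- m * c"] d4_zint_om[OF p]]
  show ?thesis
    by (rule d4_cong[OF _ open_UNIV UNIV_I]) (simp_all add: s_def st_def sz_eq[OF pU] power2_eq_square)
qed

lemma ck_V: "ck n f U \<Longrightarrow> ck n f V" by (rule ck_subset[OF _ V_subset])

lemma ck_sinh: "ck n (\<lambda>p. sinh (A p / 2)) U"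
proof -
  have "ck n (\<lambda>p. 1/2 * (exp (1/2 * A p) - exp (- 1/2 * A p))) U"
    by (intro ck_cmult ck_diff ck_exp ck_A open_U)
  thus ?thesis by (simp add: sinh_def scaleR_conv_of_real)
qed

lemma ck_sz: "ck n sz V"
proof -
  have "ck n (\<lambda>p. - m * c * sinh (A p / 2) + om p) V"
    by (intro ck_V ck_add ck_cmult ck_sinh ck_om open_U)
  thus ?thesis by (rule ck_cong[OF open_V]) (use sz_eq V_subset in auto)
qed

lemma ck_st: "ck n st V"
  unfolding st_def[abs_def]
  by (intro ck_add ck_cmult ck_V[OF ck_sinh] ck_zint ck_omt open_V)

lemma ck_s: "ck n s V"
proof (cases n)
  case 0
  have "isCont s p" if "p \<in> V" for p
    using d4_s[OF that] unfolding d4_def by (rule has_derivative_continuous)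
  thus ?thesis unfolding 0 by (auto intro: continuous_at_imp_continuous_on)
next
  case (Suc k)
  show ?thesis unfolding Suc
    by (rule ck_SucI[OF open_V d4_s[unfolded d4_def]], assumption)
      (intro ck_add ck_mult ck_const open_V ck_st ck_sz)
qed

lemma ck_phi: "ck n \<phi> V"
proof -
  have "ck n (\<lambda>p. (1 / q) * (m * c\<^sup>2 * exp (1/2 * A p) + jp Ph 0 0 p - zint z0 omt p)) V"
    by (intro ck_cmult ck_add ck_diff ck_exp ck_V[OF ck_A] ck_V[OF ck_jp[OF jets(7,8)]] ck_zint ck_omt open_V)
  thus ?thesis by (simp add: \<phi>_def[abs_def])
qed

lemma ck_lam: "ck n lam U"
proof -
  have "ck n (\<lambda>p. (- \<mu> / 2) * (yy p)\<^sup>2 + (- 1 / 4) * A p - \<mu> / 2 * ((snd p $ 1)\<^sup>2 + (snd p $ 2)\<^sup>2)) U"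
    by (intro ck_cmult ck_add ck_diff ck_power ck_yy ck_A ck_x3 open_U)
  thus ?thesis by (simp add: lam_def[abs_def])
qed

lemma ck_u: "ck n u U"
  unfolding u_def[abs_def] by (intro ck_cmult ck_exp ck_lam open_U)

text \<open>The phase of the wave is \<open>s / ch\<close>, so all momenta are divided by
  \<open>ch\<close>. The domain is \<open>V\<close> because \<open>s\<close> contains an integral
  starting at \<open>z0\<close>.\<close>

sublocale polar_field c m q ch aa \<phi> u "\<lambda>p. s p / ch" "\<lambda>p. u p * lt p" "\<lambda>p. u p * (- \<mu> * snd p $ 1)"
  "\<lambda>p. u p * (- \<mu> * snd p $ 2)" "\<lambda>p. u p * l3 p" "\<lambda>p. st p / ch" "\<lambda>p. sz p / ch" "\<lambda>p. Phi p / ch" V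
proof
  fix p assume p: "p \<in> V"
  hence pU: "p \<in> U" using V_subset by auto
  show "d4 u (u p * lt p) (u p * (- \<mu> * snd p $ 1)) (u p * (- \<mu> * snd p $ 2)) (u p * l3 p) p"
    by (rule d4_u[OF pU])
  show "d4 (\<lambda>p. s p / ch) (st p / ch) 0 0 (sz p / ch) p"
    using d4_cmult[OF d4_s[OF p], of "1 / ch"] by simp
  show "Phi p / ch = st p / ch + q * \<phi> p / ch"
    using Phi_s_phi[OF pU] by (simp add: add_divide_distrib)
qed (rule open_V)

lemma ck_psi: "ck n \<psi> V"
proof -
  have "ck n (\<lambda>p. (1 / ch) * s p) V" by (intro ck_cmult ck_s open_V)
  hence "ck n (\<lambda>p. complex_of_real (u p) * cis ((1 / ch) * s p)) V"
    by (intro ck_polar open_V ck_V[OF ck_u])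
  thus ?thesis by (simp add: \<psi>_def[abs_def])
qed

lemma KG_solution:
  assumes p: "p \<in> V"
  shows "KG_eq c m q ch aa \<phi> \<psi> p"
proof -
  have pU: "p \<in> U" using p V_subset by auto
  obtain a1 a2 a3 where lt': "d4 lt (ltt p) a1 a2 a3 p" using d4_lt[OF pU] by blast
  obtain b0 b1 b2 where l3': "d4 l3 b0 b1 b2 (l33 p) p" using d4_l3[OF pU] by blast
  obtain e where Phi': "d4 Phi (Phit p) 0 0 e p" using d4_Phi[OF pU] by blast
  obtain h where sz': "d4 sz h 0 0 (szz p) p" using d4_sz[OF pU] by blast
  note du' = d4_u[OF pU]
  show ?thesis
  proof (rule KG_eq_polar[OF p d4_mult[OF du' lt'] d4_mult[OF du' d4_cmult[OF d4_x1]] d4_mult[OF du' d4_cmult[OF d4_x2]]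
        d4_mult[OF du' l3']])
    show "d4 (\<lambda>p. Phi p / ch) (Phit p / ch) (0 / ch) (0 / ch) (e / ch) p"
      using d4_cmult[OF Phi', of "1 / ch"] by simp
    show "d4 (\<lambda>p. sz p / ch) (h / ch) (0 / ch) (0 / ch) (szz p / ch) p"
      using d4_cmult[OF sz', of "1 / ch"] by simp
    have ms: "(Phi p / ch)\<^sup>2 / c\<^sup>2 - (sz p / ch)\<^sup>2 = (m * c / ch)\<^sup>2 + Fr (tt p) (yy p)"
    proof -
      have "(Phi p / ch)\<^sup>2 / c\<^sup>2 - (sz p / ch)\<^sup>2 = ((Phi p)\<^sup>2 / c\<^sup>2 - (sz p)\<^sup>2) / ch\<^sup>2"
        by (simp add: power_divide diff_divide_distrib)
      thus ?thesis using ch by (simp add: mass_shell[OF pU] power_divide add_divide_distrib)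
    qed
    define x1 x2 where "x1 = snd p $ 1" and "x2 = snd p $ 2"
    \<comment> \<open>After \<open>u p\<close> is factored out, the equation is the sum of
      \<open>quantum_potential\<close> and the mass shell relation; \<open>Fr\<close> is added in
      one and subtracted in the other.\<close>
    have "- (u p * ltt p + u p * lt p * lt p - u p * (Phi p / ch)\<^sup>2) / c\<^sup>2 
       + (u p * (- \<mu> * 1) + u p * (- \<mu> * x1) * (- \<mu> * x1))
       + (u p * (- \<mu> * 1) + u p * (- \<mu> * x2) * (- \<mu> * x2))
       + (u p * l33 p + u p * l3 p * l3 p) - u p * (sz p / ch)\<^sup>2 - Gder aa ((u p)\<^sup>2) * u p - (m * c / ch)\<^sup>2 * u p
     = u p * ((- ((lt p)\<^sup>2 + ltt p) / c\<^sup>2 + (\<mu>\<^sup>2 * x1\<^sup>2 - \<mu>) + (\<mu>\<^sup>2 * x2\<^sup>2 - \<mu>) + ((l3 p)\<^sup>2 + l33 p) + Fr (tt p) (yy p)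
        - Gder aa ((u p)\<^sup>2)) + (((Phi p / ch)\<^sup>2 / c\<^sup>2 - (sz p / ch)\<^sup>2) - ((m * c / ch)\<^sup>2 + Fr (tt p) (yy p))))"
      by (simp add: algebra_simps power2_eq_square add_divide_distrib diff_divide_distrib)
    also have "\<dots> = 0" unfolding ms x1_def x2_def quantum_potential by simp
    finally show "- (u p * ltt p + u p * lt p * lt p - u p * (Phi p / ch)\<^sup>2) / c\<^sup>2 
       + (u p * (- \<mu> * 1) + u p * (- \<mu> * snd p $ 1) * (- \<mu> * snd p $ 1))
       + (u p * (- \<mu> * 1) + u p * (- \<mu> * snd p $ 2) * (- \<mu> * snd p $ 2))
       + (u p * l33 p + u p * l3 p * l3 p) - u p * (sz p / ch)\<^sup>2 - Gder aa ((u p)\<^sup>2) * u p - (m * c / ch)\<^sup>2 * u p = 0"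
      by (simp add: x1_def x2_def)
    have "- (2 * (u p * lt p) * (Phi p / ch) + u p * (Phit p / ch)) / c\<^sup>2 + 2 * (u p * l3 p) * (sz p / ch) + u p * (szz p / ch)
      = u p / ch * (- (2 * lt p * Phi p + Phit p) / c\<^sup>2 + 2 * l3 p * sz p + szz p)"
      by (simp add: algebra_simps add_divide_distrib)
    thus "- (2 * (u p * lt p) * (Phi p / ch) + u p * (Phit p / ch)) / c\<^sup>2 + 2 * (u p * l3 p) * (sz p / ch) + u p * (szz p / ch) = 0"
      by (simp only: continuity_equation[OF pU] mult_zero_right)
  qed
qed

end

section \<open>Solving the algebraic relation for small \<chi>\<close>

context field begin

lemma has_jet_cong: "has_jet g \<Longrightarrow> (\<And>t y. g t y = h t y) \<Longrightarrow> has_jet h"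
  unfolding has_jet_def by simp

lemma has_jet_y: "real_entire f \<Longrightarrow> has_jet (\<lambda>t y. f y)"
  using has_jet_entire[of f 0 1] by simp

lemma has_jet_x: "real_entire f \<Longrightarrow> has_jet (\<lambda>t y. f ((t + y) / 2))"
  using has_jet_entire[of f "1/2" "1/2"] by (simp add: add_divide_distrib)

lemma has_jet_const: "has_jet (\<lambda>t y. k)"
  by (rule has_jet_y[OF real_entire_const])

lemma fr_inverse: "1 / fr y = 1 / \<kappa> * exp (\<mu> * (y * y))"
  by (simp add: fr_def exp_minus field_simps power2_eq_square)

lemma has_jet_fr: "has_jet (\<lambda>t y. fr y)" and has_jet_inverse_fr: "has_jet (\<lambda>t y. 1 / fr y)"
proof -
  have "has_jet (\<lambda>t y. \<kappa> * exp (- \<mu> * (y * y)))"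
    by (rule has_jet_y) (intro real_entire_mult real_entire_exp real_entire_const real_entire_id)
  thus "has_jet (\<lambda>t y. fr y)" by (rule has_jet_cong) (simp add: fr_def power2_eq_square)
  have "has_jet (\<lambda>t y. 1 / \<kappa> * exp (\<mu> * (y * y)))"
    by (rule has_jet_y) (intro real_entire_mult real_entire_exp real_entire_const real_entire_id)
  thus "has_jet (\<lambda>t y. 1 / fr y)" by (rule has_jet_cong) (simp only: fr_inverse)
qed

lemma has_jet_exp: "has_jet (\<lambda>t y. exp (a * poly P ((t + y) / 2)))"
  by (rule has_jet_x[of "\<lambda>x. exp (a * poly P x)"]) (intro real_entire_mult real_entire_exp real_entire_const real_entire_poly)

lemma has_jet_Fr: "has_jet Fr"
proof -
  have "has_jet (\<lambda>\<tau> y. (- \<mu> * (ln (pi powr (3/2)) + 1) + \<mu> * \<mu> * (y * y)) + (\<mu> / 2) * poly P ((\<tau> + y) / 2)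
     + (- 4 * exp (-1 * poly P ((\<tau> + y) / 2))) * ((- \<mu> + \<mu> * \<mu> * (y * y)) + (\<mu> * (y * (1/4))) * poly (pderiv P) ((\<tau> + y) / 2)))"
    by (intro has_jet_add has_jet_mult has_jet_exp has_jet_x[OF real_entire_poly] has_jet_const
        has_jet_y[OF real_entire_id])
  thus ?thesis by (rule has_jet_cong) (simp add: Fr_def power2_eq_square algebra_simps)
qed

lemma exists_sol:
  assumes r: "r > 0"
  obtains ch0 where "ch0 > 0" "\<And>ch. 0 < ch \<Longrightarrow> ch < ch0 \<Longrightarrow>
    \<exists>kj pp Om Ph R1. sol t0 t1 y0 y1 c m q aa P X H T1 T2 Z1 Z2 z0 ch r R1 kj pp Om Ph"
proof -
  define E where "E a \<tau> y = exp (a * poly P ((\<tau> + y) / 2))" for a \<tau> y :: real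
  have E: "has_jet (E a)" for a unfolding E_def[abs_def] by (rule has_jet_exp)
  \<comment> \<open>Collecting \<open>k\<close> and \<open>p\<close> in \<open>relOm\<close> and
    \<open>relPh\<close> gives \<open>Om = f1 k + f2 p\<close> and \<open>Ph = f3 k + f4 p\<close>.
    Both are linear in the small unknowns, with coefficients that do not involve
    \<open>ch\<close>.\<close>
  define f1 where "f1 \<tau> y = (- (m * c / 2) * (E (1/2) \<tau> y + (-1) * E (-1/2) \<tau> y)) * (1 / fr y)" for \<tau> y
  define f2 where "f2 \<tau> y = ((m * c / 2) * (E (1/2) \<tau> y + E (-1/2) \<tau> y)) * (1 / fr y)" for \<tau> y
  define f3 where "f3 \<tau> y = ((m * c\<^sup>2 / 2) * (E (1/2) \<tau> y + E (-1/2) \<tau> y)) * (1 / fr y)" for \<tau> y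
  define f4 where "f4 \<tau> y = (- (m * c\<^sup>2 / 2) * (E (1/2) \<tau> y + (-1) * E (-1/2) \<tau> y)) * (1 / fr y)" for \<tau> y
  have f: "has_jet f1" "has_jet f2" "has_jet f3" "has_jet f4"
    unfolding f1_def[abs_def] f2_def[abs_def] f3_def[abs_def] f4_def[abs_def]
    by (intro has_jet_mult has_jet_add has_jet_const E has_jet_inverse_fr)+
  obtain J1 M1 where J1: "is_jet J1" "nm J1 M1" "\<And>t y. t\<in>{t0..t1} \<Longrightarrow> y\<in>{y0..y1} \<Longrightarrow> J1 0 0 t y = f1 t y"
    using f(1) unfolding has_jet_def by blast
  obtain J2 M2 where J2: "is_jet J2" "nm J2 M2" "\<And>t y. t\<in>{t0..t1} \<Longrightarrow> y\<in>{y0..y1} \<Longrightarrow> J2 0 0 t y = f2 t y"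
    using f(2) unfolding has_jet_def by blast
  obtain J3 M3 where J3: "is_jet J3" "nm J3 M3" "\<And>t y. t\<in>{t0..t1} \<Longrightarrow> y\<in>{y0..y1} \<Longrightarrow> J3 0 0 t y = f3 t y"
    using f(3) unfolding has_jet_def by blast
  obtain J4 M4 where J4: "is_jet J4" "nm J4 M4" "\<And>t y. t\<in>{t0..t1} \<Longrightarrow> y\<in>{y0..y1} \<Longrightarrow> J4 0 0 t y = f4 t y"
    using f(4) unfolding has_jet_def by blast
  note J = J1 J2 J3 J4
  note M0 = nm_nonneg[OF J(2)] nm_nonneg[OF J(5)] nm_nonneg[OF J(8)] nm_nonneg[OF J(11)]
  define MM where "MM = M1 + M2 + M3 + M4 + 1"
  \<comment> \<open>The 8 is the constant of \<open>nm_jmult\<close>; unknowns below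
    \<open>r'\<close> make both corrections at most \<open>r\<close>.\<close>
  define r' where "r' = r / (8 * MM)"
  have MM: "MM > 0" using M0 by (simp add: MM_def)
  have r': "r' > 0" using r MM by (simp add: r'_def)
  have r8: "8 * M * r' + 8 * M' * r' \<le> r" if "M + M' \<le> MM" for M M'
  proof -
    have "8 * M * r' + 8 * M' * r' = (M + M') * (8 * r')" by (simp add: algebra_simps)
    also have "\<dots> \<le> MM * (8 * r')" using that r' by (intro mult_right_mono) auto
    also have "\<dots> = r" using MM by (simp add: r'_def)
    finally show ?thesis .
  qed
  \<comment> \<open>Expanding \<open>rel2\<close> and isolating \<open>2 * fr y * k\<close> gives
    the fixed point equation with this \<open>b\<close>, with \<open>h\<close> below, and with
    strength \<open>e = ch\<^sup>2\<close>. The threshold for \<open>ch\<close> is therefore the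
    square root of \<open>e0\<close>.\<close>
  define b where "b \<tau> y = 1 / (2 * (m * c)\<^sup>2) * (fr y * Fr \<tau> y)" for \<tau> y
  define h where "h \<tau> y = 1/2 * (1 / fr y)" for \<tau> y :: real
  have "has_jet b" "has_jet h"
    unfolding b_def[abs_def] h_def[abs_def]
    by (intro has_jet_mult has_jet_const has_jet_fr has_jet_Fr has_jet_inverse_fr)+
  from small_solution[OF this r'] obtain e0 where e0: "e0 > 0" "\<And>e. 0 < e \<Longrightarrow> e < e0 \<Longrightarrow>
     \<exists>k p. is_jet k \<and> is_jet p \<and> nm k r' \<and> nm p r' \<and>
       (\<forall>t\<in>{t0..t1}. \<forall>y\<in>{y0..y1}. p 0 1 t y = k 1 0 t y \<and>
          k 0 0 t y = e * b t y + h t y * ((p 0 0 t y)\<^sup>2 - (k 0 0 t y)\<^sup>2))" by blast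
  show ?thesis
  proof (rule that[of "sqrt e0"])
    show "sqrt e0 > 0" using e0 by simp
    fix ch :: real assume ch: "0 < ch" "ch < sqrt e0"
    have "ch\<^sup>2 < (sqrt e0)\<^sup>2" using ch by (intro power_strict_mono) auto
    hence "ch\<^sup>2 < e0" using e0 by simp
    with e0(2)[of "ch\<^sup>2"] ch obtain k p where k: "is_jet k" "is_jet p" "nm k r'" "nm p r'"
      and rel: "\<And>t y. t\<in>{t0..t1} \<Longrightarrow> y\<in>{y0..y1} \<Longrightarrow> p 0 1 t y = k 1 0 t y"
        "\<And>t y. t\<in>{t0..t1} \<Longrightarrow> y\<in>{y0..y1} \<Longrightarrow> k 0 0 t y = ch\<^sup>2 * b t y + h t y * ((p 0 0 t y)\<^sup>2 - (k 0 0 t y)\<^sup>2)"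
      by auto
    define Om where "Om j l t y = jmult J1 k j l t y + jmult J2 p j l t y" for j l t y
    define Ph where "Ph j l t y = jmult J3 k j l t y + jmult J4 p j l t y" for j l t y
    have "sol t0 t1 y0 y1 c m q aa P X H T1 T2 Z1 Z2 z0 ch r r' k p Om Ph"
    proof unfold_locales
      show "is_jet Om" "is_jet Ph" unfolding Om_def[abs_def] Ph_def[abs_def]
        by (intro is_jet_add is_jet_jmult J k)+
      have "nm Om (8 * M1 * r' + 8 * M2 * r')" "nm Ph (8 * M3 * r' + 8 * M4 * r')"
        unfolding Om_def[abs_def] Ph_def[abs_def] by (intro nm_add nm_jmult J k)+
      thus "nm Om r" "nm Ph r" using M0 by (auto elim!: nm_mono intro!: r8 simp: MM_def)
      fix \<tau> y assume ty: "\<tau> \<in> {t0..t1}" "y \<in> {y0..y1}"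
      have f: "fr y \<noteq> 0" using fr_pos[of y] by simp
      show "(fr y + k 0 0 \<tau> y)\<^sup>2 - (p 0 0 \<tau> y)\<^sup>2 = (fr y)\<^sup>2 * (1 + ch\<^sup>2 * Fr \<tau> y / (m * c)\<^sup>2)"
      proof -
        define K G W where "K = k 0 0 \<tau> y" and "G = p 0 0 \<tau> y" and "W = ch\<^sup>2 * Fr \<tau> y / (m * c)\<^sup>2"
        have "K = ch\<^sup>2 * b \<tau> y + h \<tau> y * (G\<^sup>2 - K\<^sup>2)"
          using rel(2)[OF ty] by (simp only: K_def G_def)
        also have "ch\<^sup>2 * b \<tau> y = fr y * W / 2" by (simp add: b_def W_def mult_ac)
        also have "h \<tau> y * (G\<^sup>2 - K\<^sup>2) = (G\<^sup>2 - K\<^sup>2) / (2 * fr y)" by (simp add: h_def)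
        finally have "K = fr y * W / 2 + (G\<^sup>2 - K\<^sup>2) / (2 * fr y)" .
        hence "2 * fr y * K = 2 * fr y * (fr y * W / 2 + (G\<^sup>2 - K\<^sup>2) / (2 * fr y))" by simp
        also have "\<dots> = fr y * fr y * W + (G\<^sup>2 - K\<^sup>2)" using f by (simp add: distrib_left)
        finally have "(fr y + K)\<^sup>2 - G\<^sup>2 = (fr y)\<^sup>2 * (1 + W)" by (simp add: power2_eq_square algebra_simps)
        thus ?thesis by (simp only: K_def G_def W_def)
      qed
      have e: "exp (poly P ((\<tau> + y) / 2) / 2) = E (1/2) \<tau> y" "exp (- poly P ((\<tau> + y) / 2) / 2) = E (-1/2) \<tau> y"
        by (simp_all add: E_def)
      show "Om 0 0 \<tau> y = - (m * c / 2) * (exp (poly P ((\<tau> + y) / 2) / 2) * (k 0 0 \<tau> y - p 0 0 \<tau> y)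
          - exp (- poly P ((\<tau> + y) / 2) / 2) * (k 0 0 \<tau> y + p 0 0 \<tau> y)) / fr y"
        unfolding Om_def jmult_00 J(3)[OF ty] J(6)[OF ty] f1_def f2_def e
        using f by (simp add: field_simps)
      show "Ph 0 0 \<tau> y = (m * c\<^sup>2 / 2) * (exp (poly P ((\<tau> + y) / 2) / 2) * (k 0 0 \<tau> y - p 0 0 \<tau> y)
          + exp (- poly P ((\<tau> + y) / 2) / 2) * (k 0 0 \<tau> y + p 0 0 \<tau> y)) / fr y"
        unfolding Ph_def jmult_00 J(9)[OF ty] J(12)[OF ty] f3_def f4_def e
        using f by (simp add: field_simps)
    qed (use ch k rel in auto)
    thus "\<exists>kj pp Om Ph R1. sol t0 t1 y0 y1 c m q aa P X H T1 T2 Z1 Z2 z0 ch r R1 kj pp Om Ph" by blast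
  qed
qed

end

section \<open>Estimates of the potential and of the densities\<close>

context sol begin

lemma r_nonneg: "r \<ge> 0" by (rule nm_nonneg[OF jets(6)])

definition "C1 N = 2 * c * (N + 1)" for N :: real
definition "C2 N = 2 * c\<^sup>2 * N ^ 3 + 8 * c\<^sup>2 * (N + 1)\<^sup>2" for N :: real
definition "CC N = (1 + C1 N * (Z2 - z0) + C1 N + C2 N * (Z2 - z0) + 2 * (N + 1) + C1 N) / \<bar>q\<bar>" for N :: real

context
  fixes N :: real
  assumes N: "\<And>p. p \<in> U \<Longrightarrow> nu p \<le> N" "\<And>p. p \<in> U \<Longrightarrow> \<bar>A1 p\<bar> \<le> N" and N1: "N \<ge> 1"
begin

lemma nu_pm:
  assumes "p \<in> U"
  shows "\<bar>nu p + 1\<bar> \<le> N + 1" "\<bar>nu p - 1\<bar> \<le> N + 1"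
proof -
  have n: "0 < nu p" by (simp add: nu_def)
  show "\<bar>nu p + 1\<bar> \<le> N + 1" using n N(1)[OF assms] N1 by linarith
  show "\<bar>nu p - 1\<bar> \<le> N + 1" using n N(1)[OF assms] N1 by linarith
qed

lemma jp_t_bound:
  assumes "nm G r" "p \<in> U"
  shows "\<bar>c * (nu p + 1) * jp G 1 0 p + c * (nu p - 1) * jp G 0 1 p\<bar> \<le> C1 N * r"
    "\<bar>(nu p - 1) * jp G 1 0 p + (nu p + 1) * jp G 0 1 p\<bar> \<le> 2 * (N + 1) * r"
proof -
  have j: "\<bar>jp G 1 0 p\<bar> \<le> r" "\<bar>jp G 0 1 p\<bar> \<le> r"
    using jp_le[OF assms, of 1 0] jp_le[OF assms, of 0 1] by auto
  have cc: "\<bar>c\<bar> \<le> c" using c by simp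
  have "\<bar>c * (nu p + 1) * jp G 1 0 p\<bar> \<le> c * (N + 1) * r" "\<bar>c * (nu p - 1) * jp G 0 1 p\<bar> \<le> c * (N + 1) * r"
    by (intro abs_mult_le cc nu_pm assms j)+
  thus "\<bar>c * (nu p + 1) * jp G 1 0 p + c * (nu p - 1) * jp G 0 1 p\<bar> \<le> C1 N * r"
    unfolding C1_def by (intro order_trans[OF abs_triangle_ineq]) linarith
  have "\<bar>(nu p - 1) * jp G 1 0 p\<bar> \<le> (N + 1) * r" "\<bar>(nu p + 1) * jp G 0 1 p\<bar> \<le> (N + 1) * r"
    by (intro abs_mult_le nu_pm assms j)+
  thus "\<bar>(nu p - 1) * jp G 1 0 p + (nu p + 1) * jp G 0 1 p\<bar> \<le> 2 * (N + 1) * r"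
    by (intro order_trans[OF abs_triangle_ineq]) linarith
qed

lemma omt_bound: "p \<in> U \<Longrightarrow> \<bar>omt p\<bar> \<le> C1 N * r"
  unfolding omt_def by (rule jp_t_bound[OF jets(6)])

lemma omtt_bound: "p \<in> U \<Longrightarrow> \<bar>omtt p\<bar> \<le> C2 N * r"
proof -
  assume p: "p \<in> U"
  have j: "\<bar>jp Om 1 0 p\<bar> \<le> r" "\<bar>jp Om 0 1 p\<bar> \<le> r"
    "\<bar>jp Om 2 0 p\<bar> \<le> 2 * r" "\<bar>jp Om 1 1 p\<bar> \<le> 2 * r" "\<bar>jp Om 0 2 p\<bar> \<le> 2 * r"
    using jp_le[OF jets(6) p, of 1 0] jp_le[OF jets(6) p, of 0 1] jp_le[OF jets(6) p, of 2 0]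
      jp_le[OF jets(6) p, of 1 1] jp_le[OF jets(6) p, of 0 2] by (simp_all add: fact_2 mult.commute)
  have cc: "\<bar>c\<bar> \<le> c" using c by simp
  have tri: "\<bar>x + y\<bar> \<le> a + b" if "\<bar>x\<bar> \<le> a" "\<bar>y\<bar> \<le> b" for x y a b :: real using that by linarith
  have n: "\<bar>nu p\<bar> \<le> N" using N(1)[OF p] by (simp add: nu_def)
  have nt: "\<bar>nut p\<bar> \<le> N * c * N * N"
    unfolding nut_def abs_minus_cancel by (intro abs_mult_le N cc n p)
  have "\<bar>omtt p\<bar> \<le> c * (N * c * N * N) * (r + r) + c * (N + 1) * (c * (N + 1) * (2 * r) + c * (N + 1) * (2 * r))
      + c * (N + 1) * (c * (N + 1) * (2 * r) + c * (N + 1) * (2 * r))"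
    unfolding omtt_def by (intro tri abs_mult_le cc nt j nu_pm p)
  also have "\<dots> = C2 N * r" by (simp add: C2_def power2_eq_square power3_eq_cube algebra_simps)
  finally show ?thesis .
qed

lemma zint_omt_bound: "p \<in> V \<Longrightarrow> \<bar>zint z0 omt p\<bar> \<le> C1 N * r * (Z2 - z0)"
  by (rule zint_bound[OF _ omt_bound ck_omt[of 0]])

lemma zint_omtt_bound: "p \<in> V \<Longrightarrow> \<bar>zint z0 omtt p\<bar> \<le> C2 N * r * (Z2 - z0)"
proof (rule zint_bound[OF _ omtt_bound])
  have "ck 0 (pd omt e_t) U" using ck_omt[of "Suc 0"] by (simp add: Basis_prod_def e_t_def)
  thus "ck 0 omtt U"
    by (rule ck_cong[OF open_U]) (use d4_omt d4_pd(1) in blast)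
qed

text \<open>The leading potential \<open>m c\<^sup>2 / q * exp(A / 2)\<close> depends on
  \<open>z + c t\<close>, so its \<open>t\<close>-derivative is \<open>c\<close> times its
  \<open>z\<close>-derivative. All deviations come from \<open>Ph\<close> and from integrals of
  \<open>om\<close> and its derivatives, hence are linear in \<open>r\<close>.\<close>

lemma phi_estimate:
  assumes p: "p \<in> V"
  obtains ft fz where "d4 \<phi> ft 0 0 fz p"
    "\<bar>\<phi> p - m * c\<^sup>2 / q * exp (A p / 2)\<bar> \<le> CC N * r"
    "\<bar>ft - c * (m * c\<^sup>2 / q * (exp (A p / 2) * (A1 p * nu p / 2)))\<bar> \<le> CC N * r"
    "\<bar>fz - m * c\<^sup>2 / q * (exp (A p / 2) * (A1 p * nu p / 2))\<bar> \<le> CC N * r"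
proof -
  have pU: "p \<in> U" using p V_subset by auto
  define Pt where "Pt = c * (nu p + 1) * jp Ph 1 0 p + c * (nu p - 1) * jp Ph 0 1 p"
  define Pz where "Pz = (nu p - 1) * jp Ph 1 0 p + (nu p + 1) * jp Ph 0 1 p"
  have z: "Z2 - z0 \<ge> 0" using p by (auto simp: V_def slab_def)
  have pos: "C1 N \<ge> 0" "C2 N \<ge> 0" using c N1 by (simp_all add: C1_def C2_def)
  have d1: "d4 (\<lambda>p. exp (1/2 * A p)) (exp (A p / 2) * (A1 p * nu p / 2) * c) 0 0 (exp (A p / 2) * (A1 p * nu p / 2)) p"
    by (rule d4_cong[OF d4_exp[OF d4_cmult[OF d4_A[OF pU], of "1/2"]] open_UNIV UNIV_I]) simp_all
  have d2: "d4 (jp Ph 0 0) Pt 0 0 Pz p"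
    using d4_jp[OF jets(7,8) pU, of 0 0] by (simp add: Pt_def Pz_def)
  have d: "d4 \<phi> (1 / q * (m * c\<^sup>2 * (exp (A p / 2) * (A1 p * nu p / 2) * c) + Pt - zint z0 omtt p)) 0 0
     (1 / q * (m * c\<^sup>2 * (exp (A p / 2) * (A1 p * nu p / 2)) + Pz - omt p)) p"
    by (rule d4_cong[OF d4_cmult[OF d4_diff[OF d4_add[OF d4_cmult[OF d1, of "m * c\<^sup>2"] d2] d4_zint_omt[OF p]], of "1 / q"] open_UNIV UNIV_I])
      (simp_all add: \<phi>_def)
  have b: "\<bar>Pt\<bar> \<le> C1 N * r" "\<bar>Pz\<bar> \<le> 2 * (N + 1) * r" "\<bar>jp Ph 0 0 p\<bar> \<le> r"
    using jp_t_bound[OF jets(8) pU] jp_le[OF jets(8) pU, of 0 0] by (simp_all add: Pt_def Pz_def)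
  note b' = zint_omt_bound[OF p] zint_omtt_bound[OF p] omt_bound[OF pU]
  have key: "\<bar>1 / q * w\<bar> \<le> CC N * r" if "\<bar>w\<bar> \<le> (1 + C1 N * (Z2 - z0) + C1 N + C2 N * (Z2 - z0) + 2 * (N + 1) + C1 N) * r" for w
    using divide_right_mono[OF that, of "\<bar>q\<bar>"] by (simp add: CC_def abs_mult)
  have nn: "0 \<le> C1 N * r * (Z2 - z0)" "0 \<le> C1 N * r" "0 \<le> C2 N * r * (Z2 - z0)" "0 \<le> 2 * (N + 1) * r"
    using pos z r_nonneg N1 by auto
  show ?thesis
  proof (rule that[OF d])
    have "\<phi> p - m * c\<^sup>2 / q * exp (A p / 2) = 1 / q * (jp Ph 0 0 p - zint z0 omt p)"
      using q by (simp add: \<phi>_def field_simps)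
    also have "\<bar>\<dots>\<bar> \<le> CC N * r"
      by (rule key) (use b b' nn r_nonneg in \<open>simp add: algebra_simps\<close>)
    finally show "\<bar>\<phi> p - m * c\<^sup>2 / q * exp (A p / 2)\<bar> \<le> CC N * r" .
    have "1 / q * (m * c\<^sup>2 * (exp (A p / 2) * (A1 p * nu p / 2) * c) + Pt - zint z0 omtt p)
        - c * (m * c\<^sup>2 / q * (exp (A p / 2) * (A1 p * nu p / 2))) = 1 / q * (Pt - zint z0 omtt p)"
      using q by (simp add: field_simps)
    also have "\<bar>\<dots>\<bar> \<le> CC N * r"
      by (rule key) (use b b' nn r_nonneg in \<open>simp add: algebra_simps\<close>)
    finally show "\<bar>1 / q * (m * c\<^sup>2 * (exp (A p / 2) * (A1 p * nu p / 2) * c) + Pt - zint z0 omtt p)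
        - c * (m * c\<^sup>2 / q * (exp (A p / 2) * (A1 p * nu p / 2)))\<bar> \<le> CC N * r" .
    have "1 / q * (m * c\<^sup>2 * (exp (A p / 2) * (A1 p * nu p / 2)) + Pz - omt p)
        - m * c\<^sup>2 / q * (exp (A p / 2) * (A1 p * nu p / 2)) = 1 / q * (Pz - omt p)"
      using q by (simp add: field_simps)
    also have "\<bar>\<dots>\<bar> \<le> CC N * r"
      by (rule key) (use b b' nn r_nonneg in \<open>simp add: algebra_simps\<close>)
    finally show "\<bar>1 / q * (m * c\<^sup>2 * (exp (A p / 2) * (A1 p * nu p / 2)) + Pz - omt p)
        - m * c\<^sup>2 / q * (exp (A p / 2) * (A1 p * nu p / 2))\<bar> \<le> CC N * r" .
  qed
qed

end

definition "Sb b = (m * c\<^sup>2 * exp b + 1)\<^sup>2 / c\<^sup>2 + (m * c * exp b + 1)\<^sup>2" for b :: real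

text \<open>For small \<open>ch\<close> the derivatives of \<open>u\<close> and the nonlinear term
  are dominated by the rest mass term, so both densities are comparable to \<open>u\<^sup>2\<close>.
  The nonlinear term has no sign; it can take away at most half of the rest energy, which leaves the
  factor \<open>m * c\<^sup>2 / 4\<close>.\<close>

lemma density_bounds:
  assumes p: "p \<in> V" and Ab: "\<bar>A p\<bar> \<le> b" and zo: "\<bar>zint z0 omt p\<bar> \<le> 1" and r1: "r \<le> 1"
    and L: "(lt p)\<^sup>2 / c\<^sup>2 + (\<mu> * snd p $ 1)\<^sup>2 + (\<mu> * snd p $ 2)\<^sup>2 + (l3 p)\<^sup>2 \<le> L"
      "\<bar>\<mu> * (2 * lam p + ln (pi powr (3/2)) + 2)\<bar> \<le> L" and Lch: "ch\<^sup>2 * L \<le> (m * c)\<^sup>2 / 2"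
  shows "0 \<le> conc_dens c m ch aa \<psi> p" "conc_dens c m ch aa \<psi> p \<le> (2 + Sb b / (m * c)\<^sup>2) * (u p)\<^sup>2"
    "m * c\<^sup>2 / 4 * (u p)\<^sup>2 \<le> energy_density c m q ch aa \<phi> \<psi> p"
    "energy_density c m q ch aa \<phi> \<psi> p \<le> (m * c\<^sup>2 + Sb b / (2 * m)) * (u p)\<^sup>2"
proof -
  have pU: "p \<in> U" using p V_subset by auto
  have hyp: "\<bar>sinh (A p / 2)\<bar> \<le> exp b" "\<bar>cosh (A p / 2)\<bar> \<le> exp b"
  proof -
    have "exp (A p / 2) \<le> exp b" "exp (- (A p / 2)) \<le> exp b" using Ab by auto
    moreover have "exp (A p / 2) > 0" "exp (- (A p / 2)) > 0" by auto
    moreover have "sinh (A p / 2) = (exp (A p / 2) - exp (- (A p / 2))) / 2"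
      "cosh (A p / 2) = (exp (A p / 2) + exp (- (A p / 2))) / 2"
      by (simp_all add: sinh_def cosh_def)
    moreover have "\<bar>(x - y) / 2\<bar> \<le> B \<and> \<bar>(x + y) / 2\<bar> \<le> B"
      if "x \<le> B" "y \<le> B" "x > 0" "y > 0" for x y B :: real
      using that by (simp add: abs_le_iff)
    ultimately have "\<bar>sinh (A p / 2)\<bar> \<le> exp b \<and> \<bar>cosh (A p / 2)\<bar> \<le> exp b"
      by presburger
    thus "\<bar>sinh (A p / 2)\<bar> \<le> exp b" "\<bar>cosh (A p / 2)\<bar> \<le> exp b" by auto
  qed
  have mc: "m * c\<^sup>2 > 0" "m * c > 0" using m c by auto
  have scale: "\<bar>k * h\<bar> \<le> k * e" if "k > 0" "\<bar>h\<bar> \<le> e" for k h e :: real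
    using that by (simp add: abs_mult)
  have st: "\<bar>st p\<bar> \<le> m * c\<^sup>2 * exp b + 1"
  proof -
    have "\<bar>m * c\<^sup>2 * sinh (A p / 2)\<bar> \<le> m * c\<^sup>2 * exp b" by (rule scale[OF mc(1) hyp(1)])
    thus ?thesis using zo unfolding st_def by linarith
  qed
  have Ph: "\<bar>Phi p\<bar> \<le> m * c\<^sup>2 * exp b + 1"
  proof -
    have "\<bar>m * c\<^sup>2 * cosh (A p / 2)\<bar> \<le> m * c\<^sup>2 * exp b" by (rule scale[OF mc(1) hyp(2)])
    moreover have "\<bar>jp Ph 0 0 p\<bar> \<le> 1" using jp_le[OF jets(8) pU, of 0 0] r1 by simp
    ultimately show ?thesis unfolding Phi_eq[OF pU] by linarith
  qed
  have sz: "\<bar>sz p\<bar> \<le> m * c * exp b + 1"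
  proof -
    have "\<bar>m * c * sinh (A p / 2)\<bar> \<le> m * c * exp b" by (rule scale[OF mc(2) hyp(1)])
    moreover have "\<bar>om p\<bar> \<le> 1" using jp_le[OF jets(6) pU, of 0 0] r1 by (simp add: om_def)
    ultimately show ?thesis unfolding sz_eq[OF pU] by linarith
  qed
  have sq: "x\<^sup>2 \<le> y\<^sup>2" if "\<bar>x\<bar> \<le> y" for x y :: real using that by (meson abs_ge_zero order_trans power2_le_iff_abs_le)
  have S1: "(st p)\<^sup>2 / c\<^sup>2 + (sz p)\<^sup>2 \<le> Sb b" and S2: "(Phi p)\<^sup>2 / c\<^sup>2 + (sz p)\<^sup>2 \<le> Sb b"
    unfolding Sb_def by (intro add_mono divide_right_mono sq st sz Ph; simp)+
  define w where "w = (u p)\<^sup>2"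
  have w: "w > 0" using u_pos[of p] by (simp add: w_def)
  define D where "D = (lt p)\<^sup>2 / c\<^sup>2 + (\<mu> * snd p $ 1)\<^sup>2 + (\<mu> * snd p $ 2)\<^sup>2 + (l3 p)\<^sup>2"
  define G where "G = \<mu> * (2 * lam p + ln (pi powr (3/2)) + 2)"
  have D0: "0 \<le> D" by (simp add: D_def)
  have DL: "D \<le> L" "\<bar>G\<bar> \<le> L" using L by (simp_all add: D_def G_def)
  have Gf: "Gfun aa ((u p)\<^sup>2) = - w * G" by (simp add: Gfun_u G_def w_def)
  have cd: "conc_dens c m ch aa \<psi> p = w * (ch\<^sup>2 * D / (m * c)\<^sup>2 + ((st p)\<^sup>2 / c\<^sup>2 + (sz p)\<^sup>2) / (m * c)\<^sup>2 + ch\<^sup>2 * \<bar>G\<bar> / (m * c)\<^sup>2 + 1)"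
  proof -
    have "conc_dens c m ch aa \<psi> p = w * ((ch / (m * c))\<^sup>2 * (D + ((st p / ch)\<^sup>2 / c\<^sup>2 + (sz p / ch)\<^sup>2)) + (ch / (m * c))\<^sup>2 * \<bar>G\<bar> + 1)"
      unfolding conc_dens_polar[OF p] Gf using w
      by (simp add: D_def w_def abs_mult power_mult_distrib power_divide algebra_simps add_divide_distrib)
    also have "(st p / ch)\<^sup>2 / c\<^sup>2 + (sz p / ch)\<^sup>2 = ((st p)\<^sup>2 / c\<^sup>2 + (sz p)\<^sup>2) / ch\<^sup>2"
      by (simp add: power_divide add_divide_distrib)
    also have "(ch / (m * c))\<^sup>2 * (D + ((st p)\<^sup>2 / c\<^sup>2 + (sz p)\<^sup>2) / ch\<^sup>2)
        = ch\<^sup>2 * D / (m * c)\<^sup>2 + ((st p)\<^sup>2 / c\<^sup>2 + (sz p)\<^sup>2) / (m * c)\<^sup>2"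
    proof -
      have "(ch / (m * c))\<^sup>2 * (D + T / ch\<^sup>2) = ch\<^sup>2 * D / (m * c)\<^sup>2 + T / (m * c)\<^sup>2" for T
        using ch by (simp add: distrib_left power_divide)
      thus ?thesis .
    qed
    finally show ?thesis by (simp add: power_divide)
  qed
  have chD: "ch\<^sup>2 * D \<le> (m * c)\<^sup>2 / 2" "ch\<^sup>2 * \<bar>G\<bar> \<le> (m * c)\<^sup>2 / 2"
    using mult_left_mono[OF DL(1), of "ch\<^sup>2"] mult_left_mono[OF DL(2), of "ch\<^sup>2"] Lch by auto
  have half: "x / (m * c)\<^sup>2 \<le> 1 / 2" if "x \<le> (m * c)\<^sup>2 / 2" for x
    using that zero_less_power[OF mc(2), of 2] by (simp only: pos_divide_le_eq)
  show "0 \<le> conc_dens c m ch aa \<psi> p" unfolding cd using w D0 by (intro mult_nonneg_nonneg add_nonneg_nonneg) auto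
  show "conc_dens c m ch aa \<psi> p \<le> (2 + Sb b / (m * c)\<^sup>2) * (u p)\<^sup>2"
  proof -
    have "ch\<^sup>2 * D / (m * c)\<^sup>2 + ((st p)\<^sup>2 / c\<^sup>2 + (sz p)\<^sup>2) / (m * c)\<^sup>2 + ch\<^sup>2 * \<bar>G\<bar> / (m * c)\<^sup>2 + 1
      \<le> 1 / 2 + Sb b / (m * c)\<^sup>2 + 1 / 2 + 1"
      by (intro add_mono half chD divide_right_mono S1) auto
    hence "w * (ch\<^sup>2 * D / (m * c)\<^sup>2 + ((st p)\<^sup>2 / c\<^sup>2 + (sz p)\<^sup>2) / (m * c)\<^sup>2 + ch\<^sup>2 * \<bar>G\<bar> / (m * c)\<^sup>2 + 1)
      \<le> w * (2 + Sb b / (m * c)\<^sup>2)" using w by (intro mult_left_mono) auto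
    thus ?thesis unfolding cd w_def by (simp only: mult.commute)
  qed
  have en: "energy_density c m q ch aa \<phi> \<psi> p = w / (2 * m) * (ch\<^sup>2 * D + ((Phi p)\<^sup>2 / c\<^sup>2 + (sz p)\<^sup>2) - ch\<^sup>2 * G + (m * c)\<^sup>2)"
  proof -
    have "energy_density c m q ch aa \<phi> \<psi> p = ch\<^sup>2 / (2 * m) * (w * (D + ((Phi p / ch)\<^sup>2 / c\<^sup>2 + (sz p / ch)\<^sup>2) - G + (m * c / ch)\<^sup>2))"
      unfolding energy_density_polar[OF p] Gf
      by (simp add: D_def w_def power_mult_distrib power_divide algebra_simps add_divide_distrib)
    also have "D + ((Phi p / ch)\<^sup>2 / c\<^sup>2 + (sz p / ch)\<^sup>2) - G + (m * c / ch)\<^sup>2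
       = D + ((Phi p)\<^sup>2 / c\<^sup>2 + (sz p)\<^sup>2) / ch\<^sup>2 - G + (m * c)\<^sup>2 / ch\<^sup>2"
      by (simp add: power_divide add_divide_distrib)
    also have "\<dots> = (ch\<^sup>2 * D + ((Phi p)\<^sup>2 / c\<^sup>2 + (sz p)\<^sup>2) - ch\<^sup>2 * G + (m * c)\<^sup>2) / ch\<^sup>2"
      using ch by (simp add: add_divide_distrib diff_divide_distrib)
    finally show ?thesis using ch by simp
  qed
  have G2: "\<bar>ch\<^sup>2 * G\<bar> \<le> (m * c)\<^sup>2 / 2" using chD by (simp add: abs_mult)
  have P0: "0 \<le> (Phi p)\<^sup>2 / c\<^sup>2 + (sz p)\<^sup>2" by simp
  show "m * c\<^sup>2 / 4 * (u p)\<^sup>2 \<le> energy_density c m q ch aa \<phi> \<psi> p"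
  proof -
    have "(m * c)\<^sup>2 / 2 \<le> ch\<^sup>2 * D + ((Phi p)\<^sup>2 / c\<^sup>2 + (sz p)\<^sup>2) - ch\<^sup>2 * G + (m * c)\<^sup>2"
      using abs_le_D1[OF G2] P0 mult_nonneg_nonneg[OF zero_le_power2 D0, of ch] by linarith
    hence "w / (2 * m) * ((m * c)\<^sup>2 / 2) \<le> energy_density c m q ch aa \<phi> \<psi> p"
      unfolding en using w m by (intro mult_left_mono) auto
    moreover have "w / (2 * m) * ((m * c)\<^sup>2 / 2) = m * c\<^sup>2 / 4 * (u p)\<^sup>2"
      using m by (simp add: w_def power2_eq_square field_simps)
    ultimately show ?thesis by (simp only:)
  qed
  show "energy_density c m q ch aa \<phi> \<psi> p \<le> (m * c\<^sup>2 + Sb b / (2 * m)) * (u p)\<^sup>2"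
  proof -
    have "ch\<^sup>2 * D + ((Phi p)\<^sup>2 / c\<^sup>2 + (sz p)\<^sup>2) - ch\<^sup>2 * G + (m * c)\<^sup>2 \<le> 2 * (m * c)\<^sup>2 + Sb b"
      using G2 S2 chD(1) unfolding abs_le_iff by linarith
    hence "energy_density c m q ch aa \<phi> \<psi> p \<le> w / (2 * m) * (2 * (m * c)\<^sup>2 + Sb b)"
      unfolding en using w m by (intro mult_left_mono) auto
    also have "\<dots> = (m * c\<^sup>2 + Sb b / (2 * m)) * (u p)\<^sup>2"
      using m by (simp add: w_def power2_eq_square field_simps)
    finally show ?thesis .
  qed
qed

end

section \<open>The worldline\<close>

lemma ex_pderiv: "\<exists>Q. pderiv Q = (p :: real poly)"
proof
  have "pderiv (\<Sum>i\<le>degree p. monom (coeff p i / real (i + 1)) (i + 1)) = (\<Sum>i\<le>degree p. monom (coeff p i) i)"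
    using higher_pderiv_sum[of 1 "\<lambda>i. monom (coeff p i / real (i + 1)) (i + 1)" "{..degree p}"]
    by (simp add: pderiv_monom del: of_nat_Suc)
  thus "pderiv (\<Sum>i\<le>degree p. monom (coeff p i / real (i + 1)) (i + 1)) = p"
    by (simp only: poly_as_sum_of_monoms)
qed

lemma Weierstrass_poly:
  fixes f :: "real \<Rightarrow> real"
  assumes "continuous_on {a..b} f" "e > 0"
  obtains p where "\<And>x. x \<in> {a..b} \<Longrightarrow> \<bar>f x - poly p x\<bar> < e"
proof -
  obtain g where g: "real_polynomial_function g" "\<And>x. x \<in> {a..b} \<Longrightarrow> \<bar>f x - g x\<bar> < e"
    using Stone_Weierstrass_real_polynomial_function[OF compact_Icc assms] by blast
  from g(1) obtain k n where "g = (\<lambda>x. \<Sum>i\<le>n. k i * x ^ i)"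
    unfolding real_polynomial_function_iff_sum by blast
  hence "g x = poly (\<Sum>i\<le>n. monom (k i) i) x" for x by (simp add: poly_sum poly_monom)
  thus ?thesis using that[of "\<Sum>i\<le>n. monom (k i) i"] g(2) by auto
qed

lemma abs_diff_le_deriv_bound:
  fixes f :: "real \<Rightarrow> real"
  assumes d: "\<And>x. x \<in> {a..b} \<Longrightarrow> (f has_real_derivative f' x) (at x)"
    and b: "\<And>x. x \<in> {a..b} \<Longrightarrow> \<bar>f' x\<bar> \<le> B" and xy: "x \<in> {a..b}" "y \<in> {a..b}"
  shows "\<bar>f x - f y\<bar> \<le> B * \<bar>x - y\<bar>"
  using field_differentiable_bound[of "{a..b}" f f' B x y] d b xy
  by (auto intro: has_field_derivative_at_within)

lemma exp_diff_le: "x \<le> B \<Longrightarrow> y \<le> B \<Longrightarrow> \<bar>exp x - exp y\<bar> \<le> exp B * \<bar>x - y\<bar>" for x y B :: real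
  by (rule abs_diff_le_deriv_bound[of "min x y" "max x y" exp exp "exp B" x y]) auto

locale traj =
  fixes c Cv ep :: real and r v v1 v2 :: "real \<Rightarrow> real"
  assumes c: "c > 0" and ep: "0 \<le> ep" "ep < 1" and Cv: "Cv \<ge> 0"
    and r': "\<And>t. (r has_real_derivative v t) (at t)"
    and v': "\<And>t. (v has_real_derivative v1 t) (at t)"
    and v1': "\<And>t. (v1 has_real_derivative v2 t) (at t)"
    and v_le: "\<And>t. \<bar>v t\<bar> \<le> ep * c" and v1_le: "\<And>t. \<bar>v1 t\<bar> \<le> Cv" and v2_le: "\<And>t. \<bar>v2 t\<bar> \<le> Cv"
begin

text \<open>\<open>L\<close> is the logarithm of the Doppler factor, and \<open>l\<close> its derivative with respect to the light-cone
  parameter \<open>gt\<close>.\<close>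
definition "k1 = c * (1 - ep)"
definition "gt t = c * t - r t" for t
definition "L t = ln (c + v t) - ln (c - v t)" for t
definition "L1 t = v1 t * (inverse (c + v t) + inverse (c - v t))" for t
definition "l t = L1 t * inverse (c - v t)" for t
definition "l' t = (v2 t * (inverse (c + v t) + inverse (c - v t)) + v1 t * (v1 t * (inverse (c - v t))\<^sup>2 - v1 t * (inverse (c + v t))\<^sup>2)) * inverse (c - v t)
   + L1 t * (v1 t * (inverse (c - v t))\<^sup>2)" for t

lemma k1: "k1 > 0" using c ep by (simp add: k1_def)

lemma cv: "k1 \<le> c + v t" "k1 \<le> c - v t" "c + v t \<le> 2 * c" "c - v t \<le> 2 * c" "c + v t > 0" "c - v t > 0"
proof -
  have "ep * c \<le> 1 * c" using ep c by (intro mult_right_mono) auto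
  thus "c + v t \<le> 2 * c" "c - v t \<le> 2 * c" using v_le[of t] by auto
  show a: "k1 \<le> c + v t" and b: "k1 \<le> c - v t" using v_le[of t] by (auto simp: k1_def algebra_simps)
  show "c + v t > 0" "c - v t > 0" using a b k1 by auto
qed

lemma inv_le: "\<bar>inverse (c + v t)\<bar> \<le> inverse k1" "\<bar>inverse (c - v t)\<bar> \<le> inverse k1"
  using cv[of t] k1 by (auto intro!: le_imp_inverse_le)

lemma inv_deriv: "((\<lambda>t. inverse (c + v t)) has_real_derivative - v1 t * (inverse (c + v t))\<^sup>2) (at t)"
    "((\<lambda>t. inverse (c - v t)) has_real_derivative v1 t * (inverse (c - v t))\<^sup>2) (at t)"
proof -
  have n: "c + v t \<noteq> 0" "c - v t \<noteq> 0" using cv[of t] by auto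
  have d: "((\<lambda>t. c + v t) has_real_derivative v1 t) (at t)" "((\<lambda>t. c - v t) has_real_derivative - v1 t) (at t)"
    using v'[of t] by (auto intro!: derivative_eq_intros)
  show "((\<lambda>t. inverse (c + v t)) has_real_derivative - v1 t * (inverse (c + v t))\<^sup>2) (at t)"
    using DERIV_inverse_fun[OF d(1) n(1)] by (simp add: power2_eq_square)
  show "((\<lambda>t. inverse (c - v t)) has_real_derivative v1 t * (inverse (c - v t))\<^sup>2) (at t)"
    using DERIV_inverse_fun[OF d(2) n(2)] by (simp add: power2_eq_square)
qed

lemma gt_deriv: "(gt has_real_derivative c - v t) (at t)"
  unfolding gt_def[abs_def] using r'[of t] by (auto intro!: derivative_eq_intros)

lemma L_deriv: "(L has_real_derivative L1 t) (at t)"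
  unfolding L_def[abs_def] L1_def
  using v'[of t] cv[of t] by (auto intro!: derivative_eq_intros simp: field_simps)

lemma L1_deriv: "(L1 has_real_derivative v2 t * (inverse (c + v t) + inverse (c - v t))
    + v1 t * (v1 t * (inverse (c - v t))\<^sup>2 - v1 t * (inverse (c + v t))\<^sup>2)) (at t)"
  unfolding L1_def[abs_def]
  by (rule DERIV_cong[OF DERIV_mult[OF v1' DERIV_add[OF inv_deriv]]]) (simp add: algebra_simps)

lemma l_deriv: "(l has_real_derivative l' t) (at t)"
  unfolding l_def[abs_def] l'_def
  by (rule DERIV_cong[OF DERIV_mult[OF L1_deriv inv_deriv(2)]]) (simp add: algebra_simps)

definition "KL = Cv * (2 * inverse k1)"
definition "Kl = KL * inverse k1"
definition "Kl' = (Cv * (2 * inverse k1) + Cv * (2 * (Cv * (inverse k1)\<^sup>2))) * inverse k1 + KL * (Cv * (inverse k1)\<^sup>2)"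

lemma L1_le: "\<bar>L1 t\<bar> \<le> KL"
  unfolding L1_def KL_def
  by (intro abs_mult_le v1_le) (use inv_le[of t] in linarith)

lemma l_le: "\<bar>l t\<bar> \<le> Kl"
  unfolding l_def Kl_def by (intro abs_mult_le L1_le inv_le)

lemma l'_le: "\<bar>l' t\<bar> \<le> Kl'"
proof -
  have i2: "\<bar>(inverse (c + v t))\<^sup>2\<bar> \<le> (inverse k1)\<^sup>2" "\<bar>(inverse (c - v t))\<^sup>2\<bar> \<le> (inverse k1)\<^sup>2"
    unfolding power2_eq_square by (intro abs_mult_le inv_le)+
  have 1: "\<bar>inverse (c + v t) + inverse (c - v t)\<bar> \<le> 2 * inverse k1" using inv_le[of t] by linarith
  have "\<bar>v1 t * (inverse (c - v t))\<^sup>2\<bar> \<le> Cv * (inverse k1)\<^sup>2" "\<bar>v1 t * (inverse (c + v t))\<^sup>2\<bar> \<le> Cv * (inverse k1)\<^sup>2"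
    by (intro abs_mult_le v1_le i2)+
  hence 2: "\<bar>v1 t * (inverse (c - v t))\<^sup>2 - v1 t * (inverse (c + v t))\<^sup>2\<bar> \<le> 2 * (Cv * (inverse k1)\<^sup>2)" by linarith
  have tri: "\<bar>x + y\<bar> \<le> a + b" if "\<bar>x\<bar> \<le> a" "\<bar>y\<bar> \<le> b" for x y a b :: real using that by linarith
  show ?thesis unfolding l'_def Kl'_def
    by (intro tri abs_mult_le v2_le v1_le inv_le 1 2 L1_le i2)
qed

lemma L_lip: "\<bar>L s - L t\<bar> \<le> KL * \<bar>s - t\<bar>" and l_lip: "\<bar>l s - l t\<bar> \<le> Kl' * \<bar>s - t\<bar>"
  by (rule abs_diff_le_deriv_bound[of "min s t" "max s t"]; use L_deriv L1_le l_deriv l'_le in auto)+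

lemma r_lip: "\<bar>r s - r t\<bar> \<le> ep * c * \<bar>s - t\<bar>"
  by (rule abs_diff_le_deriv_bound[of "min s t" "max s t" r v]; use r' v_le in auto)

lemma gt_strict: "s < t \<Longrightarrow> gt s < gt t"
  by (rule DERIV_pos_imp_increasing) (use gt_deriv cv in blast)+

text \<open>The gap between \<open>c\<close> and the speed bound \<open>ep * c\<close> prevents the
  light-cone parameter from compressing time intervals by more than the factor
  \<open>k1\<close>.\<close>

lemma gt_expand: "k1 * \<bar>s - t\<bar> \<le> \<bar>gt s - gt t\<bar>"
proof -
  have "\<bar>c * (s - t)\<bar> \<le> \<bar>gt s - gt t\<bar> + \<bar>r s - r t\<bar>" by (simp add: gt_def algebra_simps)
  moreover have "\<bar>c * (s - t)\<bar> = c * \<bar>s - t\<bar>" using c by (simp add: abs_mult)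
  ultimately show ?thesis using r_lip[of s t] by (simp add: k1_def algebra_simps)
qed

lemma gt_onto: "a \<le> b \<Longrightarrow> x \<in> {gt a..gt b} \<Longrightarrow> \<exists>t\<in>{a..b}. gt t = x"
  using IVT[of gt a x b] gt_deriv DERIV_isCont by fastforce

definition "LB = ln (2 * c / k1)"

lemma exp_L: "exp (L t) = (c + v t) / (c - v t)"
  using cv[of t] by (simp add: L_def exp_diff)

lemma L_abs: "\<bar>L t\<bar> \<le> LB"
proof -
  have "ln (c + v t) \<le> ln (2 * c)" "ln (c - v t) \<le> ln (2 * c)" "ln k1 \<le> ln (c + v t)" "ln k1 \<le> ln (c - v t)"
    using cv[of t] k1 c by auto
  moreover have "LB = ln (2 * c) - ln k1" using k1 c by (simp add: LB_def ln_div)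
  ultimately show ?thesis by (simp add: L_def abs_le_iff)
qed

text \<open>Weierstrass' theorem is applied to the derivative \<open>l\<close>, regarded as a
  function of the parameter \<open>gt\<close>, and \<open>P\<close> is the primitive that agrees
  with \<open>L\<close> at the left endpoint. Value and derivative are then approximated
  together.\<close>

lemma poly_approx:
  assumes ab: "a < b" and e: "e > 0"
  obtains P where "\<And>t. t \<in> {a..b} \<Longrightarrow> \<bar>poly P (gt t) - L t\<bar> \<le> e"
    "\<And>t. t \<in> {a..b} \<Longrightarrow> \<bar>poly (pderiv P) (gt t) - l t\<bar> \<le> e"
proof -
  \<comment> \<open>Integrating an error \<open>e'\<close> over the interval, with \<open>gt\<close>
    growing at rate at most \<open>2 * c\<close>, must not exceed \<open>e\<close>.\<close>
  define e' where "e' = min e (e / (2 * c * (b - a)))"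
  have cba: "2 * c * (b - a) > 0" using c ab by simp
  have e': "e' > 0" "e' \<le> e" using e cba by (auto simp: e'_def)
  have e'': "2 * c * (b - a) * e' \<le> e"
  proof -
    have "e' \<le> e / (2 * c * (b - a))" by (simp add: e'_def)
    thus ?thesis using cba by (simp add: pos_le_divide_eq mult.commute)
  qed
  have inj: "inj_on gt {a..b}" by (rule strict_mono_on_imp_inj_on) (auto intro!: strict_mono_onI gt_strict)
  have gc: "continuous_on {a..b} gt"
    using gt_deriv DERIV_isCont by (blast intro: continuous_at_imp_continuous_on)
  have img: "gt ` {a..b} = {gt a..gt b}"
  proof (intro equalityI subsetI)
    fix x assume "x \<in> gt ` {a..b}"
    then obtain t where "x = gt t" "t \<in> {a..b}" by blast
    thus "x \<in> {gt a..gt b}" using gt_strict[of a t] gt_strict[of t b] by (cases "a = t"; cases "t = b"; auto)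
  next
    fix x assume "x \<in> {gt a..gt b}"
    thus "x \<in> gt ` {a..b}" using gt_onto[of a b x] ab by auto
  qed
  define gi where "gi = inv_into {a..b} gt"
  have gi: "gi (gt t) = t" if "t \<in> {a..b}" for t using inv_into_f_f[OF inj that] by (simp add: gi_def)
  have gic: "continuous_on {gt a..gt b} gi"
    using continuous_on_inv[OF gc compact_Icc, of gi] gi img by auto
  have "continuous_on {gt a..gt b} (\<lambda>x. l (gi x))"
  proof (rule continuous_on_compose2[OF _ gic])
    show "continuous_on UNIV l" using l_deriv DERIV_isCont by (blast intro: continuous_at_imp_continuous_on)
  qed auto
  from Weierstrass_poly[OF this e'(1)] obtain p where p: "\<And>x. x \<in> {gt a..gt b} \<Longrightarrow> \<bar>l (gi x) - poly p x\<bar> < e'" by blast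
  obtain Q where Q: "pderiv Q = p" using ex_pderiv by blast
  define P where "P = Q + [:L a - poly Q (gt a):]"
  have P': "pderiv P = p" by (simp add: P_def Q pderiv_add pderiv_pCons)
  have 1: "\<bar>poly (pderiv P) (gt t) - l t\<bar> \<le> e'" if "t \<in> {a..b}" for t
    using p[of "gt t"] gi[OF that] img that by (force simp: P' abs_minus_commute)
  have 2: "\<bar>poly P (gt t) - L t\<bar> \<le> e" if t: "t \<in> {a..b}" for t
  proof -
    have D: "((\<lambda>t. poly P (gt t) - L t) has_real_derivative poly (pderiv P) (gt t) * (c - v t) - L1 t) (at t)" for t
      by (intro DERIV_diff L_deriv DERIV_chain2[OF poly_DERIV gt_deriv])
    have eq: "poly (pderiv P) (gt t) * (c - v t) - L1 t = (poly (pderiv P) (gt t) - l t) * (c - v t)" for t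
    proof -
      have "c - v t \<noteq> 0" using cv[of t] by linarith
      hence "L1 t * inverse (c - v t) * (c - v t) = L1 t" by (metis left_inverse mult.assoc mult_1_right)
      thus ?thesis by (simp only: l_def left_diff_distrib)
    qed
    have "\<bar>(poly P (gt t) - L t) - (poly P (gt a) - L a)\<bar> \<le> e' * (2 * c) * \<bar>t - a\<bar>"
    proof (rule abs_diff_le_deriv_bound[OF D])
      show "\<bar>poly (pderiv P) (gt x) * (c - v x) - L1 x\<bar> \<le> e' * (2 * c)" if "x \<in> {a..b}" for x
        unfolding eq by (intro abs_mult_le 1 that) (use cv[of x] in simp)
    qed (use t ab in auto)
    also have "\<dots> \<le> e' * (2 * c) * (b - a)" using t e' c by (intro mult_left_mono) auto
    also have "\<dots> \<le> e" using e'' by (simp add: mult_ac)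
    finally show ?thesis by (simp add: P_def)
  qed
  show ?thesis by (rule that[OF 2]) (use 1 e'(2) in \<open>auto intro: order_trans\<close>)
qed

text \<open>Along the worldline \<open>r t + c t\<close> has derivative \<open>exp (L t)\<close>
  with respect to \<open>gt t\<close>. The primitive \<open>\<alpha>\<close> of \<open>exp P\<close>
  therefore nearly maps \<open>gt t\<close> to \<open>r t + c t\<close>, and its inverse
  \<open>X\<close> makes \<open>y = X(z + c t) + (z - c t)\<close> nearly vanish at
  \<open>z = r t\<close>.\<close>

lemma geometry_interval:
  assumes ab: "a < b" and e: "0 < e" "e \<le> 1"
  obtains P \<alpha> X where
    "\<And>t. t \<in> {a..b} \<Longrightarrow> \<bar>poly P (gt t) - L t\<bar> \<le> e"
    "\<And>t. t \<in> {a..b} \<Longrightarrow> \<bar>poly (pderiv P) (gt t) - l t\<bar> \<le> e"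
    "\<And>t. t \<in> {a..b} \<Longrightarrow> \<bar>\<alpha> (gt t) - (r t + c * t)\<bar> \<le> exp (LB + 1) * (2 * c) * (b - a) * e"
    "\<alpha> (gt a) = r a + c * a"
    "\<And>x. X (\<alpha> x) = x"
    "\<And>\<xi>. \<alpha> (gt a) < \<xi> \<Longrightarrow> \<xi> < \<alpha> (gt b) \<Longrightarrow> \<exists>t\<in>{a..b}. X \<xi> = gt t"
    "\<And>\<xi>. \<alpha> (gt a) < \<xi> \<Longrightarrow> \<xi> < \<alpha> (gt b) \<Longrightarrow> (X has_real_derivative exp (- poly P (X \<xi>))) (at \<xi>)"
    "\<And>s t. s < t \<Longrightarrow> \<alpha> (gt s) < \<alpha> (gt t)"
proof -
  obtain P where P: "\<And>t. t \<in> {a..b} \<Longrightarrow> \<bar>poly P (gt t) - L t\<bar> \<le> e"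
    "\<And>t. t \<in> {a..b} \<Longrightarrow> \<bar>poly (pderiv P) (gt t) - l t\<bar> \<le> e"
    using poly_approx[OF ab e(1)] by blast
  obtain E where E: "\<And>x. (E has_real_derivative exp (poly P x)) (at x)"
    using real_entire_primitive[OF real_entire_exp[OF real_entire_poly]] by blast
  define \<alpha> where "\<alpha> x = r a + c * a + (E x - E (gt a))" for x
  have \<alpha>': "(\<alpha> has_real_derivative exp (poly P x)) (at x)" for x
    unfolding \<alpha>_def[abs_def] using E[of x] by (auto intro!: derivative_eq_intros)
  have inc: "\<alpha> x < \<alpha> y" if "x < y" for x y
    by (rule DERIV_pos_imp_increasing[OF that], intro exI conjI, rule \<alpha>') simp
  have inj: "inj \<alpha>" by (rule injI) (metis inc less_irrefl linorder_neqE_linordered_idom)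
  define X where "X = inv \<alpha>"
  have X\<alpha>: "X (\<alpha> x) = x" for x using inj by (simp add: X_def)
  have onto: "\<exists>x. gt a < x \<and> x < gt b \<and> \<alpha> x = \<xi>" if "\<alpha> (gt a) < \<xi>" "\<xi> < \<alpha> (gt b)" for \<xi>
  proof -
    have "\<exists>x\<ge>gt a. x \<le> gt b \<and> \<alpha> x = \<xi>"
      by (rule IVT) (use that gt_strict[OF ab] DERIV_isCont[OF \<alpha>'] in \<open>auto intro: less_imp_le\<close>)
    then obtain x where "gt a \<le> x" "x \<le> gt b" "\<alpha> x = \<xi>" by blast
    thus ?thesis using that by (intro exI[of _ x]) (auto simp: less_le)
  qed
  show ?thesis
  proof (rule that[of P \<alpha> X])
    show "\<bar>poly P (gt t) - L t\<bar> \<le> e" "\<bar>poly (pderiv P) (gt t) - l t\<bar> \<le> e" if "t \<in> {a..b}" for t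
      using P that by auto
    show "\<alpha> (gt a) = r a + c * a" by (simp add: \<alpha>_def)
    show "X (\<alpha> x) = x" for x by (rule X\<alpha>)
    show "\<alpha> (gt s) < \<alpha> (gt t)" if "s < t" for s t using inc gt_strict that by blast
    show "\<exists>t\<in>{a..b}. X \<xi> = gt t" if \<xi>: "\<alpha> (gt a) < \<xi>" "\<xi> < \<alpha> (gt b)" for \<xi>
    proof -
      obtain x where "gt a < x" "x < gt b" "\<alpha> x = \<xi>" using onto[OF \<xi>] by blast
      thus ?thesis using gt_onto[of a b x] ab X\<alpha> by force
    qed
    show "(X has_real_derivative exp (- poly P (X \<xi>))) (at \<xi>)" if \<xi>: "\<alpha> (gt a) < \<xi>" "\<xi> < \<alpha> (gt b)" for \<xi>
    proof -
      obtain x where x: "gt a < x" "x < gt b" "\<alpha> x = \<xi>" using onto[OF \<xi>] by blast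
      have "isCont X (\<alpha> x)"
        by (rule isCont_inverse_function2[OF x(1,2)]) (rule X\<alpha>, rule DERIV_isCont[OF \<alpha>'])
      hence cont: "isCont X \<xi>" using x(3) by simp
      have "(X has_real_derivative inverse (exp (poly P (X \<xi>)))) (at \<xi>)"
      proof (rule DERIV_inverse_function[OF \<alpha>' _ \<xi> _ cont])
        fix y assume "\<alpha> (gt a) < y" "y < \<alpha> (gt b)"
        from onto[OF this] obtain x where "\<alpha> x = y" by blast
        thus "\<alpha> (X y) = y" using X\<alpha>[of x] by simp
      qed simp
      thus ?thesis by (simp add: exp_minus)
    qed
    fix t assume t: "t \<in> {a..b}"
    have D: "((\<lambda>t. \<alpha> (gt t) - (r t + c * t)) has_real_derivative exp (poly P (gt s)) * (c - v s) - (v s + c)) (at s)" for s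
      by (rule DERIV_diff[OF DERIV_chain2[OF \<alpha>' gt_deriv]]) (use r'[of s] in \<open>auto intro!: derivative_eq_intros\<close>)
    \<comment> \<open>The exact relation \<open>exp (L s) * (c - v s) = v s + c\<close> reduces the
      derivative of the discrepancy to the difference of two exponentials.\<close>
    have B: "\<bar>exp (poly P (gt s)) * (c - v s) - (v s + c)\<bar> \<le> (exp (LB + 1) * e) * (2 * c)" if s: "s \<in> {a..b}" for s
    proof -
      have "exp (L s) * (c - v s) = v s + c" using cv[of s] by (simp add: exp_L)
      hence eq: "exp (poly P (gt s)) * (c - v s) - (v s + c) = (exp (poly P (gt s)) - exp (L s)) * (c - v s)"
        by (simp only: left_diff_distrib)
      have "\<bar>exp (poly P (gt s)) - exp (L s)\<bar> \<le> exp (LB + 1) * \<bar>poly P (gt s) - L s\<bar>"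
        by (rule exp_diff_le) (use P(1)[OF s] L_abs[of s] e in linarith)+
      also have "\<dots> \<le> exp (LB + 1) * e" by (intro mult_left_mono P s) auto
      finally show ?thesis unfolding eq by (intro abs_mult_le) (use cv[of s] in auto)
    qed
    have "\<bar>(\<alpha> (gt t) - (r t + c * t)) - (\<alpha> (gt a) - (r a + c * a))\<bar> \<le> (exp (LB + 1) * e) * (2 * c) * \<bar>t - a\<bar>"
      by (rule abs_diff_le_deriv_bound[OF D B]) (use t ab in auto)
    also have "\<dots> \<le> (exp (LB + 1) * e) * (2 * c) * (b - a)" using t e c by (intro mult_left_mono) auto
    finally show "\<bar>\<alpha> (gt t) - (r t + c * t)\<bar> \<le> exp (LB + 1) * (2 * c) * (b - a) * e"
      by (simp add: \<alpha>_def mult_ac)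
  qed
qed

text \<open>The order of the quantifiers is the point: the slab and the bounds \<open>b\<close>,
  \<open>K\<close>, \<open>N\<close> are fixed first, and only the polynomial and the functions
  derived from it depend on the scales \<open>aa\<close> and \<open>R\<close>.\<close>

lemma geometry:
  assumes T: "Tm < Tp" and m: "m > 0" and q: "q \<noteq> 0"
  obtains T1 T2 Z1 Z2 z0 b K N where "T1 < Tm" "Tp < T2" "\<And>t. t \<in> {Tm..Tp} \<Longrightarrow> z0 < r t - 1 \<and> r t + 1 < Z2"
    "b \<ge> 0" "K \<ge> 0" "N \<ge> 1"
    "\<And>aa R. 0 < aa \<Longrightarrow> aa \<le> R \<Longrightarrow> R \<le> 1 \<Longrightarrow> \<exists>t0 t1 y0 y1 P X H.
       field t0 t1 y0 y1 c m q aa P X H T1 T2 Z1 Z2 z0 \<and>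
       (\<forall>t\<in>{T1<..<T2}. \<forall>z\<in>{Z1<..<Z2}. \<bar>poly P (X (z + c * t))\<bar> \<le> b \<and> \<bar>poly (pderiv P) (X (z + c * t))\<bar> \<le> N) \<and>
       (\<forall>t\<in>{Tm..Tp}. \<forall>z. \<bar>z - r t\<bar> \<le> R \<longrightarrow>
          \<bar>poly P (X (z + c * t)) - L t\<bar> \<le> K * R \<and> \<bar>poly (pderiv P) (X (z + c * t)) - l t\<bar> \<le> K * R \<and>
          \<bar>z - r t\<bar> - aa \<le> \<bar>X (z + c * t) + (z - c * t)\<bar> \<and>
          \<bar>X (z + c * t) + (z - c * t)\<bar> \<le> (1 + exp b) * \<bar>z - r t\<bar> + aa)"
proof -
  define TT where "TT = \<bar>Tm\<bar> + \<bar>Tp\<bar> + 1"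
  \<comment> \<open>\<open>\<bar>r 0\<bar> + c * TT\<close> bounds the trajectory on the times
    considered; the extra 3 leaves room for a tube of radius 1 and for the level
    \<open>1 - ZZ\<close> at which the integrals start.\<close>
  define ZZ where "ZZ = \<bar>r 0\<bar> + c * TT + 3"
  define XI where "XI = ZZ + c * TT"
  \<comment> \<open>On the interval from \<open>- bb\<close> to \<open>bb\<close> the quantity
    \<open>r t + c t\<close> sweeps past \<open>\<plusminus> XI\<close> with a margin of 2, so that
    \<open>X\<close> is controlled at \<open>z + c t\<close> for every point of the slab.\<close>
  define bb where "bb = (XI + \<bar>r 0\<bar> + 2) / k1 + TT"
  define b where "b = LB + 1"
  \<comment> \<open>If \<open>X(z + c t) = gt s\<close>, then \<open>\<bar>s - t\<bar>\<close> is at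
    most \<open>2 * exp b / k1 * R\<close>. The Lipschitz constants of \<open>L\<close> and
    \<open>l\<close> convert this into an error, and the summand 1 pays for the polynomial
    approximation.\<close>
  define K where "K = 1 + (KL + Kl') * (2 * exp b / k1)"
  define N where "N = Kl + 1"
  define Kh where "Kh = exp (LB + 1) * (2 * c) * (bb - (- bb))"
  have TT: "TT \<ge> 1" by (simp add: TT_def)
  have cT: "0 < c * TT" using c TT by simp
  have XI: "XI > 0" using cT unfolding XI_def ZZ_def by linarith
  have bb: "bb \<ge> TT" "k1 * bb \<ge> XI + \<bar>r 0\<bar> + 2"
  proof -
    have "(XI + \<bar>r 0\<bar> + 2) / k1 \<ge> 0" using k1 XI by simp
    thus "bb \<ge> TT" by (simp add: bb_def)
    have "k1 * (W / k1 + TT) = W + k1 * TT" for W using k1 by (simp add: distrib_left)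
    hence "k1 * bb = (XI + \<bar>r 0\<bar> + 2) + k1 * TT" by (simp only: bb_def)
    thus "k1 * bb \<ge> XI + \<bar>r 0\<bar> + 2" using mult_nonneg_nonneg[of k1 TT] k1 TT by linarith
  qed
  have bb0: "- bb < bb" using bb TT by simp
  have LB0: "LB \<ge> 0" using L_abs[of 0] by linarith
  have b0: "b \<ge> 0" using LB0 by (simp add: b_def)
  have nn: "KL \<ge> 0" "Kl \<ge> 0" "Kl' \<ge> 0" using L1_le[of 0] l_le[of 0] l'_le[of 0] by linarith+
  have Kh0: "Kh \<ge> 0" using c bb0 by (simp add: Kh_def)
  have r_le: "\<bar>r t\<bar> \<le> \<bar>r 0\<bar> + c * TT" if "\<bar>t\<bar> \<le> TT" for t
  proof -
    have "\<bar>r t - r 0\<bar> \<le> ep * c * \<bar>t - 0\<bar>" by (rule r_lip)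
    also have "\<dots> \<le> 1 * c * TT" using ep c that by (intro mult_mono) auto
    finally show ?thesis by linarith
  qed
  have endpts: "r (- bb) + c * (- bb) \<le> - XI - 2" "r bb + c * bb \<ge> XI + 2"
  proof -
    have "\<bar>r (- bb) - r 0\<bar> \<le> ep * c * bb" "\<bar>r bb - r 0\<bar> \<le> ep * c * bb"
      using r_lip[of "- bb" 0] r_lip[of bb 0] bb TT by auto
    moreover have "k1 * bb = c * bb - ep * c * bb" by (simp add: k1_def algebra_simps)
    ultimately show "r (- bb) + c * (- bb) \<le> - XI - 2" "r bb + c * bb \<ge> XI + 2"
      using bb(2) by auto
  qed
  have main: "\<exists>t0 t1 y0 y1 P X H.
       field t0 t1 y0 y1 c m q aa P X H (Tm - 1) (Tp + 1) (- ZZ) ZZ (1 - ZZ) \<and>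
       (\<forall>t\<in>{Tm - 1<..<Tp + 1}. \<forall>z\<in>{- ZZ<..<ZZ}. \<bar>poly P (X (z + c * t))\<bar> \<le> b \<and> \<bar>poly (pderiv P) (X (z + c * t))\<bar> \<le> N) \<and>
       (\<forall>t\<in>{Tm..Tp}. \<forall>z. \<bar>z - r t\<bar> \<le> R \<longrightarrow>
          \<bar>poly P (X (z + c * t)) - L t\<bar> \<le> K * R \<and> \<bar>poly (pderiv P) (X (z + c * t)) - l t\<bar> \<le> K * R \<and>
          \<bar>z - r t\<bar> - aa \<le> \<bar>X (z + c * t) + (z - c * t)\<bar> \<and>
          \<bar>X (z + c * t) + (z - c * t)\<bar> \<le> (1 + exp b) * \<bar>z - r t\<bar> + aa)"
    if aa: "0 < aa" "aa \<le> R" and R: "R \<le> 1" for aa R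
  proof -
    \<comment> \<open>The discrepancy of \<open>\<alpha>\<close> stays below \<open>aa\<close> even
      after multiplication by the Lipschitz constant \<open>exp b\<close> of \<open>X\<close>; the
      worldline thus lies within \<open>aa\<close> of \<open>y = 0\<close>.\<close>
    define e where "e = min R (aa / (exp b * Kh + 1))"
    have den: "exp b * Kh + 1 > 0" using Kh0 by (simp add: add_nonneg_pos)
    have e: "0 < e" "e \<le> R" "e \<le> 1" using aa R den by (auto simp: e_def)
    have eK: "exp b * (Kh * e) \<le> aa"
    proof -
      have "e \<le> aa / (exp b * Kh + 1)" by (simp add: e_def)
      hence "e * (exp b * Kh + 1) \<le> aa" using den by (simp add: pos_le_divide_eq)
      thus ?thesis using e by (simp add: algebra_simps)
    qed
    have hsmall: "Kh * e \<le> aa"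
    proof -
      have "1 * (Kh * e) \<le> exp b * (Kh * e)" using Kh0 e b0 by (intro mult_right_mono) auto
      thus ?thesis using eK by simp
    qed
    obtain P \<alpha> X where G:
      "\<And>t. t \<in> {- bb..bb} \<Longrightarrow> \<bar>poly P (gt t) - L t\<bar> \<le> e"
      "\<And>t. t \<in> {- bb..bb} \<Longrightarrow> \<bar>poly (pderiv P) (gt t) - l t\<bar> \<le> e"
      "\<And>t. t \<in> {- bb..bb} \<Longrightarrow> \<bar>\<alpha> (gt t) - (r t + c * t)\<bar> \<le> exp (LB + 1) * (2 * c) * (bb - (- bb)) * e"
      "\<alpha> (gt (- bb)) = r (- bb) + c * (- bb)"
      "\<And>x. X (\<alpha> x) = x"
      "\<And>\<xi>. \<alpha> (gt (- bb)) < \<xi> \<Longrightarrow> \<xi> < \<alpha> (gt bb) \<Longrightarrow> \<exists>t\<in>{- bb..bb}. X \<xi> = gt t"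
      "\<And>\<xi>. \<alpha> (gt (- bb)) < \<xi> \<Longrightarrow> \<xi> < \<alpha> (gt bb) \<Longrightarrow> (X has_real_derivative exp (- poly P (X \<xi>))) (at \<xi>)"
      "\<And>s t. s < t \<Longrightarrow> \<alpha> (gt s) < \<alpha> (gt t)"
      using geometry_interval[OF bb0 e(1,3)] by blast
    have h: "\<bar>\<alpha> (gt t) - (r t + c * t)\<bar> \<le> Kh * e" if "t \<in> {- bb..bb}" for t
      using G(3)[OF that] by (simp only: Kh_def)
    have lo: "\<alpha> (gt (- bb)) < - XI" using G(4) endpts(1) by linarith
    have hi: "\<alpha> (gt bb) > XI" using h[of bb] endpts(2) hsmall aa R bb TT by auto
    have dom: "\<alpha> (gt (- bb)) < \<xi>" "\<xi> < \<alpha> (gt bb)" if "\<bar>\<xi>\<bar> \<le> XI" for \<xi>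
      using that lo hi by auto
    have xi: "\<bar>z + c * t\<bar> \<le> XI" "\<bar>z - c * t\<bar> \<le> XI" if "\<bar>z\<bar> \<le> ZZ" "\<bar>t\<bar> \<le> TT" for z t
    proof -
      have "\<bar>c * t\<bar> \<le> c * TT" using that(2) c by (simp add: abs_mult)
      thus "\<bar>z + c * t\<bar> \<le> XI" "\<bar>z - c * t\<bar> \<le> XI" using that(1) by (auto simp: XI_def)
    qed
    have Pb: "\<bar>poly P (X \<xi>)\<bar> \<le> b" "\<bar>poly (pderiv P) (X \<xi>)\<bar> \<le> N"
      if \<xi>: "\<alpha> (gt (- bb)) < \<xi>" "\<xi> < \<alpha> (gt bb)" for \<xi>
    proof -
      obtain t where t: "t \<in> {- bb..bb}" "X \<xi> = gt t" using G(6)[OF \<xi>] by blast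
      show "\<bar>poly P (X \<xi>)\<bar> \<le> b" using G(1)[OF t(1)] L_abs[of t] e by (simp add: t b_def)
      show "\<bar>poly (pderiv P) (X \<xi>)\<bar> \<le> N" using G(2)[OF t(1)] l_le[of t] e by (simp add: t N_def)
    qed
    have X_lip: "\<bar>X x - X y\<bar> \<le> exp b * \<bar>x - y\<bar>"
      if "\<alpha> (gt (- bb)) < x" "x < \<alpha> (gt bb)" "\<alpha> (gt (- bb)) < y" "y < \<alpha> (gt bb)" for x y
    proof (rule abs_diff_le_deriv_bound[of "min x y" "max x y" X "\<lambda>\<xi>. exp (- poly P (X \<xi>))"])
      fix \<xi> assume "\<xi> \<in> {min x y..max x y}"
      hence \<xi>: "\<alpha> (gt (- bb)) < \<xi>" "\<xi> < \<alpha> (gt bb)" using that by (auto simp: min_def max_def split: if_splits)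
      show "(X has_real_derivative exp (- poly P (X \<xi>))) (at \<xi>)" by (rule G(7)[OF \<xi>])
      show "\<bar>exp (- poly P (X \<xi>))\<bar> \<le> exp b" using Pb(1)[OF \<xi>] by auto
    qed auto
    have X_mono: "X x \<le> X y"
      if "\<alpha> (gt (- bb)) < x" "y < \<alpha> (gt bb)" "x \<le> y" for x y
    proof (cases "x = y")
      case False
      show ?thesis
      proof (rule DERIV_nonneg_imp_nondecreasing[OF that(3)], intro exI conjI)
        fix \<xi> assume "x \<le> \<xi>" "\<xi> \<le> y"
        thus "(X has_real_derivative exp (- poly P (X \<xi>))) (at \<xi>)" using that by (intro G(7)) auto
      qed simp
    qed simp
    obtain H where H: "\<And>x. (H has_real_derivative sinh (poly P x / 2) * exp (poly P x)) (at x)"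
    proof -
      have "real_entire (\<lambda>x. 1/2 * (exp (1/2 * poly P x) + (-1) * exp (-1/2 * poly P x)) * exp (poly P x))"
        by (intro real_entire_mult real_entire_add real_entire_exp real_entire_const real_entire_poly)
      from real_entire_primitive[OF this] obtain H where
        "\<And>x. (H has_real_derivative 1/2 * (exp (1/2 * poly P x) + (-1) * exp (-1/2 * poly P x)) * exp (poly P x)) (at x)" by blast
      thus ?thesis by (intro that[of H]) (simp add: sinh_def)
    qed
    have tTT: "\<bar>t\<bar> \<le> TT" if "t \<in> {Tm - 1<..<Tp + 1}" for t using that by (auto simp: TT_def)
    define BB where "BB = \<bar>gt (- bb)\<bar> + \<bar>gt bb\<bar> + XI + 1"
    have "field (- BB) BB (- BB) BB c m q aa P X H (Tm - 1) (Tp + 1) (- ZZ) ZZ (1 - ZZ)"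
    proof unfold_locales
      fix t z assume t: "t \<in> {Tm - 1<..<Tp + 1}" and z: "z \<in> {- ZZ<..<ZZ}"
      have xz: "\<bar>z + c * t\<bar> \<le> XI" "\<bar>z - c * t\<bar> \<le> XI" using xi[of z t] z tTT[OF t] by auto
      show "(X has_real_derivative exp (- poly P (X (z + c * t)))) (at (z + c * t))"
        by (rule G(7)[OF dom[OF xz(1)]])
      obtain s where s: "s \<in> {- bb..bb}" "X (z + c * t) = gt s" using G(6)[OF dom[OF xz(1)]] by blast
      have "gt (- bb) \<le> gt s" "gt s \<le> gt bb"
        using gt_strict[of "- bb" s] gt_strict[of s bb] s by (cases "s = - bb"; cases "s = bb"; force)+
      thus "X (z + c * t) - (z - c * t) \<in> {- BB<..<BB} \<and> X (z + c * t) + (z - c * t) \<in> {- BB<..<BB}"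
        using xz(2) s(2) by (auto simp: BB_def)
    qed (use c m q aa H XI in \<open>auto simp: BB_def\<close>)
    moreover have "\<bar>poly P (X (z + c * t))\<bar> \<le> b \<and> \<bar>poly (pderiv P) (X (z + c * t))\<bar> \<le> N"
      if "t \<in> {Tm - 1<..<Tp + 1}" "z \<in> {- ZZ<..<ZZ}" for t z
      using Pb[OF dom[OF xi(1)[of z t]]] that tTT[of t] by auto
    moreover have "\<bar>poly P (X (z + c * t)) - L t\<bar> \<le> K * R \<and> \<bar>poly (pderiv P) (X (z + c * t)) - l t\<bar> \<le> K * R \<and>
          \<bar>z - r t\<bar> - aa \<le> \<bar>X (z + c * t) + (z - c * t)\<bar> \<and>
          \<bar>X (z + c * t) + (z - c * t)\<bar> \<le> (1 + exp b) * \<bar>z - r t\<bar> + aa"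
      if t: "t \<in> {Tm..Tp}" and z: "\<bar>z - r t\<bar> \<le> R" for t z
    proof -
      have tt: "\<bar>t\<bar> \<le> TT" "t \<in> {- bb..bb}" "- bb < t" "t < bb" using t bb TT by (auto simp: TT_def)
      have "\<bar>z\<bar> \<le> ZZ" "\<bar>r t\<bar> \<le> ZZ" using r_le[OF tt(1)] z R by (auto simp: ZZ_def)
      hence d1: "\<bar>z + c * t\<bar> \<le> XI" and d2: "\<bar>r t + c * t\<bar> \<le> XI" using xi tt by auto
      have d3: "\<alpha> (gt (- bb)) < \<alpha> (gt t)" "\<alpha> (gt t) < \<alpha> (gt bb)" using G(8) tt by auto
      have ht: "\<bar>\<alpha> (gt t) - (r t + c * t)\<bar> \<le> Kh * e" by (rule h[OF tt(2)])
      obtain s where s: "s \<in> {- bb..bb}" "X (z + c * t) = gt s" using G(6)[OF dom[OF d1]] by blast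
      have "k1 * \<bar>s - t\<bar> \<le> \<bar>gt s - gt t\<bar>" by (rule gt_expand)
      also have "\<dots> = \<bar>X (z + c * t) - X (\<alpha> (gt t))\<bar>" by (simp add: s G(5))
      also have "\<dots> \<le> exp b * \<bar>(z + c * t) - \<alpha> (gt t)\<bar>" by (rule X_lip[OF dom[OF d1] d3])
      also have "\<dots> \<le> exp b * (2 * R)" using ht z hsmall aa by (intro mult_left_mono) auto
      finally have st: "\<bar>s - t\<bar> \<le> 2 * exp b / k1 * R" using k1 by (simp add: field_simps)
      have lipbound: "D * \<bar>s - t\<bar> + e \<le> K * R" if "0 \<le> D" "D \<le> KL + Kl'" for D
      proof -
        have "D * \<bar>s - t\<bar> \<le> (KL + Kl') * (2 * exp b / k1 * R)" using that st nn by (intro mult_mono) auto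
        moreover have "K * R = R + (KL + Kl') * (2 * exp b / k1 * R)"
          by (simp only: K_def distrib_right mult_1_left mult.assoc)
        ultimately show ?thesis using e(2) by linarith
      qed
      have A1: "\<bar>poly P (X (z + c * t)) - L t\<bar> \<le> K * R"
        unfolding s(2) using G(1)[OF s(1)] L_lip[of s t] lipbound[of KL] nn by linarith
      have A2: "\<bar>poly (pderiv P) (X (z + c * t)) - l t\<bar> \<le> K * R"
        unfolding s(2) using G(2)[OF s(1)] l_lip[of s t] lipbound[of Kl'] nn by linarith
      define yc where "yc = X (r t + c * t) + (r t - c * t)"
      have "\<bar>yc\<bar> = \<bar>X (r t + c * t) - X (\<alpha> (gt t))\<bar>" by (simp add: yc_def G(5) gt_def algebra_simps)
      also have "\<dots> \<le> exp b * \<bar>(r t + c * t) - \<alpha> (gt t)\<bar>" by (rule X_lip[OF dom[OF d2] d3])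
      also have "\<dots> \<le> exp b * (Kh * e)" using ht by (intro mult_left_mono) auto
      finally have yc: "\<bar>yc\<bar> \<le> aa" using eK by linarith
      define dX where "dX = X (z + c * t) - X (r t + c * t)"
      have y: "X (z + c * t) + (z - c * t) = yc + (dX + (z - r t))" by (simp add: yc_def dX_def)
      have dXle: "\<bar>dX\<bar> \<le> exp b * \<bar>z - r t\<bar>"
        using X_lip[OF dom[OF d1] dom[OF d2]] by (simp add: dX_def)
      \<comment> \<open>\<open>X\<close> is increasing, so \<open>dX\<close> has the sign of
        \<open>z - r t\<close>, and the absolute values add without cancellation. This gives the
        lower bound on the coordinate \<open>y\<close>.\<close>
      have sgn: "\<bar>dX + (z - r t)\<bar> = \<bar>dX\<bar> + \<bar>z - r t\<bar>"
        using X_mono[OF dom(1)[OF d1] dom(2)[OF d2]] X_mono[OF dom(1)[OF d2] dom(2)[OF d1]]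
        by (cases "z \<le> r t") (auto simp: dX_def)
      have B1: "\<bar>z - r t\<bar> - aa \<le> \<bar>X (z + c * t) + (z - c * t)\<bar>" using y sgn yc by linarith
      have B2: "\<bar>X (z + c * t) + (z - c * t)\<bar> \<le> (1 + exp b) * \<bar>z - r t\<bar> + aa"
        unfolding distrib_right mult_1_left using y sgn yc dXle by linarith
      show ?thesis using A1 A2 B1 B2 by blast
    qed
    ultimately show ?thesis by blast
  qed
  show ?thesis
  proof (rule that[of "Tm - 1" "Tp + 1" "1 - ZZ" ZZ b K N "- ZZ"])
    show "1 - ZZ < r t - 1 \<and> r t + 1 < ZZ" if "t \<in> {Tm..Tp}" for t
    proof -
      have "\<bar>t\<bar> \<le> TT" using that by (auto simp: TT_def)
      from r_le[OF this] show ?thesis unfolding ZZ_def by linarith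
    qed
    show "K \<ge> 0" using nn k1 by (simp add: K_def)
    show "N \<ge> 1" using nn by (simp add: N_def)
  qed (use main b0 in auto)
qed

end

section \<open>Integrals over balls and spheres\<close>

lemma continuous_integrable_on_compact:
  fixes f :: "'a::euclidean_space \<Rightarrow> real"
  assumes "compact S" "continuous_on S f"
  shows "f integrable_on S"
proof -
  have "set_integrable lborel S f"
    unfolding set_integrable_def by (rule borel_integrable_compact[OF assms])
  thus ?thesis by (rule set_borel_integral_eq_integral(1))
qed

text \<open>After normalisation the integrand is a product of three one-dimensional normal
  densities, whose integral over the whole space is 1 by Fubini.\<close>

lemma gaussian_ball_integral:
  fixes x0 :: "real^3"
  assumes a: "a > 0"
  shows "integral (cball x0 R) (\<lambda>x. exp (- (norm (x - x0))\<^sup>2 / (2 * a\<^sup>2))) \<le> sqrt (2 * pi * a\<^sup>2) ^ 3"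
proof -
  define f where "f x = (\<Prod>b\<in>Basis. normal_density (x0 \<bullet> b) a (x \<bullet> b))" for x :: "real^3"
  have s: "sqrt (2 * pi * a\<^sup>2) > 0" using a by simp
  have f_eq: "f x = exp (- (norm (x - x0))\<^sup>2 / (2 * a\<^sup>2)) / sqrt (2 * pi * a\<^sup>2) ^ 3" for x
  proof -
    have "f x = (\<Prod>b\<in>(Basis::(real^3) set). 1 / sqrt (2 * pi * a\<^sup>2)) * exp (\<Sum>b\<in>Basis. - (x \<bullet> b - x0 \<bullet> b)\<^sup>2 / (2 * a\<^sup>2))"
      unfolding f_def normal_density_def prod.distrib by (simp only: exp_sum finite_Basis)
    also have "(\<Sum>b\<in>Basis. - (x \<bullet> b - x0 \<bullet> b)\<^sup>2 / (2 * a\<^sup>2)) = - (\<Sum>b\<in>Basis. ((x - x0) \<bullet> b)\<^sup>2) / (2 * a\<^sup>2)"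
      by (simp add: sum_divide_distrib sum_negf inner_diff_left)
    also have "(\<Sum>b\<in>Basis. ((x - x0) \<bullet> b)\<^sup>2) = (norm (x - x0))\<^sup>2"
      unfolding power2_norm_eq_inner by (subst euclidean_inner) (simp add: power2_eq_square)
    finally show ?thesis by (simp add: power_divide)
  qed
  have "(\<integral>\<^sup>+x. ennreal (f x) \<partial>lborel) = (\<integral>\<^sup>+x. (\<Prod>b\<in>Basis. ennreal (normal_density (x0 \<bullet> b) a (x \<bullet> b))) \<partial>lborel)"
    unfolding f_def by (simp add: prod_ennreal)
  also have "\<dots> = (\<Prod>b\<in>Basis. (\<integral>\<^sup>+x. ennreal (normal_density (x0 \<bullet> b) a x) \<partial>lborel))"
    by (rule nn_integral_lborel_prod) auto
  also have "\<dots> = 1"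
  proof (rule prod.neutral, intro ballI)
    fix b :: "real^3"
    have "integral\<^sup>L lborel (normal_density (x0 \<bullet> b) a) = 1" "integrable lborel (normal_density (x0 \<bullet> b) a)"
      using integral_normal_density[OF a] integrable_normal_density[OF a] by auto
    thus "(\<integral>\<^sup>+x. ennreal (normal_density (x0 \<bullet> b) a x) \<partial>lborel) = 1"
      by (subst nn_integral_eq_integral) auto
  qed
  finally have nn: "(\<integral>\<^sup>+x. ennreal (f x) \<partial>lborel) = ennreal 1" by simp
  have f0: "f x \<ge> 0" for x unfolding f_eq using s by simp
  have cont: "continuous_on S f" for S
    unfolding f_eq[abs_def] using s a by (intro continuous_intros) auto
  have "has_bochner_integral lborel f 1"
    by (rule has_bochner_integral_nn_integral)
      (use nn f0 borel_measurable_continuous_onI[OF cont] in auto)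
  hence "(f has_integral 1) UNIV"
    using has_integral_integral_lborel by (metis has_bochner_integral_iff)
  hence "integral UNIV f = 1" "f integrable_on UNIV" by auto
  moreover have "integral (cball x0 R) f \<le> integral UNIV f"
    by (rule integral_subset_le) (use f0 calculation continuous_integrable_on_compact[OF compact_cball cont] in auto)
  moreover have "integral (cball x0 R) f = integral (cball x0 R) (\<lambda>x. exp (- (norm (x - x0))\<^sup>2 / (2 * a\<^sup>2))) / sqrt (2 * pi * a\<^sup>2) ^ 3"
    unfolding f_eq[abs_def] by (rule integral_divide)
  ultimately show ?thesis using s by (simp add: divide_le_eq)
qed

lemma ball_integral_upper:
  fixes x0 :: "real^3"
  assumes a: "a > 0" and f: "continuous_on (cball x0 R) f" and C: "C \<ge> 0"
    and b: "\<And>x. x \<in> cball x0 R \<Longrightarrow> f x \<le> C / a ^ 3 * exp (- (norm (x - x0))\<^sup>2 / (2 * a\<^sup>2))"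
  shows "integral (cball x0 R) f \<le> C * sqrt (2 * pi) ^ 3"
proof -
  have "integral (cball x0 R) f \<le> integral (cball x0 R) (\<lambda>x. C / a ^ 3 * exp (- (norm (x - x0))\<^sup>2 / (2 * a\<^sup>2)))"
    using a by (intro integral_le continuous_integrable_on_compact f b continuous_intros) auto
  also have "\<dots> = C / a ^ 3 * integral (cball x0 R) (\<lambda>x. exp (- (norm (x - x0))\<^sup>2 / (2 * a\<^sup>2)))"
    by simp
  also have "\<dots> \<le> C / a ^ 3 * sqrt (2 * pi * a\<^sup>2) ^ 3"
    using a C by (intro mult_left_mono gaussian_ball_integral) auto
  also have "sqrt (2 * pi * a\<^sup>2) = sqrt (2 * pi) * a"
    using a by (simp add: real_sqrt_mult)
  also have "C / a ^ 3 * (sqrt (2 * pi) * a) ^ 3 = C * sqrt (2 * pi) ^ 3"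
    using a by (simp only: power_mult_distrib) simp
  finally show ?thesis .
qed

text \<open>The concentric ball of radius \<open>a\<close> already suffices: its volume is
  proportional to \<open>a ^ 3\<close> and compensates the height of \<open>f\<close>.\<close>

lemma ball_integral_lower:
  fixes x0 :: "real^3"
  assumes a: "0 < a" "a \<le> R" and f: "continuous_on (cball x0 R) f" and f0: "\<And>x. x \<in> cball x0 R \<Longrightarrow> 0 \<le> f x"
    and b: "\<And>x. x \<in> cball x0 a \<Longrightarrow> C / a ^ 3 \<le> f x"
  shows "C * unit_ball_vol 3 \<le> integral (cball x0 R) f"
proof -
  have sub: "cball x0 a \<subseteq> cball x0 R" using a by auto
  have "integral (cball x0 a) (\<lambda>x. C / a ^ 3) = C / a ^ 3 * integral (cball x0 a) (\<lambda>x. 1)"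
    by (subst integral_mult_right[symmetric]) simp
  also have "integral (cball x0 a) (\<lambda>x. 1) = measure lebesgue (cball x0 a)"
    by (rule lmeasure_integral[symmetric]) simp
  also have "\<dots> = unit_ball_vol 3 * a ^ 3"
    using content_cball[of a x0] a by (simp add: measure_completion)
  finally have "C * unit_ball_vol 3 = integral (cball x0 a) (\<lambda>x. C / a ^ 3)" using a by simp
  also have "\<dots> \<le> integral (cball x0 a) f"
    by (intro integral_le continuous_integrable_on_compact b continuous_on_subset[OF f sub]) auto
  also have "\<dots> \<le> integral (cball x0 R) f"
    by (intro integral_subset_le sub continuous_integrable_on_compact f continuous_on_subset[OF f sub]) (use f0 in auto)
  finally show ?thesis .
qed

lemma sphere_integral_le:
  assumes B: "B \<ge> 0" and R: "R \<ge> 0" and f: "\<And>x. norm (x - x0) = R \<Longrightarrow> \<bar>f x\<bar> \<le> B"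
  shows "sphere_integral f x0 R \<le> 2 * pi\<^sup>2 * R\<^sup>2 * B"
proof -
  have norm_sph: "norm (sph \<theta> \<phi>) = 1" for \<theta> \<phi>
  proof -
    have "(norm (sph \<theta> \<phi>))\<^sup>2 = (sin \<theta> * cos \<phi>)\<^sup>2 + (sin \<theta> * sin \<phi>)\<^sup>2 + (cos \<theta>)\<^sup>2"
      unfolding power2_norm_eq_inner inner_vec_def sum_3 sph_def by (simp add: power2_eq_square)
    also have "\<dots> = (sin \<theta>)\<^sup>2 * ((cos \<phi>)\<^sup>2 + (sin \<phi>)\<^sup>2) + (cos \<theta>)\<^sup>2"
      by algebra
    also have "\<dots> = 1" by simp
    finally have "norm (sph \<theta> \<phi>) = 1 \<or> norm (sph \<theta> \<phi>) = -1" by (simp only: power2_eq_1_iff)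
    thus ?thesis using norm_ge_zero[of "sph \<theta> \<phi>"] by linarith
  qed
  define h where "h = (\<lambda>(\<theta>, \<phi>). R\<^sup>2 * sin \<theta> * f (x0 + R *\<^sub>R sph \<theta> \<phi>))"
  have hb: "norm (h p) \<le> R\<^sup>2 * B" for p
  proof -
    obtain \<theta> \<phi> where p: "p = (\<theta>, \<phi>)" by (metis surj_pair)
    have "\<bar>f (x0 + R *\<^sub>R sph \<theta> \<phi>)\<bar> \<le> B" by (rule f) (use R in \<open>simp add: norm_sph\<close>)
    hence "\<bar>sin \<theta>\<bar> * \<bar>f (x0 + R *\<^sub>R sph \<theta> \<phi>)\<bar> \<le> 1 * B" by (intro mult_mono) auto
    hence "R\<^sup>2 * (\<bar>sin \<theta>\<bar> * \<bar>f (x0 + R *\<^sub>R sph \<theta> \<phi>)\<bar>) \<le> R\<^sup>2 * (1 * B)" by (intro mult_left_mono) auto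
    thus ?thesis by (simp add: h_def p abs_mult mult_ac)
  qed
  have box: "{0..pi} \<times> {0..2*pi} = cbox (0, 0) (pi, 2 * pi)" unfolding cbox_Pair_eq by (simp only: cbox_interval)
  have "norm (integral (cbox (0, 0) (pi, 2 * pi)) h) \<le> R\<^sup>2 * B * measure lborel (cbox (0, 0) (pi, 2 * pi))"
  \<comment> \<open>A non-integrable function has integral 0 by convention, so the bound holds
    without any regularity of \<open>f\<close>.\<close>
  proof (cases "h integrable_on cbox (0, 0) (pi, 2 * pi)")
    case True
    show ?thesis by (rule integrable_bound[OF _ True]) (use B hb in auto)
  next
    case False
    thus ?thesis using B by (simp add: not_integrable_integral)
  qed
  also have "measure lborel (cbox (0, 0) (pi, 2 * pi)) = pi * (2 * pi)"
    unfolding content_Pair by simp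
  finally show ?thesis unfolding sphere_integral_def box h_def[symmetric]
    by (simp add: power2_eq_square mult_ac)
qed

section \<open>Gaussian bounds for the amplitude\<close>

context field begin

lemma mu_aa: "\<mu> * aa\<^sup>2 = 1" using aa by (simp add: \<mu>_def)

text \<open>Since \<open>\<bar>yy p\<bar> + aa\<close> dominates the distance in \<open>z\<close>,
  its square is at most \<open>2 (yy p)\<^sup>2 + 2 aa\<^sup>2\<close>. This halves the exponent
  and, as \<open>\<mu> * aa\<^sup>2 = 1\<close>, costs the factor \<open>exp 1\<close>.\<close>

lemma u_square_upper:
  assumes A: "\<bar>A p\<bar> \<le> b" and y: "\<bar>snd p $ 3 - \<rho>\<bar> - aa \<le> \<bar>yy p\<bar>"
  shows "(u p)\<^sup>2 \<le> exp (1 + b) / aa ^ 3 * exp (- ((snd p $ 1)\<^sup>2 + (snd p $ 2)\<^sup>2 + (snd p $ 3 - \<rho>)\<^sup>2) / (2 * aa\<^sup>2))"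
proof -
  define X2 where "X2 = (snd p $ 1)\<^sup>2 + (snd p $ 2)\<^sup>2"
  define Z where "Z = (snd p $ 3 - \<rho>)\<^sup>2"
  have "Z \<le> (\<bar>yy p\<bar> + aa)\<^sup>2"
  proof -
    have "\<bar>snd p $ 3 - \<rho>\<bar>\<^sup>2 \<le> (\<bar>yy p\<bar> + aa)\<^sup>2" using y by (intro power_mono) auto
    thus ?thesis by (simp add: Z_def)
  qed
  also have "\<dots> \<le> 2 * (yy p)\<^sup>2 + 2 * aa\<^sup>2"
    using sum_squares_bound[of "\<bar>yy p\<bar>" aa] by (simp add: power2_sum)
  finally have "\<mu> * (Z / 2 - aa\<^sup>2) \<le> \<mu> * (yy p)\<^sup>2" using mu by (intro mult_left_mono) auto
  hence y2: "\<mu> * Z / 2 - 1 \<le> \<mu> * (yy p)\<^sup>2" using mu_aa by (simp add: right_diff_distrib)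
  have X0: "0 \<le> \<mu> * X2" using mu by (simp add: X2_def)
  have "2 * lam p = - (\<mu> * (yy p)\<^sup>2) - A p / 2 - \<mu> * X2" by (simp add: lam_def X2_def field_simps)
  also have "\<dots> \<le> (1 + b) - \<mu> * (X2 + Z) / 2"
  proof -
    have "\<mu> * (X2 + Z) / 2 = \<mu> * X2 / 2 + \<mu> * Z / 2" by (simp add: field_simps)
    thus ?thesis using y2 X0 A by linarith
  qed
  finally have "exp (2 * lam p) \<le> exp ((1 + b) + - (\<mu> * (X2 + Z) / 2))" by simp
  also have "- (\<mu> * (X2 + Z) / 2) = - (X2 + Z) / (2 * aa\<^sup>2)"
    unfolding \<mu>_def minus_divide_left[symmetric] by (simp add: mult.commute)
  finally have "exp (2 * lam p) / aa ^ 3 \<le> exp (1 + b) * exp (- (X2 + Z) / (2 * aa\<^sup>2)) / aa ^ 3"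
    unfolding exp_add using aa by (intro divide_right_mono) auto
  thus ?thesis unfolding u_square by (simp add: X2_def Z_def)
qed

lemma u_square_lower:
  assumes A: "\<bar>A p\<bar> \<le> b" and y: "\<bar>yy p\<bar> \<le> (1 + exp b) * \<bar>snd p $ 3 - \<rho>\<bar> + aa"
    and d: "(snd p $ 1)\<^sup>2 + (snd p $ 2)\<^sup>2 + (snd p $ 3 - \<rho>)\<^sup>2 \<le> aa\<^sup>2"
  shows "exp (- ((2 + exp b)\<^sup>2 + b + 1)) / aa ^ 3 \<le> (u p)\<^sup>2"
proof -
  define X2 where "X2 = (snd p $ 1)\<^sup>2 + (snd p $ 2)\<^sup>2"
  have X2: "0 \<le> X2" "X2 \<le> aa\<^sup>2" "(snd p $ 3 - \<rho>)\<^sup>2 \<le> aa\<^sup>2" using d by (auto simp: X2_def intro: order_trans[rotated])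
  have "\<bar>snd p $ 3 - \<rho>\<bar> \<le> aa" using X2(3) abs_le_square_iff[of "snd p $ 3 - \<rho>" aa] aa by simp
  hence "(1 + exp b) * \<bar>snd p $ 3 - \<rho>\<bar> \<le> (1 + exp b) * aa" by (intro mult_left_mono) (auto simp: add_nonneg_nonneg)
  hence "\<bar>yy p\<bar> \<le> (2 + exp b) * aa" using y by (simp add: algebra_simps)
  hence "\<bar>yy p\<bar>\<^sup>2 \<le> ((2 + exp b) * aa)\<^sup>2" by (intro power_mono) auto
  hence "\<mu> * (yy p)\<^sup>2 \<le> \<mu> * ((2 + exp b) * aa)\<^sup>2" using mu by (intro mult_left_mono) auto
  also have "\<dots> = (2 + exp b)\<^sup>2" using mu_aa by (simp add: power_mult_distrib mult_ac)
  finally have y2: "\<mu> * (yy p)\<^sup>2 \<le> (2 + exp b)\<^sup>2" .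
  have x2: "\<mu> * X2 \<le> 1" using mult_left_mono[OF X2(2), of \<mu>] mu mu_aa by simp
  have "2 * lam p = - (\<mu> * (yy p)\<^sup>2) - A p / 2 - \<mu> * X2" by (simp add: lam_def X2_def field_simps)
  also have "\<dots> \<ge> - ((2 + exp b)\<^sup>2 + b + 1)" using y2 x2 A by linarith
  finally have "exp (- ((2 + exp b)\<^sup>2 + b + 1)) \<le> exp (2 * lam p)" by simp
  thus ?thesis unfolding u_square using aa by (intro divide_right_mono) auto
qed

lemma continuous_lt: "continuous_on U lt" and continuous_l3: "continuous_on U l3"
proof -
  have "isCont lt p" "isCont l3 p" if "p \<in> U" for p
    using d4_lt[OF that] d4_l3[OF that] unfolding d4_def by (blast intro: has_derivative_continuous)+
  thus "continuous_on U lt" "continuous_on U l3" by (auto intro: continuous_at_imp_continuous_on)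
qed

text \<open>Any explicit bound serves here, however large, as it depends only on quantities fixed
  before \<open>ch\<close> and is multiplied by \<open>ch\<^sup>2\<close> afterwards.\<close>

lemma coefficient_bound:
  assumes A: "\<bar>A p\<bar> \<le> b" "\<bar>A1 p\<bar> \<le> N" and b: "b \<ge> 0" and y: "\<bar>yy p\<bar> \<le> Y" and x: "\<bar>snd p $ 1\<bar> \<le> 1" "\<bar>snd p $ 2\<bar> \<le> 1"
    and lm: "M = \<bar>ln (pi powr (3/2))\<bar>" and QQ: "QQ = \<mu> * Y * (exp b + 1) + N * exp b"
  shows "(lt p)\<^sup>2 / c\<^sup>2 + (\<mu> * snd p $ 1)\<^sup>2 + (\<mu> * snd p $ 2)\<^sup>2 + (l3 p)\<^sup>2 \<le> 2 * QQ\<^sup>2 + 2 * \<mu>\<^sup>2 + \<mu> * (\<mu> * Y\<^sup>2 + b + 2 * \<mu> + M + 2)"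
    "\<bar>\<mu> * (2 * lam p + ln (pi powr (3/2)) + 2)\<bar> \<le> 2 * QQ\<^sup>2 + 2 * \<mu>\<^sup>2 + \<mu> * (\<mu> * Y\<^sup>2 + b + 2 * \<mu> + M + 2)"
proof -
  have nu: "0 < nu p" "nu p \<le> exp b" using A(1) by (auto simp: nu_def)
  have am: "\<bar>x * y\<bar> \<le> a * b" if "\<bar>x\<bar> \<le> a" "\<bar>y\<bar> \<le> b" for x y a b :: real
    unfolding abs_mult by (rule mult_mono) (use that in auto)
  have e1: "1 \<le> exp b" using b by simp
  have n: "\<bar>nu p - 1\<bar> \<le> exp b + 1" "\<bar>nu p + 1\<bar> \<le> exp b + 1" "\<bar>nu p\<bar> \<le> exp b" using nu e1 by linarith+
  have Y0: "0 \<le> Y \<and> 0 \<le> N" using y A(2) by linarith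
  have mm: "\<bar>\<mu>\<bar> \<le> \<mu>" using mu by simp
  have 1: "\<bar>\<mu> * yy p * (nu p - 1)\<bar> \<le> \<mu> * Y * (exp b + 1)" "\<bar>\<mu> * yy p * (nu p + 1)\<bar> \<le> \<mu> * Y * (exp b + 1)"
    "\<bar>A1 p * nu p\<bar> \<le> N * exp b" by (intro am mm y n A)+
  have 2: "\<bar>- \<mu> * yy p * (nu p - 1) - A1 p * nu p / 4\<bar> \<le> QQ" "\<bar>l3 p\<bar> \<le> QQ"
    unfolding l3_def QQ using 1 by (simp_all only: abs_le_iff) linarith+
  have sq: "x\<^sup>2 \<le> y\<^sup>2" if "\<bar>x\<bar> \<le> y" for x y :: real using that by (meson abs_ge_zero order_trans power2_le_iff_abs_le)
  have l1: "(lt p)\<^sup>2 / c\<^sup>2 \<le> QQ\<^sup>2" using sq[OF 2(1)] c by (simp add: lt_def power_mult_distrib)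
  have l2: "(l3 p)\<^sup>2 \<le> QQ\<^sup>2" by (rule sq[OF 2(2)])
  have l4: "(\<mu> * snd p $ 1)\<^sup>2 \<le> \<mu>\<^sup>2" "(\<mu> * snd p $ 2)\<^sup>2 \<le> \<mu>\<^sup>2"
    using am[OF mm x(1)] am[OF mm x(2)] by (auto intro!: sq)
  have rest: "0 \<le> \<mu> * (\<mu> * Y\<^sup>2 + b + 2 * \<mu> + M + 2)"
    using mu b by (intro mult_nonneg_nonneg add_nonneg_nonneg) (auto simp: lm)
  show "(lt p)\<^sup>2 / c\<^sup>2 + (\<mu> * snd p $ 1)\<^sup>2 + (\<mu> * snd p $ 2)\<^sup>2 + (l3 p)\<^sup>2 \<le> 2 * QQ\<^sup>2 + 2 * \<mu>\<^sup>2 + \<mu> * (\<mu> * Y\<^sup>2 + b + 2 * \<mu> + M + 2)"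
    using l1 l2 l4 rest by linarith
  have y2: "\<mu> * (yy p)\<^sup>2 \<le> \<mu> * Y\<^sup>2" "0 \<le> \<mu> * (yy p)\<^sup>2" using sq[OF y] mu by (auto intro: mult_left_mono)
  have x2: "\<mu> * (snd p $ 1)\<^sup>2 \<le> \<mu> * 1" "\<mu> * (snd p $ 2)\<^sup>2 \<le> \<mu> * 1" "0 \<le> \<mu> * (snd p $ 1)\<^sup>2" "0 \<le> \<mu> * (snd p $ 2)\<^sup>2"
    using sq[OF x(1)] sq[OF x(2)] mu by (auto intro!: mult_left_mono)
  have "2 * lam p = - (\<mu> * (yy p)\<^sup>2) - A p / 2 - \<mu> * (snd p $ 1)\<^sup>2 - \<mu> * (snd p $ 2)\<^sup>2" by (simp add: lam_def field_simps)
  hence "\<bar>2 * lam p + ln (pi powr (3/2)) + 2\<bar> \<le> \<mu> * Y\<^sup>2 + b + 2 * \<mu> + M + 2"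
    using y2 x2 A(1) b mu unfolding lm by linarith
  hence "\<bar>\<mu> * (2 * lam p + ln (pi powr (3/2)) + 2)\<bar> \<le> \<mu> * (\<mu> * Y\<^sup>2 + b + 2 * \<mu> + M + 2)"
    by (intro am mm)
  moreover have "0 \<le> 2 * QQ\<^sup>2 + 2 * \<mu>\<^sup>2" by simp
  ultimately show "\<bar>\<mu> * (2 * lam p + ln (pi powr (3/2)) + 2)\<bar> \<le> 2 * QQ\<^sup>2 + 2 * \<mu>\<^sup>2 + \<mu> * (\<mu> * Y\<^sup>2 + b + 2 * \<mu> + M + 2)"
    by linarith
qed

end

context sol begin

lemma continuous_Phi: "continuous_on V Phi"
proof -
  have "isCont Phi p" if "p \<in> U" for p
    using d4_Phi[OF that] unfolding d4_def by (blast intro: has_derivative_continuous)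
  thus ?thesis using V_subset by (auto intro!: continuous_at_imp_continuous_on)
qed

lemma continuous_densities:
  "continuous_on V (conc_dens c m ch aa \<psi>)" "continuous_on V (energy_density c m q ch aa \<phi> \<psi>)"
proof -
  note [continuous_intros] = continuous_on_subset[OF continuous_lt V_subset] continuous_on_subset[OF continuous_l3 V_subset]
    continuous_Phi ck_continuous[OF ck_st[of 0]] ck_continuous[OF ck_sz[of 0]]
    continuous_on_subset[OF ck_continuous[OF ck_u[of 0]] V_subset] continuous_on_subset[OF ck_continuous[OF ck_lam[of 0]] V_subset]
  have c0: "c \<noteq> 0" "ch \<noteq> 0" "m \<noteq> 0" using c ch m by auto
  have "continuous_on V (\<lambda>p. (ch / (m * c))\<^sup>2 * (((u p * lt p)\<^sup>2 + (u p * (st p / ch))\<^sup>2) / c\<^sup>2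
     + ((u p * (- \<mu> * snd p $ 1))\<^sup>2 + (u p * (- \<mu> * snd p $ 2))\<^sup>2 + (u p * l3 p)\<^sup>2 + (u p * (sz p / ch))\<^sup>2))
     + (ch / (m * c))\<^sup>2 * \<bar>Gfun aa ((u p)\<^sup>2)\<bar> + (u p)\<^sup>2)"
    unfolding Gfun_u by (intro continuous_intros) (use c0 in auto)
  thus "continuous_on V (conc_dens c m ch aa \<psi>)"
    by (rule continuous_on_eq) (simp add: conc_dens_polar)
  have "continuous_on V (\<lambda>p. ch\<^sup>2 / (2 * m) * (((u p * lt p)\<^sup>2 + (u p * (Phi p / ch))\<^sup>2) / c\<^sup>2
     + ((u p * (- \<mu> * snd p $ 1))\<^sup>2 + (u p * (- \<mu> * snd p $ 2))\<^sup>2 + (u p * l3 p)\<^sup>2 + (u p * (sz p / ch))\<^sup>2)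
     + Gfun aa ((u p)\<^sup>2) + (m * c / ch)\<^sup>2 * (u p)\<^sup>2))"
    unfolding Gfun_u by (intro continuous_intros) (use c0 in auto)
  thus "continuous_on V (energy_density c m q ch aa \<phi> \<psi>)"
    by (rule continuous_on_eq) (simp add: energy_density_polar)
qed

end

section \<open>The limiting potential along the worldline\<close>

context traj begin

definition "fz W t = W * exp (L t / 2)" for W t :: real
definition "gz W t = W * (exp (- L t / 2) * l t / 2)" for W t :: real
text \<open>The rate of change of the field gradient \<open>gz\<close>; through \<open>l'\<close> it
  contains \<open>v2\<close>, the second derivative of the velocity.\<close>

definition "gz' W t = W / 2 * (exp (- L t / 2) * l' t - L1 t / 2 * exp (- L t / 2) * l t)" for W t :: real

text \<open>The leading potential is a function of \<open>z + c t\<close>, so its rate of change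
  along the worldline is \<open>c + v\<close> times its \<open>z\<close>-derivative. In the
  computation this is \<open>exp (L t) * (c - v t) = c + v t\<close>.\<close>

lemma fz_deriv: "(fz W has_real_derivative (c + v t) * gz W t) (at t)"
proof -
  have d: "c - v t \<noteq> 0" using cv[of t] by linarith
  have e: "exp (L t / 2) = exp (- L t / 2) * exp (L t)" by (simp flip: exp_add)
  have "L1 t = l t * (c - v t)" using d by (simp add: l_def mult.assoc)
  hence "exp (L t / 2) * L1 t = exp (- L t / 2) * l t * (exp (L t) * (c - v t))" by (simp add: e)
  also have "exp (L t) * (c - v t) = c + v t" using d by (simp add: exp_L)
  finally have eq: "W * (exp (L t / 2) * (L1 t / 2)) = (c + v t) * gz W t" by (simp add: gz_def)
  have "((\<lambda>t. W * exp (L t / 2)) has_real_derivative W * (exp (L t / 2) * (L1 t / 2))) (at t)"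
    by (intro DERIV_cmult DERIV_chain2[OF DERIV_exp] DERIV_cdivide L_deriv)
  thus ?thesis unfolding eq by (simp add: fz_def[abs_def])
qed

lemma gz_deriv: "(gz W has_real_derivative gz' W t) (at t)"
proof -
  have "((\<lambda>t. exp (- L t / 2)) has_real_derivative exp (- L t / 2) * (- L1 t / 2)) (at t)"
    by (intro DERIV_chain2[OF DERIV_exp] DERIV_cdivide DERIV_minus L_deriv)
  from DERIV_cmult[OF DERIV_mult[OF this l_deriv], of "W / 2"] show ?thesis
    by (simp add: gz_def[abs_def] gz'_def field_simps)
qed

lemma exp_half_le: "exp (L t / 2) \<le> exp LB" "exp (- L t / 2) \<le> exp LB"
  using L_abs[of t] by auto

lemma fz_bound: "\<bar>fz W t\<bar> \<le> \<bar>W\<bar> * exp LB"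
  unfolding fz_def by (intro abs_mult_le) (use exp_half_le(1)[of t] in auto)

lemma gz_bound: "\<bar>gz W t\<bar> \<le> \<bar>W\<bar> * (exp LB * Kl)"
proof -
  have "\<bar>exp (- L t / 2) * l t\<bar> \<le> exp LB * Kl"
    by (intro abs_mult_le l_le) (use exp_half_le(2)[of t] in auto)
  hence "\<bar>exp (- L t / 2) * l t / 2\<bar> \<le> exp LB * Kl" by simp
  thus ?thesis unfolding gz_def by (intro abs_mult_le) auto
qed

lemma gz'_bound: "\<bar>gz' W t\<bar> \<le> \<bar>W\<bar> * (exp LB * Kl' + KL * exp LB * Kl)"
proof -
  have e: "\<bar>exp (- L t / 2)\<bar> \<le> exp LB" using exp_half_le(2)[of t] by simp
  have "\<bar>exp (- L t / 2) * l' t\<bar> \<le> exp LB * Kl'" "\<bar>L1 t * exp (- L t / 2) * l t\<bar> \<le> KL * exp LB * Kl"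
    by (intro abs_mult_le e l'_le l_le L1_le)+
  moreover have "L1 t / 2 * exp (- L t / 2) * l t = (L1 t * exp (- L t / 2) * l t) / 2" by simp
  ultimately have "\<bar>exp (- L t / 2) * l' t - L1 t / 2 * exp (- L t / 2) * l t\<bar> \<le> exp LB * Kl' + KL * exp LB * Kl"
    by linarith
  moreover have "\<bar>W / 2\<bar> \<le> \<bar>W\<bar>" by simp
  ultimately show ?thesis unfolding gz'_def by (intro abs_mult_le)
qed

end

section \<open>Choice of the scales\<close>

lemma grad0_norm_le:
  assumes "c > 0" "d4 f ft 0 0 fz p"
  shows "grad0_norm c f p \<le> \<bar>ft\<bar> / c + \<bar>fz\<bar>"
  using sqrt_sum_squares_le_sum_abs[of "ft / c" fz] assms(1)
  by (simp add: grad0_norm_def sum_3 d4_pd[OF assms(2)])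

lemma rhat_nth: "rhat r t $ 1 = 0" "rhat r t $ 2 = 0" "rhat r t $ 3 = r t"
  by (simp_all add: rhat_def)

lemma norm_minus_rhat: "(norm (x - rhat r t))\<^sup>2 = (x $ 1)\<^sup>2 + (x $ 2)\<^sup>2 + (x $ 3 - r t)\<^sup>2"
  unfolding power2_norm_eq_inner inner_vec_def sum_3 by (simp add: rhat_nth power2_eq_square)

lemma component_minus_rhat_le:
  assumes "norm (x - rhat r t) \<le> R"
  shows "\<bar>x $ 1\<bar> \<le> R" "\<bar>x $ 2\<bar> \<le> R" "\<bar>x $ 3 - r t\<bar> \<le> R"
  using component_le_norm_cart[of "x - rhat r t" 1] component_le_norm_cart[of "x - rhat r t" 2]
    component_le_norm_cart[of "x - rhat r t" 3] assms by (auto simp: rhat_nth)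

context traj begin

definition "phinf W = (\<lambda>(t, x). fz W t + (x - rhat r t) \<bullet> (gz W t *\<^sub>R axis 3 1))" for W :: real

lemma phinf_eq: "phinf W p = fz W (fst p) + (snd p $ 3 - r (fst p)) * gz W (fst p)"
  by (simp add: phinf_def case_prod_unfold inner_axis rhat_nth)

lemma d4_phinf: "d4 (phinf W) (c * gz W (fst p) + (snd p $ 3 - r (fst p)) * gz' W (fst p)) 0 0 (gz W (fst p)) p"
proof -
  have "d4 (\<lambda>p. fz W (fst p)) ((c + v (fst p)) * gz W (fst p) * 1) ((c + v (fst p)) * gz W (fst p) * 0)
      ((c + v (fst p)) * gz W (fst p) * 0) ((c + v (fst p)) * gz W (fst p) * 0) p"
    by (rule d4_chain[OF fz_deriv d4_t])
  moreover have "d4 (\<lambda>p. gz W (fst p)) (gz' W (fst p) * 1) (gz' W (fst p) * 0) (gz' W (fst p) * 0) (gz' W (fst p) * 0) p"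
    by (rule d4_chain[OF gz_deriv d4_t])
  moreover have "d4 (\<lambda>p. r (fst p)) (v (fst p) * 1) (v (fst p) * 0) (v (fst p) * 0) (v (fst p) * 0) p"
    by (rule d4_chain[OF r' d4_t])
  ultimately show ?thesis
    using d4_cong[OF d4_add[OF _ d4_mult[OF d4_diff[OF d4_x3]]] open_UNIV UNIV_I phinf_eq[symmetric]]
    by (auto simp: algebra_simps)
qed

text \<open>\<open>\<alpha>\<close> and \<open>\<alpha>'\<close> stand for \<open>A\<close> and
  \<open>A1\<close> at a point of the tube; the two estimates concern the value and the
  \<open>z\<close>-derivative of the leading potential.\<close>

lemma exp_estimates:
  assumes a: "\<bar>\<alpha>\<bar> \<le> B" "\<bar>\<alpha> - L t\<bar> \<le> k" "\<bar>\<alpha>' - l t\<bar> \<le> k" and B: "LB \<le> B"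
  shows "\<bar>W * exp (\<alpha> / 2) - fz W t\<bar> \<le> \<bar>W\<bar> * (exp B * k)"
    "\<bar>W * (exp (- \<alpha> / 2) * \<alpha>' / 2) - gz W t\<bar> \<le> \<bar>W\<bar> * (exp B * k * (1 + Kl))"
proof -
  have LB: "\<bar>L t\<bar> \<le> B" using L_abs[of t] B by linarith
  have k: "k \<ge> 0" using a(2) by linarith
  have half: "\<bar>exp (s * \<alpha> / 2) - exp (s * L t / 2)\<bar> \<le> exp B * k" if s: "s = 1 \<or> s = -1" for s
  proof -
    have "\<bar>exp (s * \<alpha> / 2) - exp (s * L t / 2)\<bar> \<le> exp B * \<bar>s * \<alpha> / 2 - s * L t / 2\<bar>"
      by (rule exp_diff_le) (use s a(1) LB in auto)
    also have "\<dots> \<le> exp B * k"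
      using s a(2) k by (intro mult_left_mono) (auto simp: abs_if field_simps split: if_splits)
    finally show ?thesis .
  qed
  have e1: "\<bar>exp (\<alpha> / 2) - exp (L t / 2)\<bar> \<le> exp B * k" and e2: "\<bar>exp (- \<alpha> / 2) - exp (- L t / 2)\<bar> \<le> exp B * k"
    using half[of 1] half[of "-1"] by simp_all
  have "W * exp (\<alpha> / 2) - fz W t = W * (exp (\<alpha> / 2) - exp (L t / 2))" by (simp add: fz_def algebra_simps)
  thus "\<bar>W * exp (\<alpha> / 2) - fz W t\<bar> \<le> \<bar>W\<bar> * (exp B * k)"
    by (simp only:) (rule abs_mult_le[OF order_refl e1])
  have "exp (- \<alpha> / 2) * \<alpha>' - exp (- L t / 2) * l t = exp (- \<alpha> / 2) * (\<alpha>' - l t) + (exp (- \<alpha> / 2) - exp (- L t / 2)) * l t"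
    by (simp add: algebra_simps)
  moreover have "\<bar>exp (- \<alpha> / 2) * (\<alpha>' - l t)\<bar> \<le> exp B * k" by (intro abs_mult_le a) (use a(1) in auto)
  moreover have "\<bar>(exp (- \<alpha> / 2) - exp (- L t / 2)) * l t\<bar> \<le> exp B * k * Kl" by (intro abs_mult_le e2 l_le)
  ultimately have "\<bar>exp (- \<alpha> / 2) * \<alpha>' - exp (- L t / 2) * l t\<bar> \<le> exp B * k * (1 + Kl)"
    by (simp add: distrib_left)
  hence h: "\<bar>(exp (- \<alpha> / 2) * \<alpha>' - exp (- L t / 2) * l t) / 2\<bar> \<le> exp B * k * (1 + Kl)" by simp
  have "W * (exp (- \<alpha> / 2) * \<alpha>' / 2) - gz W t = W * ((exp (- \<alpha> / 2) * \<alpha>' - exp (- L t / 2) * l t) / 2)"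
    by (simp add: gz_def algebra_simps)
  thus "\<bar>W * (exp (- \<alpha> / 2) * \<alpha>' / 2) - gz W t\<bar> \<le> \<bar>W\<bar> * (exp B * k * (1 + Kl))"
    by (simp only:) (rule abs_mult_le[OF order_refl h])
qed

text \<open>Everything required of one member of the sequence, with smallness measured by
  \<open>e\<close>. The constants \<open>Kc\<close> and \<open>c0\<close> are arguments so that they
  can be chosen before \<open>e\<close>.\<close>

definition "scaled_solution m q Tm Tp Kc c0 e aa R ch \<phi> \<psi> \<longleftrightarrow> 0 < aa \<and> 0 < R \<and> 0 < ch \<and> aa \<le> e \<and> R \<le> e \<and> ch \<le> e \<and>
       ch / (m * c) / aa \<le> 1 \<and> 1 / e \<le> R / aa \<and>
       C2_on \<phi> (Omega_hat r R Tm Tp) \<and> C2_on \<psi> (Omega_hat r R Tm Tp) \<and>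
       (\<forall>p\<in>Omega_hat r R Tm Tp. KG_eq c m q ch aa \<phi> \<psi> p \<and> \<bar>\<phi> p\<bar> + grad0_norm c \<phi> p \<le> Kc \<and>
          \<bar>\<phi> p - phinf (m * c\<^sup>2 / q) p\<bar> + grad0_norm c (\<lambda>p. \<phi> p - phinf (m * c\<^sup>2 / q) p) p \<le> e) \<and>
       (\<forall>t\<in>{Tm..Tp}. integral (Omega r R t) (\<lambda>x. conc_dens c m ch aa \<psi> (t, x)) \<le> Kc \<and>
          sphere_integral (\<lambda>x. conc_dens c m ch aa \<psi> (t, x)) (rhat r t) R \<le> e \<and>
          c0 \<le> Ebar c m q r R ch aa \<phi> \<psi> t \<and> Ebar c m q r R ch aa \<phi> \<psi> t \<le> Kc)"
  for m q Tm Tp Kc c0 e aa R ch :: real and \<phi> :: "pt \<Rightarrow> real" and \<psi> :: "pt \<Rightarrow> complex"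

lemma exists_scaled_solution:
  assumes T: "Tm < Tp" and m: "m > 0" and q: "q \<noteq> 0"
  obtains Kc c0 where "c0 > 0"
    "\<And>e. 0 < e \<Longrightarrow> e \<le> 1 \<Longrightarrow> \<exists>aa R ch \<phi> \<psi>. scaled_solution m q Tm Tp Kc c0 e aa R ch \<phi> \<psi>"
proof -
  show ?thesis
  proof (rule geometry[OF T m q])
    fix T1 T2 Z1 Z2 z0 b K N assume geo: "T1 < Tm" "Tp < T2" "\<And>t. t \<in> {Tm..Tp} \<Longrightarrow> z0 < r t - 1 \<and> r t + 1 < Z2"
      "b \<ge> 0" "K \<ge> 0" "N \<ge> 1"
      and ex: "\<And>aa R. 0 < aa \<Longrightarrow> aa \<le> R \<Longrightarrow> R \<le> 1 \<Longrightarrow> \<exists>t0 t1 y0 y1 P X H.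
         field t0 t1 y0 y1 c m q aa P X H T1 T2 Z1 Z2 z0 \<and>
         (\<forall>t\<in>{T1<..<T2}. \<forall>z\<in>{Z1<..<Z2}. \<bar>poly P (X (z + c * t))\<bar> \<le> b \<and> \<bar>poly (pderiv P) (X (z + c * t))\<bar> \<le> N) \<and>
         (\<forall>t\<in>{Tm..Tp}. \<forall>z. \<bar>z - r t\<bar> \<le> R \<longrightarrow>
            \<bar>poly P (X (z + c * t)) - L t\<bar> \<le> K * R \<and> \<bar>poly (pderiv P) (X (z + c * t)) - l t\<bar> \<le> K * R \<and>
            \<bar>z - r t\<bar> - aa \<le> \<bar>X (z + c * t) + (z - c * t)\<bar> \<and>
            \<bar>X (z + c * t) + (z - c * t)\<bar> \<le> (1 + exp b) * \<bar>z - r t\<bar> + aa)"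
    define W where "W = m * c\<^sup>2 / q"
    define B where "B = max b LB"
    \<comment> \<open>A common bound for \<open>A1\<close> and for \<open>nu\<close>, as the
      estimates of the solution assume.\<close>
    define N' where "N' = max N (exp b)"
    define D where "D = Z2 - z0"
    \<comment> \<open>These expressions reproduce \<open>C1\<close>, \<open>C2\<close>,
      \<open>CC\<close> and \<open>Sb\<close>. They are written out beforehand because the constants
      must be available before any solution has been chosen.\<close>
    define k1' where "k1' = 2 * c * (N' + 1)"
    define k2' where "k2' = 2 * c\<^sup>2 * N' ^ 3 + 8 * c\<^sup>2 * (N' + 1)\<^sup>2"
    define CQ where "CQ = (1 + k1' * D + k1' + k2' * D + 2 * (N' + 1) + k1') / \<bar>q\<bar>"
    define SB where "SB = (m * c\<^sup>2 * exp b + 1)\<^sup>2 / c\<^sup>2 + (m * c * exp b + 1)\<^sup>2"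
    define Kd where "Kd = 2 + SB / (m * c)\<^sup>2"
    define Ke where "Ke = m * c\<^sup>2 + SB / (2 * m)"
    define c3 where "c3 = exp (- ((2 + exp b)\<^sup>2 + b + 1))"
    define c0 where "c0 = m * c\<^sup>2 / 4 * c3 * unit_ball_vol 3"
    \<comment> \<open>The factor of \<open>R\<close> in the distance between the leading potential
      and \<open>phinf\<close>: the errors of value and gradient from \<open>exp_estimates\<close>,
      plus the linear terms of \<open>phinf\<close> on a tube of radius \<open>R\<close>.\<close>
    define M where "M = \<bar>W\<bar> * (exp B * K) + \<bar>W\<bar> * (exp LB * Kl) + 2 * (\<bar>W\<bar> * (exp B * K * (1 + Kl))) + \<bar>W\<bar> * (exp LB * Kl' + KL * exp LB * Kl) / c"
    define Kphi where "Kphi = 1 + \<bar>W\<bar> * exp b + 2 * (\<bar>W\<bar> * (exp b * N))"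
    define Kc where "Kc = max Kphi (max (Kd * exp (1 + b) * sqrt (2 * pi) ^ 3) (Ke * exp (1 + b) * sqrt (2 * pi) ^ 3))"
    have D0: "D > 0" using geo(3)[of Tm] T by (simp add: D_def)
    have N': "N' \<ge> 1" "N \<le> N'" "exp b \<le> N'" using geo(6) by (auto simp: N'_def)
    have kk: "k1' \<ge> 0" "k2' \<ge> 0" using c N' by (simp_all add: k1'_def k2'_def)
    have CQ: "CQ > 0" unfolding CQ_def using q kk D0 N' by (intro divide_pos_pos add_pos_nonneg) auto
    have SB: "SB \<ge> 0" unfolding SB_def by simp
    have Kd: "Kd > 0" and Ke: "Ke > 0" using SB m c by (auto simp: Kd_def Ke_def intro!: add_pos_nonneg)
    have Kl0: "Kl \<ge> 0" "Kl' \<ge> 0" "KL \<ge> 0" using l_le[of 0] l'_le[of 0] L1_le[of 0] by linarith+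
    have M0: "M \<ge> 0" unfolding M_def using Kl0 geo(5) c by (intro add_nonneg_nonneg mult_nonneg_nonneg divide_nonneg_nonneg) auto
    have c0: "c0 > 0" using m c by (simp add: c0_def c3_def)
    show ?thesis
    proof (rule that[OF c0])
      fix e :: real assume e: "0 < e" "e \<le> 1"
      \<comment> \<open>The bound of \<open>sphere_integral_le\<close> with
        \<open>aa = R\<^sup>2\<close> already inserted.\<close>
      have lim: "((\<lambda>R::real. 2 * pi\<^sup>2 * R\<^sup>2 * (Kd * exp (1 + b) / (R\<^sup>2) ^ 3 * exp (- R\<^sup>2 / (2 * (R\<^sup>2)\<^sup>2)))) \<longlongrightarrow> 0) (at_right 0)"
        by real_asymp
      have "eventually (\<lambda>R. 2 * pi\<^sup>2 * R\<^sup>2 * (Kd * exp (1 + b) / (R\<^sup>2) ^ 3 * exp (- R\<^sup>2 / (2 * (R\<^sup>2)\<^sup>2))) < e) (at_right (0::real))"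
        by (rule order_tendstoD(2)[OF lim e(1)])
      moreover have "eventually (\<lambda>R. R < e / (2 * (M + 1))) (at_right (0::real))"
        by (rule order_tendstoD(2)[OF tendsto_ident_at]) (use e M0 in auto)
      moreover have "eventually (\<lambda>R. R < e) (at_right (0::real))"
        by (rule order_tendstoD(2)[OF tendsto_ident_at]) (use e in auto)
      ultimately have "eventually (\<lambda>R. 0 < R \<and> 2 * pi\<^sup>2 * R\<^sup>2 * (Kd * exp (1 + b) / (R\<^sup>2) ^ 3 * exp (- R\<^sup>2 / (2 * (R\<^sup>2)\<^sup>2))) < e
         \<and> R < e / (2 * (M + 1)) \<and> R < e) (at_right 0)"
        using eventually_at_right_less[of "0::real"] by eventually_elim blast
      then obtain R where R: "0 < R" "2 * pi\<^sup>2 * R\<^sup>2 * (Kd * exp (1 + b) / (R\<^sup>2) ^ 3 * exp (- R\<^sup>2 / (2 * (R\<^sup>2)\<^sup>2))) < e"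
         "R < e / (2 * (M + 1))" "R < e"
        using eventually_happens'[OF trivial_limit_at_right_real] by blast
      \<comment> \<open>With this choice \<open>R / aa = 1 / R\<close> is unbounded as
        \<open>R\<close> tends to 0, and the Gaussian at distance \<open>R\<close> is
        \<open>exp (- 1 / (2 * R\<^sup>2))\<close>, which beats every power of
        \<open>R\<close>.\<close>
      define aa where "aa = R\<^sup>2"
      have R1: "R \<le> 1" using R(4) e by simp
      have aa: "0 < aa" "aa \<le> R" using R(1) R1 by (simp_all add: aa_def power2_eq_square mult_left_le)
      have RM: "R * M \<le> e / 2"
      proof -
        have "R * (2 * (M + 1)) < e" using R(3) M0 by (simp add: pos_less_divide_eq)
        thus ?thesis using R(1) by (simp add: algebra_simps)
      qed
      obtain t0 t1 y0 y1 P X H where fld: "field t0 t1 y0 y1 c m q aa P X H T1 T2 Z1 Z2 z0"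
        and bnd: "\<And>t z. t\<in>{T1<..<T2} \<Longrightarrow> z\<in>{Z1<..<Z2} \<Longrightarrow> \<bar>poly P (X (z + c * t))\<bar> \<le> b \<and> \<bar>poly (pderiv P) (X (z + c * t))\<bar> \<le> N"
        and tube: "\<And>t z. t\<in>{Tm..Tp} \<Longrightarrow> \<bar>z - r t\<bar> \<le> R \<Longrightarrow>
            \<bar>poly P (X (z + c * t)) - L t\<bar> \<le> K * R \<and> \<bar>poly (pderiv P) (X (z + c * t)) - l t\<bar> \<le> K * R \<and>
            \<bar>z - r t\<bar> - aa \<le> \<bar>X (z + c * t) + (z - c * t)\<bar> \<and>
            \<bar>X (z + c * t) + (z - c * t)\<bar> \<le> (1 + exp b) * \<bar>z - r t\<bar> + aa"
        using ex[OF aa R1] by blast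
      \<comment> \<open>The admissible size of the corrections: the second bound keeps the integral
        of \<open>omt\<close> at most 1, the third keeps their share in the error of the potential
        below \<open>e / 2\<close>.\<close>
      define rr where "rr = min 1 (min (1 / (k1' * D + 1)) (e / (2 * CQ * (2 + 1 / c))))"
      have k1D: "k1' * D \<ge> 0" using kk D0 by simp
      have cc: "2 + 1 / c > 0" using c by (simp add: add_pos_pos)
      have rr: "0 < rr" "rr \<le> 1" "k1' * rr * D \<le> 1" "CQ * rr * (2 + 1 / c) \<le> e / 2"
      proof -
        show r0: "0 < rr" using k1D e CQ cc by (simp add: rr_def add_nonneg_pos)
        show "rr \<le> 1" by (simp add: rr_def)
        have "rr \<le> 1 / (k1' * D + 1)" by (simp add: rr_def)
        hence "rr * (k1' * D + 1) \<le> 1" using k1D by (simp add: pos_le_divide_eq add_nonneg_pos)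
        thus "k1' * rr * D \<le> 1" using r0 by (simp add: algebra_simps)
        have "rr \<le> e / (2 * CQ * (2 + 1 / c))" by (simp add: rr_def)
        moreover have "0 < 2 * CQ * (2 + 1 / c)" using CQ cc by (intro mult_pos_pos) auto
        ultimately have "rr * (2 * CQ * (2 + 1 / c)) \<le> e" by (simp only: pos_le_divide_eq)
        moreover have "rr * (2 * CQ * (2 + 1 / c)) = 2 * (CQ * rr * (2 + 1 / c))" by (simp only: mult_ac)
        ultimately show "CQ * rr * (2 + 1 / c) \<le> e / 2" by linarith
      qed
      obtain ch0 where ch0: "ch0 > 0" "\<And>ch. 0 < ch \<Longrightarrow> ch < ch0 \<Longrightarrow>
        \<exists>kj pp Om Ph R1. sol t0 t1 y0 y1 c m q aa P X H T1 T2 Z1 Z2 z0 ch rr R1 kj pp Om Ph"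
        using field.exists_sol[OF fld rr(1)] by blast
      define mu where "mu = 1 / aa\<^sup>2"
      define Y where "Y = (1 + exp b) + 1"
      define QQ where "QQ = mu * Y * (exp b + 1) + N * exp b"
      define pl where "pl = \<bar>ln (pi powr (3/2))\<bar>"
      define LL where "LL = 2 * QQ\<^sup>2 + 2 * mu\<^sup>2 + mu * (mu * Y\<^sup>2 + b + 2 * mu + pl + 2)"
      have LL0: "LL \<ge> 0" unfolding LL_def using geo(4) by (intro add_nonneg_nonneg mult_nonneg_nonneg) (auto simp: mu_def pl_def)
      \<comment> \<open>One bound per requirement: existence of the solution, smallness,
        \<open>a_C / a \<le> 1\<close>, and dominance of the rest mass in the densities.\<close>
      define ch where "ch = min (min (ch0 / 2) e) (min (m * c * aa) (m * c / (2 * (LL + 1))))"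
      have mc: "m * c > 0" using m c by simp
      have ch: "0 < ch" "ch < ch0" "ch \<le> e" "ch \<le> m * c * aa" "ch \<le> m * c / (2 * (LL + 1))"
        using ch0(1) e mc aa LL0 unfolding ch_def by (auto simp: min_less_iff_disj)
      have chL: "ch\<^sup>2 * LL \<le> (m * c)\<^sup>2 / 2"
      proof -
        have 1: "ch * (2 * (LL + 1)) \<le> m * c" using ch(5) LL0 by (simp add: pos_le_divide_eq)
        have "ch * 1 \<le> ch * (2 * (LL + 1))" using ch(1) LL0 by (intro mult_left_mono) auto
        hence 2: "ch \<le> m * c" using 1 by simp
        have "ch * (ch * (2 * (LL + 1))) \<le> (m * c) * (m * c)" by (rule mult_mono[OF 2 1]) (use ch(1) LL0 mc in auto)
        moreover have "ch * (ch * (2 * (LL + 1))) = 2 * (ch\<^sup>2 * LL) + 2 * ch\<^sup>2" by (simp add: power2_eq_square algebra_simps)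
        ultimately show ?thesis using zero_le_power2[of ch] power2_eq_square[of "m * c"] by linarith
      qed
      obtain kj pp Om Ph R1' where sl: "sol t0 t1 y0 y1 c m q aa P X H T1 T2 Z1 Z2 z0 ch rr R1' kj pp Om Ph"
        using ch0(2)[OF ch(1,2)] by blast
      interpret S: sol t0 t1 y0 y1 c m q aa P X H T1 T2 Z1 Z2 z0 ch rr R1' kj pp Om Ph by (rule sl)
      have inV: "p \<in> S.V" if p: "fst p \<in> {Tm..Tp}" "norm (snd p - rhat r (fst p)) \<le> R" for p
        using component_minus_rhat_le(3)[OF p(2)] geo(1,2) geo(3)[OF p(1)] p(1) R1
        by (auto simp: S.V_def slab_def abs_le_iff)
      have inU: "S.nu p \<le> N'" "\<bar>S.A1 p\<bar> \<le> N'" "\<bar>S.A p\<bar> \<le> b" "\<bar>S.A1 p\<bar> \<le> N" if "p \<in> S.U" for p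
      proof -
        have h: "\<bar>S.A p\<bar> \<le> b \<and> \<bar>S.A1 p\<bar> \<le> N"
          using bnd[of "fst p" "snd p $ 3"] that by (auto simp: S.U_def slab_def S.A_def S.A1_def S.Xp_def)
        thus "\<bar>S.A1 p\<bar> \<le> N'" "\<bar>S.A p\<bar> \<le> b" "\<bar>S.A1 p\<bar> \<le> N" using N' by auto
        have "S.nu p \<le> exp b" using h by (auto simp: S.nu_def)
        thus "S.nu p \<le> N'" using N' by simp
      qed
      have CC: "S.CC N' = CQ" "S.C1 N' = k1'"
        by (simp_all only: S.CC_def S.C1_def S.C2_def CQ_def k1'_def k2'_def D_def)
      have pt: "S.yy p = X (snd p $ 3 + c * fst p) + (snd p $ 3 - c * fst p)" "S.A p = poly P (X (snd p $ 3 + c * fst p))"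
        "S.A1 p = poly (pderiv P) (X (snd p $ 3 + c * fst p))" for p
        by (simp_all add: S.yy_def S.Xp_def S.et_def S.A_def S.A1_def)
      have tb: "\<bar>S.A p - L (fst p)\<bar> \<le> K * R" "\<bar>S.A1 p - l (fst p)\<bar> \<le> K * R"
          "\<bar>snd p $ 3 - r (fst p)\<bar> - aa \<le> \<bar>S.yy p\<bar>" "\<bar>S.yy p\<bar> \<le> (1 + exp b) * \<bar>snd p $ 3 - r (fst p)\<bar> + aa"
        if p: "fst p \<in> {Tm..Tp}" "norm (snd p - rhat r (fst p)) \<le> R" for p
        using tube[OF p(1) component_minus_rhat_le(3)[OF p(2)]] unfolding pt by auto
      have dens: "0 \<le> conc_dens c m ch aa S.\<psi> p" "conc_dens c m ch aa S.\<psi> p \<le> Kd * (S.u p)\<^sup>2"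
          "m * c\<^sup>2 / 4 * (S.u p)\<^sup>2 \<le> energy_density c m q ch aa S.\<phi> S.\<psi> p" "energy_density c m q ch aa S.\<phi> S.\<psi> p \<le> Ke * (S.u p)\<^sup>2"
        if p: "fst p \<in> {Tm..Tp}" "norm (snd p - rhat r (fst p)) \<le> R" for p
      proof -
        have pV: "p \<in> S.V" by (rule inV[OF p])
        hence pU: "p \<in> S.U" using S.V_subset by auto
        note cm = component_minus_rhat_le[OF p(2)]
        have x: "\<bar>snd p $ 1\<bar> \<le> 1" "\<bar>snd p $ 2\<bar> \<le> 1" using cm R1 by auto
        have "(1 + exp b) * \<bar>snd p $ 3 - r (fst p)\<bar> \<le> (1 + exp b) * 1"
          using cm(3) R1 by (intro mult_left_mono) (auto intro: add_nonneg_nonneg)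
        hence y: "\<bar>S.yy p\<bar> \<le> Y" using tb(4)[OF p] aa R1 by (simp add: Y_def)
        have mu: "S.\<mu> = mu" by (simp add: S.\<mu>_def mu_def)
        note cf = S.coefficient_bound[OF inU(3)[OF pU] inU(4)[OF pU] geo(4) y x refl refl, unfolded mu, folded QQ_def pl_def, folded LL_def]
        have z: "\<bar>zint z0 S.omt p\<bar> \<le> 1"
          using S.zint_omt_bound[OF inU(1) inU(2) N'(1) pV] rr(3) unfolding CC D_def[symmetric] by linarith
        note db = S.density_bounds[OF pV inU(3)[OF pU] z rr(2) cf[folded mu] chL]
        have SBe: "S.Sb b = SB" by (simp add: S.Sb_def SB_def)
        show "0 \<le> conc_dens c m ch aa S.\<psi> p" by (rule db(1))
        show "conc_dens c m ch aa S.\<psi> p \<le> Kd * (S.u p)\<^sup>2" using db(2) by (simp only: SBe Kd_def)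
        show "m * c\<^sup>2 / 4 * (S.u p)\<^sup>2 \<le> energy_density c m q ch aa S.\<phi> S.\<psi> p" by (rule db(3))
        show "energy_density c m q ch aa S.\<phi> S.\<psi> p \<le> Ke * (S.u p)\<^sup>2" using db(4) by (simp only: SBe Ke_def)
      qed
      have uu: "(S.u p)\<^sup>2 \<le> exp (1 + b) / aa ^ 3 * exp (- (norm (snd p - rhat r (fst p)))\<^sup>2 / (2 * aa\<^sup>2))"
        if p: "fst p \<in> {Tm..Tp}" "norm (snd p - rhat r (fst p)) \<le> R" for p
        unfolding norm_minus_rhat
        by (rule S.u_square_upper[OF inU(3) tb(3)[OF p]]) (use inV[OF p] S.V_subset in auto)
      have ul: "c3 / aa ^ 3 \<le> (S.u p)\<^sup>2"
        if p: "fst p \<in> {Tm..Tp}" "norm (snd p - rhat r (fst p)) \<le> aa" for p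
      proof -
        have p': "norm (snd p - rhat r (fst p)) \<le> R" using p(2) aa by simp
        have "(norm (snd p - rhat r (fst p)))\<^sup>2 \<le> aa\<^sup>2" using p(2) by (intro power_mono) auto
        thus ?thesis unfolding norm_minus_rhat c3_def
          by (intro S.u_square_lower[OF inU(3) tb(4)[OF p(1) p']]) (use inV[OF p(1) p'] S.V_subset in auto)
      qed
      have omega: "p \<in> Omega_hat r R Tm Tp \<longleftrightarrow> fst p \<in> {Tm..Tp} \<and> norm (snd p - rhat r (fst p)) \<le> R" for p
        by (cases p) (auto simp: Omega_hat_def Omega_def dist_norm norm_minus_commute)
      have sub: "Omega_hat r R Tm Tp \<subseteq> S.V" using inV omega by blast
      have cont: "continuous_on (cball (rhat r t) R) (\<lambda>x. f (t, x))" if f: "continuous_on S.V f" and t: "t \<in> {Tm..Tp}" for f :: "pt \<Rightarrow> real" and t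
        by (rule continuous_on_compose2[OF f]) (use t in \<open>auto intro!: continuous_intros inV simp: dist_norm norm_minus_commute\<close>)
      have phi: "\<bar>S.\<phi> p\<bar> + grad0_norm c S.\<phi> p \<le> Kc \<and>
            \<bar>S.\<phi> p - phinf (m * c\<^sup>2 / q) p\<bar> + grad0_norm c (\<lambda>p. S.\<phi> p - phinf (m * c\<^sup>2 / q) p) p \<le> e"
        if p: "fst p \<in> {Tm..Tp}" "norm (snd p - rhat r (fst p)) \<le> R" for p
      proof -
        have pV: "p \<in> S.V" by (rule inV[OF p])
        hence pU: "p \<in> S.U" using S.V_subset by auto
        define t where "t = fst p"
        define w where "w = snd p $ 3 - r t"
        have w: "\<bar>w\<bar> \<le> R" using component_minus_rhat_le(3)[OF p(2)] by (simp add: w_def t_def)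
        obtain ft fz' where ft: "d4 S.\<phi> ft 0 0 fz' p"
          and est: "\<bar>S.\<phi> p - m * c\<^sup>2 / q * exp (S.A p / 2)\<bar> \<le> S.CC N' * rr"
            "\<bar>ft - c * (m * c\<^sup>2 / q * (exp (S.A p / 2) * (S.A1 p * S.nu p / 2)))\<bar> \<le> S.CC N' * rr"
            "\<bar>fz' - m * c\<^sup>2 / q * (exp (S.A p / 2) * (S.A1 p * S.nu p / 2))\<bar> \<le> S.CC N' * rr"
          using S.phi_estimate[OF inU(1) inU(2) N'(1) pV] by blast
        define E where "E = CQ * rr"
        define G where "G = W * (exp (- S.A p / 2) * S.A1 p / 2)"
        have "exp (S.A p / 2) * S.nu p = exp (- S.A p / 2)" by (simp add: S.nu_def flip: exp_add)
        hence "exp (S.A p / 2) * (S.A1 p * S.nu p / 2) = exp (- S.A p / 2) * S.A1 p / 2"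
          by (metis mult.assoc mult.commute times_divide_eq_right)
        hence est': "\<bar>S.\<phi> p - W * exp (S.A p / 2)\<bar> \<le> E" "\<bar>ft - c * G\<bar> \<le> E" "\<bar>fz' - G\<bar> \<le> E"
          using est unfolding CC by (simp_all only: W_def E_def G_def)
        have AB: "\<bar>S.A p\<bar> \<le> B" using inU(3)[OF pU] by (simp add: B_def)
        note ee = exp_estimates[OF AB tb(1,2)[OF p], folded t_def, of W]
        have LBB: "LB \<le> B" by (simp add: B_def)
        have d: "d4 (\<lambda>p. S.\<phi> p - phinf W p) (ft - (c * gz W t + w * gz' W t)) 0 0 (fz' - gz W t) p"
          using d4_diff[OF ft d4_phinf[of W p]] by (simp add: t_def w_def)
        define e1 e2 g3 g4 where "e1 = \<bar>W\<bar> * (exp B * (K * R))" and "e2 = \<bar>W\<bar> * (exp B * (K * R) * (1 + Kl))"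
          and "g3 = \<bar>W\<bar> * (exp LB * Kl)" and "g4 = \<bar>W\<bar> * (exp LB * Kl' + KL * exp LB * Kl)"
        have wg: "\<bar>w * gz W t\<bar> \<le> R * g3" "\<bar>w * gz' W t\<bar> \<le> R * g4"
          unfolding g3_def g4_def by (intro abs_mult_le w gz_bound gz'_bound)+
        have a1: "\<bar>S.\<phi> p - phinf W p\<bar> \<le> E + e1 + R * g3"
        proof -
          have "phinf W p = fz W t + w * gz W t" by (simp add: phinf_eq t_def w_def)
          thus ?thesis using est'(1) ee(1)[OF LBB] wg(1) unfolding e1_def by linarith
        qed
        have a2: "\<bar>ft - (c * gz W t + w * gz' W t)\<bar> \<le> E + c * e2 + R * g4"
        proof -
          have "\<bar>c * (G - gz W t)\<bar> \<le> c * e2"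
            unfolding G_def e2_def using ee(2)[OF LBB] c by (intro abs_mult_le) auto
          hence "\<bar>c * G - c * gz W t\<bar> \<le> c * e2" by (simp only: right_diff_distrib)
          thus ?thesis using est'(2) wg(2) by linarith
        qed
        have a3: "\<bar>fz' - gz W t\<bar> \<le> E + e2"
          using est'(3) ee(2)[OF LBB] unfolding G_def e2_def by linarith
        have a2': "\<bar>ft - (c * gz W t + w * gz' W t)\<bar> / c \<le> E / c + e2 + R * g4 / c"
          using divide_right_mono[OF a2, of c] c by (simp add: add_divide_distrib)
        have tot: "E * (2 + 1 / c) + R * M = (E + e1 + R * g3) + (E / c + e2 + R * g4 / c) + (E + e2)"
          unfolding M_def e1_def e2_def g3_def g4_def by (simp add: algebra_simps)
        have Ee: "E * (2 + 1 / c) \<le> e / 2" using rr(4) by (simp add: E_def)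
        have fin: "\<bar>S.\<phi> p - phinf W p\<bar> + grad0_norm c (\<lambda>p. S.\<phi> p - phinf W p) p \<le> e"
          using grad0_norm_le[OF c d] a1 a2' a3 tot Ee RM by linarith
        have Gb: "\<bar>G\<bar> \<le> \<bar>W\<bar> * (exp b * N)"
        proof -
          have "\<bar>exp (- S.A p / 2) * S.A1 p\<bar> \<le> exp b * N"
            by (intro abs_mult_le inU(4)[OF pU]) (use inU(3)[OF pU] in auto)
          hence "\<bar>exp (- S.A p / 2) * S.A1 p / 2\<bar> \<le> exp b * N" by simp
          thus ?thesis unfolding G_def by (intro abs_mult_le) auto
        qed
        have b1: "\<bar>W * exp (S.A p / 2)\<bar> \<le> \<bar>W\<bar> * exp b"
          by (intro abs_mult_le) (use inU(3)[OF pU] in auto)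
        have b2: "\<bar>ft\<bar> / c \<le> E / c + \<bar>W\<bar> * (exp b * N)"
        proof -
          have "\<bar>c * G\<bar> \<le> c * (\<bar>W\<bar> * (exp b * N))" using Gb c by (intro abs_mult_le) auto
          hence "\<bar>ft\<bar> \<le> E + c * (\<bar>W\<bar> * (exp b * N))" using est'(2) by linarith
          from divide_right_mono[OF this, of c] show ?thesis using c by (simp add: add_divide_distrib)
        qed
        have tot2: "E * (2 + 1 / c) = E + E / c + E" by (simp add: algebra_simps)
        have "\<bar>S.\<phi> p\<bar> + grad0_norm c S.\<phi> p \<le> Kphi"
          using grad0_norm_le[OF c ft] est'(1,3) b1 b2 Gb tot2 Ee e unfolding Kphi_def by linarith
        thus ?thesis using fin by (simp add: W_def Kc_def)
      qed
      have integrals: "integral (Omega r R t) (\<lambda>x. conc_dens c m ch aa S.\<psi> (t, x)) \<le> Kc \<and>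
            sphere_integral (\<lambda>x. conc_dens c m ch aa S.\<psi> (t, x)) (rhat r t) R \<le> e \<and>
            c0 \<le> Ebar c m q r R ch aa S.\<phi> S.\<psi> t \<and> Ebar c m q r R ch aa S.\<phi> S.\<psi> t \<le> Kc" if t: "t \<in> {Tm..Tp}" for t
      proof (intro conjI)
        have up: "f \<le> (k * exp (1 + b)) / aa ^ 3 * exp (- (norm (x - rhat r t))\<^sup>2 / (2 * aa\<^sup>2))"
          if "k > 0" "f \<le> k * (S.u (t, x))\<^sup>2" "norm (x - rhat r t) \<le> R" for k f x
          using mult_left_mono[OF uu[of "(t, x)"], of k] that t by (simp add: mult_ac)
        have nb: "norm (x - rhat r t) \<le> R" if "x \<in> cball (rhat r t) R" for x using that by (simp add: dist_norm norm_minus_commute)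
        have "integral (cball (rhat r t) R) (\<lambda>x. conc_dens c m ch aa S.\<psi> (t, x)) \<le> (Kd * exp (1 + b)) * sqrt (2 * pi) ^ 3"
          by (rule ball_integral_upper[OF aa(1) cont[OF S.continuous_densities(1) t]])
            (use Kd up[OF Kd dens(2)] nb t in auto)
        thus "integral (Omega r R t) (\<lambda>x. conc_dens c m ch aa S.\<psi> (t, x)) \<le> Kc" by (simp add: Omega_def Kc_def)
        have "integral (cball (rhat r t) R) (\<lambda>x. energy_density c m q ch aa S.\<phi> S.\<psi> (t, x)) \<le> (Ke * exp (1 + b)) * sqrt (2 * pi) ^ 3"
          by (rule ball_integral_upper[OF aa(1) cont[OF S.continuous_densities(2) t]])
            (use Ke up[OF Ke dens(4)] nb t in auto)
        thus "Ebar c m q r R ch aa S.\<phi> S.\<psi> t \<le> Kc" by (simp add: Ebar_def Omega_def Kc_def)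
        have en0: "0 \<le> energy_density c m q ch aa S.\<phi> S.\<psi> (t, x)" if "norm (x - rhat r t) \<le> R" for x
          by (rule order_trans[OF _ dens(3)]) (use that t m in auto)
        have enl: "(m * c\<^sup>2 / 4 * c3) / aa ^ 3 \<le> energy_density c m q ch aa S.\<phi> S.\<psi> (t, x)" if x: "norm (x - rhat r t) \<le> aa" for x
        proof -
          have "m * c\<^sup>2 / 4 * (c3 / aa ^ 3) \<le> m * c\<^sup>2 / 4 * (S.u (t, x))\<^sup>2"
            using ul[of "(t, x)"] x t m by (intro mult_left_mono) auto
          also have "\<dots> \<le> energy_density c m q ch aa S.\<phi> S.\<psi> (t, x)" using dens(3)[of "(t, x)"] x t aa by simp
          finally show ?thesis by simp
        qed
        have "(m * c\<^sup>2 / 4 * c3) * unit_ball_vol 3 \<le> integral (cball (rhat r t) R) (\<lambda>x. energy_density c m q ch aa S.\<phi> S.\<psi> (t, x))"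
          by (rule ball_integral_lower[OF aa cont[OF S.continuous_densities(2) t]])
            (use en0 enl in \<open>auto simp: dist_norm norm_minus_commute\<close>)
        thus "c0 \<le> Ebar c m q r R ch aa S.\<phi> S.\<psi> t" by (simp add: Ebar_def Omega_def c0_def)
        have "sphere_integral (\<lambda>x. conc_dens c m ch aa S.\<psi> (t, x)) (rhat r t) R
           \<le> 2 * pi\<^sup>2 * R\<^sup>2 * (Kd * exp (1 + b) / aa ^ 3 * exp (- R\<^sup>2 / (2 * aa\<^sup>2)))"
        proof (rule sphere_integral_le)
          show "0 \<le> Kd * exp (1 + b) / aa ^ 3 * exp (- R\<^sup>2 / (2 * aa\<^sup>2))" using Kd aa by simp
          fix x assume x: "norm (x - rhat r t) = R"
          show "\<bar>conc_dens c m ch aa S.\<psi> (t, x)\<bar> \<le> Kd * exp (1 + b) / aa ^ 3 * exp (- R\<^sup>2 / (2 * aa\<^sup>2))"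
            using up[OF Kd dens(2)[of "(t, x)"]] dens(1)[of "(t, x)"] x t by simp
        qed (use R in simp)
        thus "sphere_integral (\<lambda>x. conc_dens c m ch aa S.\<psi> (t, x)) (rhat r t) R \<le> e"
          using R(2) unfolding aa_def by linarith
      qed
      show "\<exists>aa R ch \<phi> \<psi>. scaled_solution m q Tm Tp Kc c0 e aa R ch \<phi> \<psi>"
        unfolding scaled_solution_def
      proof (rule exI[of _ aa], rule exI[of _ R], rule exI[of _ ch], rule exI[of _ "S.\<phi>"], rule exI[of _ "S.\<psi>"], intro conjI)
        show "ch / (m * c) / aa \<le> 1" using ch(4) mc aa by (simp add: divide_le_eq)
        have "R / aa = 1 / R" using R(1) by (simp add: aa_def power2_eq_square)
        thus "1 / e \<le> R / aa" using R(1,4) by (simp add: frac_le)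
        show "C2_on S.\<phi> (Omega_hat r R Tm Tp)" "C2_on S.\<psi> (Omega_hat r R Tm Tp)"
          by (rule ck_2_imp_C2_on[OF S.open_V sub], rule S.ck_phi S.ck_psi)+
        show "\<forall>p\<in>Omega_hat r R Tm Tp. KG_eq c m q ch aa S.\<phi> S.\<psi> p \<and> \<bar>S.\<phi> p\<bar> + grad0_norm c S.\<phi> p \<le> Kc \<and>
            \<bar>S.\<phi> p - phinf (m * c\<^sup>2 / q) p\<bar> + grad0_norm c (\<lambda>p. S.\<phi> p - phinf (m * c\<^sup>2 / q) p) p \<le> e"
          using S.KG_solution sub phi omega by blast
        show "\<forall>t\<in>{Tm..Tp}. integral (Omega r R t) (\<lambda>x. conc_dens c m ch aa S.\<psi> (t, x)) \<le> Kc \<and>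
            sphere_integral (\<lambda>x. conc_dens c m ch aa S.\<psi> (t, x)) (rhat r t) R \<le> e \<and>
            c0 \<le> Ebar c m q r R ch aa S.\<phi> S.\<psi> t \<and> Ebar c m q r R ch aa S.\<phi> S.\<psi> t \<le> Kc"
          using integrals by blast
      qed (use aa R ch in auto)
    qed
  qed
qed

end

section \<open>From single scales to the sequence\<close>

lemma (in traj) exists_concentrating:
  assumes T: "Tm < Tp" and m: "m > 0" and q: "q \<noteq> 0"
  shows "\<exists>a R ch \<phi>. localized_KG c m r Tm Tp a R ch \<phi> \<and> (\<exists>\<psi>. concentrating c m q r Tm Tp a R ch \<phi> \<psi>)"
proof (rule exists_scaled_solution[OF T m q])
  fix Kc c0 :: real
  define W where "W = m * c\<^sup>2 / q"
  assume c0: "c0 > 0" and sc: "\<And>e. 0 < e \<Longrightarrow> e \<le> 1 \<Longrightarrow> \<exists>aa R ch \<phi> \<psi>. scaled_solution m q Tm Tp Kc c0 e aa R ch \<phi> \<psi>"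
  have "\<exists>aa R ch \<phi> \<psi>. scaled_solution m q Tm Tp Kc c0 (inverse (real (Suc n))) aa R ch \<phi> \<psi>" for n
    by (rule sc) (simp_all add: inverse_le_1_iff)
  note ex = this
  define S where "S n x \<longleftrightarrow> scaled_solution m q Tm Tp Kc c0 (inverse (real (Suc n))) (fst x) (fst (snd x)) (fst (snd (snd x))) (fst (snd (snd (snd x))))
    (snd (snd (snd (snd x))))" for n x
  have "\<forall>n. \<exists>x. S n x"
  proof
    fix n
    from ex[of n] obtain aa R ch \<phi> \<psi> where "scaled_solution m q Tm Tp Kc c0 (inverse (real (Suc n))) aa R ch \<phi> \<psi>" by (elim exE)
    hence "S n (aa, R, ch, \<phi>, \<psi>)" by (simp only: S_def fst_conv snd_conv)
    thus "\<exists>x. S n x" ..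
  qed
  from choice[OF this] obtain F where "\<forall>n. S n (F n)" ..
  hence F: "\<And>n. scaled_solution m q Tm Tp Kc c0 (inverse (real (Suc n))) (fst (F n)) (fst (snd (F n))) (fst (snd (snd (F n))))
      (fst (snd (snd (snd (F n))))) (snd (snd (snd (snd (F n)))))"
    by (simp only: S_def)
  define E where "E n = Ebar c m q r (fst (snd (F n))) (fst (snd (snd (F n)))) (fst (F n))
      (fst (snd (snd (snd (F n))))) (snd (snd (snd (snd (F n))))) Tm" for n
  have Tm: "Tm \<in> {Tm..Tp}" using T by simp
  \<comment> \<open>\<open>Tm\<close> serves as the time \<open>t0\<close> of the energy condition;
    compactness applies because \<open>c0\<close> and \<open>Kc\<close> do not depend on
    \<open>n\<close>.\<close>
  have "E n \<in> {c0..Kc}" for n using F[of n] Tm unfolding scaled_solution_def E_def by simp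
  then obtain lim s where s: "strict_mono s" "(E \<circ> s) \<longlonglongrightarrow> lim"
    using seq_compactE[OF compact_imp_seq_compact[OF compact_Icc]] by metis
  define aa R ch \<phi> \<psi> e where "aa n = fst (F (s n))" and "R n = fst (snd (F (s n)))" and "ch n = fst (snd (snd (F (s n))))"
    and "\<phi> n = fst (snd (snd (snd (F (s n)))))" and "\<psi> n = snd (snd (snd (snd (F (s n)))))" and "e n = inverse (real (Suc (s n)))" for n
  have Q: "scaled_solution m q Tm Tp Kc c0 (e n) (aa n) (R n) (ch n) (\<phi> n) (\<psi> n)" for n
    using F[of "s n"] by (simp only: aa_def R_def ch_def \<phi>_def \<psi>_def e_def)
  note Q = Q[unfolded scaled_solution_def, folded W_def]
  have e: "e \<longlonglongrightarrow> 0"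
    using LIMSEQ_subseq_LIMSEQ[OF LIMSEQ_inverse_real_of_nat s(1)] by (simp add: e_def[abs_def] o_def)
  have e0: "e n > 0" for n by (simp add: e_def)
  have small: "\<forall>\<^sub>F n in sequentially. e n \<le> \<epsilon>" if "\<epsilon> > 0" for \<epsilon>
    using order_tendstoD(2)[OF e that] by eventually_elim simp
  have null: "f \<longlonglongrightarrow> 0" if "\<And>n. 0 < f n \<and> f n \<le> e n" for f
    by (rule tendsto_sandwich[OF _ _ tendsto_const e]) (use that in \<open>auto intro!: always_eventually less_imp_le\<close>)
  have "filterlim (\<lambda>n. 1 / e n) at_top sequentially"
    using filterlim_inverse_at_top[OF e] e0 by (simp add: inverse_eq_divide)
  hence top: "filterlim (\<lambda>n. R n / aa n) at_top sequentially"
    by (rule filterlim_at_top_mono) (use Q in auto)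
  have nn: "\<bar>W\<bar> * (exp LB * Kl) \<ge> 0" "\<bar>W\<bar> * exp LB \<ge> 0" "\<bar>W\<bar> * (exp LB * Kl' + KL * exp LB * Kl) \<ge> 0"
    using order_trans[OF abs_ge_zero gz_bound] order_trans[OF abs_ge_zero fz_bound] order_trans[OF abs_ge_zero gz'_bound] by blast+
  define g :: "real \<Rightarrow> real^3" where "g t = gz W t *\<^sub>R axis 3 1" for t
  have g: "(g has_vector_derivative gz' W t *\<^sub>R axis 3 1) (at t)" for t
    unfolding g_def[abs_def]
    using has_vector_derivative_scaleR[OF gz_deriv[of W t] has_vector_derivative_const[of "axis 3 1 :: real^3"]] by simp
  have "\<exists>C. \<forall>t\<in>{Tm..Tp}. \<bar>fz W t\<bar> \<le> C \<and> norm (g t) \<le> C \<and> norm (vector_derivative g (at t)) \<le> C"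
  proof (intro exI ballI conjI)
    fix t
    let ?C = "\<bar>W\<bar> * exp LB + \<bar>W\<bar> * (exp LB * Kl) + \<bar>W\<bar> * (exp LB * Kl' + KL * exp LB * Kl)"
    show "\<bar>fz W t\<bar> \<le> ?C" using fz_bound[of W t] nn by linarith
    have "norm (g t) = \<bar>gz W t\<bar>" by (simp add: g_def)
    thus "norm (g t) \<le> ?C" using gz_bound[of W t] nn by linarith
    have "norm (vector_derivative g (at t)) = \<bar>gz' W t\<bar>" by (simp add: vector_derivative_at[OF g])
    thus "norm (vector_derivative g (at t)) \<le> ?C" using gz'_bound[of W t] nn by linarith
  qed
  moreover have "\<forall>t. fz W differentiable at t \<and> g differentiable at t"
    using fz_deriv g by (meson differentiableI_vector has_real_derivative_iff_has_vector_derivative)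
  moreover have "\<forall>\<epsilon>>0. \<forall>\<^sub>F n in sequentially. \<forall>p\<in>Omega_hat r (R n) Tm Tp.
             \<bar>\<phi> n p - phinf W p\<bar> + grad0_norm c (\<lambda>q. \<phi> n q - phinf W q) p \<le> \<epsilon>"
  proof (intro allI impI)
    fix \<epsilon> :: real assume "\<epsilon> > 0"
    from small[OF this] show "\<forall>\<^sub>F n in sequentially. \<forall>p\<in>Omega_hat r (R n) Tm Tp.
             \<bar>\<phi> n p - phinf W p\<bar> + grad0_norm c (\<lambda>q. \<phi> n q - phinf W q) p \<le> \<epsilon>"
      by eventually_elim (use Q order_trans in blast)
  qed
  moreover have "phinf W = (\<lambda>(t, x). fz W t + (x - rhat r t) \<bullet> g t)" by (simp only: phinf_def g_def)
  ultimately have lim: "\<exists>f0 g. (\<forall>t. f0 differentiable at t \<and> g differentiable at t) \<and>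
        (let \<phi>inf = (\<lambda>(t, x). f0 t + (x - rhat r t) \<bullet> g t) in
          (\<forall>\<epsilon>>0. \<forall>\<^sub>F n in sequentially. \<forall>p\<in>Omega_hat r (R n) Tm Tp.
             \<bar>\<phi> n p - \<phi>inf p\<bar> + grad0_norm c (\<lambda>q. \<phi> n q - \<phi>inf q) p \<le> \<epsilon>)) \<and>
        (\<exists>C. \<forall>t\<in>{Tm..Tp}. \<bar>f0 t\<bar> \<le> C \<and> norm (g t) \<le> C \<and>
             norm (vector_derivative g (at t)) \<le> C)"
    unfolding Let_def by (intro exI[of _ "fz W"] exI[of _ g]) simp
  have loc: "localized_KG c m r Tm Tp aa R ch \<phi>"
    unfolding localized_KG_def
  proof (intro conjI)
    show "\<exists>C. \<forall>n. ch n / (m * c) / aa n \<le> C" using Q by blast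
    show "\<exists>C. \<forall>n. \<forall>p\<in>Omega_hat r (R n) Tm Tp. \<bar>\<phi> n p\<bar> + grad0_norm c (\<phi> n) p \<le> C" using Q by blast
    show "\<forall>n. C2_on (\<phi> n) (Omega_hat r (R n) Tm Tp)" "\<forall>n. aa n > 0 \<and> ch n > 0 \<and> R n > 0" using Q by blast+
    show "aa \<longlonglongrightarrow> 0" "ch \<longlonglongrightarrow> 0" "R \<longlonglongrightarrow> 0" using Q by (blast intro: null)+
  qed (rule top lim)+
  have "concentrating c m q r Tm Tp aa R ch \<phi> \<psi>"
    unfolding concentrating_def
  proof (intro conjI)
    show "\<forall>n. C2_on (\<psi> n) (Omega_hat r (R n) Tm Tp) \<and>
          (\<forall>p\<in>Omega_hat r (R n) Tm Tp. KG_eq c m q (ch n) (aa n) (\<phi> n) (\<psi> n) p)" using Q by blast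
    show "\<exists>C. \<forall>n. \<forall>t\<in>{Tm..Tp}. integral (Omega r (R n) t) (\<lambda>x. conc_dens c m (ch n) (aa n) (\<psi> n) (t, x)) \<le> C"
      using Q by blast
    show "\<forall>\<epsilon>>0. \<forall>\<^sub>F n in sequentially. \<forall>t\<in>{Tm..Tp}.
        sphere_integral (\<lambda>x. conc_dens c m (ch n) (aa n) (\<psi> n) (t, x)) (rhat r t) (R n) \<le> \<epsilon>"
    proof (intro allI impI)
      fix \<epsilon> :: real assume "\<epsilon> > 0"
      from small[OF this] show "\<forall>\<^sub>F n in sequentially. \<forall>t\<in>{Tm..Tp}.
        sphere_integral (\<lambda>x. conc_dens c m (ch n) (aa n) (\<psi> n) (t, x)) (rhat r t) (R n) \<le> \<epsilon>"
        by eventually_elim (use Q order_trans in blast)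
    qed
    show "\<exists>c0>0. \<exists>n0. \<forall>n\<ge>n0. \<forall>t\<in>{Tm..Tp}. Ebar c m q r (R n) (ch n) (aa n) (\<phi> n) (\<psi> n) t \<ge> c0"
      using c0 Q by blast
    have "(\<lambda>n. Ebar c m q r (R n) (ch n) (aa n) (\<phi> n) (\<psi> n) Tm) = E \<circ> s"
      by (simp add: E_def aa_def R_def ch_def \<phi>_def \<psi>_def fun_eq_iff)
    hence "convergent (\<lambda>n. Ebar c m q r (R n) (ch n) (aa n) (\<phi> n) (\<psi> n) Tm)"
      using convergentI[OF s(2)] by (simp only:)
    thus "\<exists>t0\<in>{Tm..Tp}. convergent (\<lambda>n. Ebar c m q r (R n) (ch n) (aa n) (\<phi> n) (\<psi> n) t0)"
      using Tm by (rule bexI)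
  qed
  thus ?thesis using loc by blast
qed

theorem theorem4:
  fixes c m q :: real and r v v1 v2 :: "real \<Rightarrow> real"
  assumes "c > 0" and "m > 0" and "q \<noteq> 0"
    and "\<forall>t. (r has_real_derivative v t) (at t)"
    and "\<forall>t. (v has_real_derivative v1 t) (at t)"
    and "\<forall>t. (v1 has_real_derivative v2 t) (at t)"
    and "continuous_on UNIV v2"
    and "\<exists>C. \<forall>t. \<bar>v t\<bar> + \<bar>v1 t\<bar> + \<bar>v2 t\<bar> \<le> C"
    and "\<exists>\<beta>c \<epsilon>1. \<beta>c > 0 \<and> \<epsilon>1 < 1 \<and> (\<forall>t. \<beta>c \<le> \<bar>v t / c\<bar> \<and> \<bar>v t / c\<bar> \<le> \<epsilon>1)"
  shows "\<forall>Tm Tp. Tm < Tp \<longrightarrow>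
           (\<exists>a R ch \<phi>. localized_KG c m r Tm Tp a R ch \<phi> \<and>
              (\<exists>\<psi>. concentrating c m q r Tm Tp a R ch \<phi> \<psi>))"
proof -
  obtain C where C: "\<And>t. \<bar>v t\<bar> + \<bar>v1 t\<bar> + \<bar>v2 t\<bar> \<le> C" using assms(8) by blast
  obtain \<epsilon> where \<epsilon>: "\<epsilon> < 1" "\<And>t. \<bar>v t / c\<bar> \<le> \<epsilon>" using assms(9) by blast
  have "traj c C \<epsilon> r v v1 v2"
  proof
    show "0 \<le> \<epsilon>" using order_trans[OF abs_ge_zero \<epsilon>(2)] .
    show "C \<ge> 0" using C[of 0] by linarith
    show "\<bar>v t\<bar> \<le> \<epsilon> * c" for t using \<epsilon>(2)[of t] assms(1) by (simp add: pos_divide_le_eq)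
    show "\<bar>v1 t\<bar> \<le> C" "\<bar>v2 t\<bar> \<le> C" for t using C[of t] by linarith+
  qed (use assms \<epsilon> in auto)
  thus ?thesis using traj.exists_concentrating assms(2,3) by blast
qed

end
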